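(* Let $\mathfrak{g}$ be a simple Lie algebra over $\mathbb{C}$ of type $B_n$, $C_n$ or $D_n$, and let $\lambda$ be a dominant weight of $\mathfrak{g}$. If $\lambda \leq 2\rho$ in the dominance order and $\lambda \lesssim 2\rho$ in the coordinatewise order, then the irreducible representation $V_\lambda$ appears as an irreducible component of the exterior algebra $\Lambda\mathfrak{g}$ (where $\mathfrak{g}$ acts on $\Lambda \mathfrak{g}$ via the extension of the adjoint action).
   Context: Realize the root systems in $\mathbb{E}=\mathbb{R}^n$ with orthonormal basis $\varepsilon_1,\dots,\varepsilon_n$ as follows. Type $B_n$: positive roots $\{\varepsilon_i\pm\varepsilon_j\}_{i<j}\cup\{\varepsilon_1,\dots,\varepsilon_n\}$, simple roots $\varepsilon_1-\varepsilon_2,\dots,\varepsilon_{n-1}-\varepsilon_n,\varepsilon_n$, $\rho=\frac{1}{2}\big((2n-1)\varepsilon_1+(2n-3)\varepsilon_2+\dots+3\varepsilon_{n-1}+\varepsilon_n\big)$. Type $C_n$: positive roots $\{\varepsilon_i\pm\varepsilon_j\}_{i<j}\cup\{2\varepsilon_1,\dots,2\varepsilon_n\}$, simple roots $\varepsilon_1-\varepsilon_2,\dots,\varepsilon_{n-1}-\varepsilon_n,2\varepsilon_n$, $\rho=n\varepsilon_1+(n-1)\varepsilon_2+\dots+\varepsilon_n$. Type $D_n$: positive roots $\{\varepsilon_i\pm\varepsilon_j\}_{i<j}$, simple roots $\varepsilon_1-\varepsilon_2,\dots,\varepsilon_{n-1}-\varepsilon_n,\varepsilon_{n-1}+\varepsilon_n$,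 $\rho=(n-1)\varepsilon_1+(n-2)\varepsilon_2+\dots+\varepsilon_{n-1}$. $\rho$ is half the sum of the positive roots and $V_\lambda$ denotes the irreducible finite-dimensional representation of highest weight $\lambda$. The dominance order: $\mu\leq\lambda$ iff $\lambda-\mu$ is a sum of positive roots (a nonnegative integer combination). Coordinatewise order: writing dominant weights as $\lambda=\sum_i\lambda_i\varepsilon_i$, $\mu=\sum_i\mu_i\varepsilon_i$, we write $\mu\lesssim\lambda$ iff $\lambda_i-\mu_i\geq 0$ and $|\lambda_i|\geq|\mu_i|$ for all $i=1,\dots,n$. *)

theory Defs
  imports Complex_Main "HOL-Library.Product_Lexorder"
begin

section \<open>Root data (coordinates w.r.t. epsilon_1..epsilon_n, stored 0-based)\<close>

datatype lie_type = TypeB | TypeC | TypeD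

text \<open>Humphreys' convention for the classical types: B_n (n>=2), C_n (n>=3), D_n (n>=4).\<close>
definition valid_rank :: "lie_type \<Rightarrow> nat \<Rightarrow> bool" where
  "valid_rank T n = (case T of TypeB \<Rightarrow> n \<ge> 2 | TypeC \<Rightarrow> n \<ge> 3 | TypeD \<Rightarrow> n \<ge> 4)"

text \<open>Weights are functions nat => real; coordinate i (i < n) is the coefficient of epsilon_(i+1).\<close>
definition eps :: "nat \<Rightarrow> nat \<Rightarrow> real" where
  "eps i = (\<lambda>k. if k = i then 1 else 0)"

definition pos_roots :: "lie_type \<Rightarrow> nat \<Rightarrow> (nat \<Rightarrow> real) set" where
  "pos_roots T n =
     {(\<lambda>k. eps i k - eps j k) | i j. i < j \<and> j < n} \<union> {(\<lambda>k. eps i k + eps j k) | i j. i < j \<and> j < n} \<union>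
     (case T of TypeB \<Rightarrow> {eps i | i. i < n}
              | TypeC \<Rightarrow> {(\<lambda>k. 2 * eps i k) | i. i < n}
              | TypeD \<Rightarrow> {})"

definition two_rho :: "lie_type \<Rightarrow> nat \<Rightarrow> nat \<Rightarrow> real" where
  "two_rho T n i = (case T of
       TypeB \<Rightarrow> 2 * real n - 1 - 2 * real i
     | TypeC \<Rightarrow> 2 * (real n - real i)
     | TypeD \<Rightarrow> 2 * (real n - 1 - real i))"

definition dominant :: "lie_type \<Rightarrow> nat \<Rightarrow> (nat \<Rightarrow> real) \<Rightarrow> bool" where
  "dominant T n lam = (case T of
       TypeB \<Rightarrow> (\<forall>i. i + 1 < n \<longrightarrow> lam (i+1) \<le> lam i) \<and> lam (n-1) \<ge> 0 \<and>
                ((\<forall>i<n. lam i \<in> \<int>) \<or> (\<forall>i<n. lam i - 1/2 \<in> \<int>))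
     | TypeC \<Rightarrow> (\<forall>i. i + 1 < n \<longrightarrow> lam (i+1) \<le> lam i) \<and> lam (n-1) \<ge> 0 \<and>
                (\<forall>i<n. lam i \<in> \<int>)
     | TypeD \<Rightarrow> (\<forall>i. i + 2 < n \<longrightarrow> lam (i+1) \<le> lam i) \<and> \<bar>lam (n-1)\<bar> \<le> lam (n-2) \<and>
                ((\<forall>i<n. lam i \<in> \<int>) \<or> (\<forall>i<n. lam i - 1/2 \<in> \<int>)))"

definition dom_le :: "lie_type \<Rightarrow> nat \<Rightarrow> (nat \<Rightarrow> real) \<Rightarrow> (nat \<Rightarrow> real) \<Rightarrow> bool" where
  "dom_le T n mu lam = (\<exists>c :: (nat \<Rightarrow> real) \<Rightarrow> nat.
      \<forall>k<n. lam k - mu k = (\<Sum>\<alpha>\<in>pos_roots T n. real (c \<alpha>) * \<alpha> k))"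

definition coord_le :: "nat \<Rightarrow> (nat \<Rightarrow> real) \<Rightarrow> (nat \<Rightarrow> real) \<Rightarrow> bool" where
  "coord_le n mu lam = (\<forall>i<n. lam i - mu i \<ge> 0 \<and> \<bar>lam i\<bar> \<ge> \<bar>mu i\<bar>)"

type_synonym mat = "nat \<Rightarrow> nat \<Rightarrow> complex"

definition msize :: "lie_type \<Rightarrow> nat \<Rightarrow> nat" where
  "msize T n = (case T of TypeB \<Rightarrow> 2*n+1 | TypeC \<Rightarrow> 2*n | TypeD \<Rightarrow> 2*n)"

definition form :: "lie_type \<Rightarrow> nat \<Rightarrow> mat" where
  "form T n i j = (case T of
       TypeB \<Rightarrow> (if i + j = 2*n then 1 else 0)
     | TypeC \<Rightarrow> (if i + j + 1 = 2*n then (if i < n then 1 else -1) else 0)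
     | TypeD \<Rightarrow> (if i + j + 1 = 2*n then 1 else 0))"

definition mmul :: "nat \<Rightarrow> mat \<Rightarrow> mat \<Rightarrow> mat" where
  "mmul N A B = (\<lambda>i j. \<Sum>k<N. A i k * B k j)"

definition bracket :: "nat \<Rightarrow> mat \<Rightarrow> mat \<Rightarrow> mat" where
  "bracket N A B = (\<lambda>i j. mmul N A B i j - mmul N B A i j)"

definition lie :: "lie_type \<Rightarrow> nat \<Rightarrow> mat set" where
  "lie T n = {X. (\<forall>i j. (msize T n \<le> i \<or> msize T n \<le> j) \<longrightarrow> X i j = 0) \<and>
      (\<forall>i<msize T n. \<forall>j<msize T n.
         (\<Sum>k<msize T n. X k i * form T n k j) + (\<Sum>k<msize T n. form T n i k * X k j) = 0)}"

definition cartan :: "lie_type \<Rightarrow> nat \<Rightarrow> mat set" where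
  "cartan T n = {H \<in> lie T n. \<forall>i j. i \<noteq> j \<longrightarrow> H i j = 0}"

definition nplus :: "lie_type \<Rightarrow> nat \<Rightarrow> mat set" where
  "nplus T n = {X \<in> lie T n. \<forall>i j. j \<le> i \<longrightarrow> X i j = 0}"

text \<open>A weight evaluated on an element of the Cartan: epsilon_(i+1)(H) = H i i.\<close>
definition weight_val :: "nat \<Rightarrow> (nat \<Rightarrow> real) \<Rightarrow> mat \<Rightarrow> complex" where
  "weight_val n lam H = (\<Sum>i<n. complex_of_real (lam i) * H i i)"

text \<open>Elements of the exterior algebra of gl_N, in the basis e_S (S a finite set of matrix
  positions, wedge taken in increasing lexicographic order): functions S => coefficient.\<close>
type_synonym ext = "(nat \<times> nat) set \<Rightarrow> complex"

definition grid :: "nat \<Rightarrow> (nat \<times> nat) set" where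
  "grid N = {..<N} \<times> {..<N}"

definition wsign :: "(nat \<times> nat) set \<Rightarrow> (nat \<times> nat) set \<Rightarrow> complex" where
  "wsign S T = (-1) ^ card {(s, t). s \<in> S \<and> t \<in> T \<and> t < s}"

definition wedge :: "ext \<Rightarrow> ext \<Rightarrow> ext" where
  "wedge a b = (\<lambda>U. \<Sum>S\<in>Pow U. wsign S (U - S) * a S * b (U - S))"

definition ext_one :: ext where
  "ext_one = (\<lambda>U. if U = {} then 1 else 0)"

definition ext_zero :: ext where
  "ext_zero = (\<lambda>U. 0)"

definition vec :: "mat \<Rightarrow> ext" where
  "vec X = (\<lambda>U. if card U = 1 then X (fst (the_elem U)) (snd (the_elem U)) else 0)"

definition wedge_list :: "mat list \<Rightarrow> ext" where
  "wedge_list xs = foldr (\<lambda>X a. wedge (vec X) a) xs ext_one"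

definition Lam :: "lie_type \<Rightarrow> nat \<Rightarrow> ext set" where
  "Lam T n = {(\<lambda>U. \<Sum>i<k. c i * wedge_list (xs i) U) | (k::nat) c xs. \<forall>i<k. set (xs i) \<subseteq> lie T n}"

definition Emat :: "nat \<times> nat \<Rightarrow> mat" where
  "Emat p = (\<lambda>a b. if a = fst p \<and> b = snd p then 1 else 0)"

definition der :: "nat \<Rightarrow> mat \<Rightarrow> mat list \<Rightarrow> ext" where
  "der N X ms = (\<lambda>U. \<Sum>j<length ms. wedge_list (ms[j := bracket N X (ms ! j)]) U)"

definition act :: "lie_type \<Rightarrow> nat \<Rightarrow> mat \<Rightarrow> ext \<Rightarrow> ext" where
  "act T n X a = (\<lambda>U. \<Sum>S\<in>Pow (grid (msize T n)).
       a S * der (msize T n) X (map Emat (sorted_list_of_set S)) U)"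

definition submodule :: "lie_type \<Rightarrow> nat \<Rightarrow> ext set \<Rightarrow> bool" where
  "submodule T n W \<longleftrightarrow> W \<subseteq> Lam T n \<and> ext_zero \<in> W \<and>
     (\<forall>a\<in>W. \<forall>b\<in>W. (\<lambda>U. a U + b U) \<in> W) \<and>
     (\<forall>c. \<forall>a\<in>W. (\<lambda>U. c * a U) \<in> W) \<and>
     (\<forall>X\<in>lie T n. \<forall>a\<in>W. act T n X a \<in> W)"

definition irreducible_submodule :: "lie_type \<Rightarrow> nat \<Rightarrow> ext set \<Rightarrow> bool" where
  "irreducible_submodule T n W \<longleftrightarrow> submodule T n W \<and> W \<noteq> {ext_zero} \<and>
     (\<forall>W'. submodule T n W' \<and> W' \<subseteq> W \<longrightarrow> W' = {ext_zero} \<or> W' = W)"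

text \<open>W has highest weight lam: it contains a nonzero weight vector of weight lam killed by n+.
  An irreducible finite-dimensional module with this property is (isomorphic to) V_lam.\<close>
definition has_highest_weight :: "lie_type \<Rightarrow> nat \<Rightarrow> ext set \<Rightarrow> (nat \<Rightarrow> real) \<Rightarrow> bool" where
  "has_highest_weight T n W lam \<longleftrightarrow> (\<exists>v\<in>W. v \<noteq> ext_zero \<and>
     (\<forall>H\<in>cartan T n. act T n H v = (\<lambda>U. weight_val n lam H * v U)) \<and>
     (\<forall>X\<in>nplus T n. act T n X v = ext_zero))"

end

theory Submission
  imports Defs "HOL-Library.Function_Algebras" "HOL-Library.Multiset" "HOL-Computational_Algebra.Polynomial"
begin

text \<open>
  Let N be the size of the matrices. For a Young diagram B in Frobenius notation and an
  N by N matrix g with columns g_0, g_1, ..., put Psi(g) = wedge of the elements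
  theta(g_i, g_j) of the Lie algebra over the boxes (i,j) of B. The Gram kernel of the orbit
  map Psi is, up to a constant, the product over the columns c of the diagram of the Gram kernels
  of g_(c-1) \<and> ... \<and> g_0: both sides are unchanged when g is multiplied by an upper
  unitriangular matrix, which reduces the claim to a triangular Gram matrix, and a pencil
  g + t I makes the triangularization possible for large t. Hence every linear combination f(g)
  of products of minors of the prescribed sizes in the leading columns is an inner product of
  Psi(g) with a vector v in the span of all Psi(g). If f is not zero and is semi-invariant under
  the lower triangular matrices of the Lie algebra, then v is a highest weight vector, and a
  submodule of minimal dimension containing a vector of that weight is irreducible.

  Such functions f are products of contractions, by means of the invariant form, of
  one or two wedges of leading columns. A greedy schedule chooses the 0-1 sequence of the diagram
  and the contractions so that the total weight is lam. The coordinatewise bound makes the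
  contractions possible; the dominance order only contributes integrality and the parity of the
  sum of the coordinates.
\<close>

section \<open>Creation and annihilation operators\<close>

text \<open>The background is the action of GL(V) on V = C^N. Via theta the Lie algebra is the
  symmetric square of V in type C and the exterior square in types B and D. The exterior algebra of
  either square is a sum of Schur functors whose shapes have all arms one longer, respectively one
  shorter, than the corresponding legs; a 0-1 sequence of length N + 1, respectively N - 1, encodes
  such a shape. The kernel formula stands in for the GL(V)-theory: it identifies the module
  generated by Psi(1), so that it remains to find V_lam in the restriction of one such functor to
  the orthogonal or symplectic Lie algebra. The obstacle is the choice of the shape. The columns of
  lam are what is left after contraction. A symplectic contraction shortens one column by two; an
  orthogonal one changes two columns at the same time, each by one. So the columns of lam have to be
  grouped, by parity in type C and by equality in types B and D, while the column lengths on offer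
  are dictated by the letters read so far. This is where the parity of the coordinate sum is
  felt.\<close>

lemma sum_fun_apply: "(\<Sum>i\<in>I. f i) x = (\<Sum>i\<in>I. f i x)"
  by (induction I rule: infinite_finite_induct) auto

definition scl :: "complex \<Rightarrow> ('i \<Rightarrow> complex) \<Rightarrow> 'i \<Rightarrow> complex" where
  "scl c a = (\<lambda>U. c * a U)"

lemma scl_apply [simp]: "scl c a U = c * a U"
  by (simp add: scl_def)

lemma scl_simps: "scl c (a + b) = scl c a + scl c b" "scl (c + d) a = scl c a + scl d a"
  "scl c (scl d a) = scl (c * d) a" "scl 1 a = a" "scl 0 a = 0" "scl c 0 = 0" "scl (-1) a = - a"
  by (auto simp: fun_eq_iff algebra_simps)

lemma scl_sum: "scl c (\<Sum>i\<in>I. f i) = (\<Sum>i\<in>I. scl c (f i))"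
  by (auto simp: fun_eq_iff sum_fun_apply sum_distrib_left)

definition lin :: "(('i \<Rightarrow> complex) \<Rightarrow> ('j \<Rightarrow> complex)) \<Rightarrow> bool" where
  "lin F \<longleftrightarrow> (\<forall>a b. F (a + b) = F a + F b) \<and> (\<forall>c a. F (scl c a) = scl c (F a))"

lemma lin_add: "lin F \<Longrightarrow> F (a + b) = F a + F b"
  and lin_scl: "lin F \<Longrightarrow> F (scl c a) = scl c (F a)"
  by (auto simp: lin_def)

lemma lin_0: "lin F \<Longrightarrow> F 0 = 0"
  using lin_scl[of F 0 0] by (simp add: scl_simps)

lemma lin_minus: "lin F \<Longrightarrow> F (- a) = - F a"
  using lin_scl[of F "-1" a] by (simp add: scl_simps)

lemma lin_diff: "lin F \<Longrightarrow> F (a - b) = F a - F b"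
  using lin_add[of F a "- b"] lin_minus[of F b] by simp

lemma lin_sum: "lin F \<Longrightarrow> F (\<Sum>i\<in>I. f i) = (\<Sum>i\<in>I. F (f i))"
  by (induction I rule: infinite_finite_induct) (auto simp: lin_0 lin_add)

text \<open>The sign picked up when the basis vector with index s is moved from the front into its
  sorted place in the wedge indexed by U.\<close>

definition sg :: "'a::linorder \<Rightarrow> 'a set \<Rightarrow> complex" where
  "sg s U = (-1) ^ card {t \<in> U. t < s}"

lemma sg_sq [simp]: "sg s U * sg s U = 1"
  by (simp add: sg_def flip: power_add mult_2)

lemma sg_sq2 [simp]: "sg s U * (sg s U * z) = z"
  by (simp flip: mult.assoc)

lemma sg_nz [simp]: "sg s U \<noteq> 0"
  by (simp add: sg_def)

lemma cnj_sg [simp]: "cnj (sg s U) = sg s U"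
  by (simp add: sg_def)

lemma sg_insert:
  assumes "finite U" "t \<notin> U"
  shows "sg s (insert t U) = (if t < s then - sg s U else sg s U)"
proof -
  have "{x \<in> insert t U. x < s} = (if t < s then insert t {x \<in> U. x < s} else {x \<in> U. x < s})"
    by auto
  then show ?thesis using assms by (simp add: sg_def)
qed

lemma sg_remove:
  assumes "finite U" "t \<in> U"
  shows "sg s (U - {t}) = (if t < s then - sg s U else sg s U)"
  using sg_insert[of "U - {t}" t s] assms by (simp add: insert_absorb split: if_splits)

lemma sg_self: "sg s (insert s U) = sg s U" "sg s (U - {s}) = sg s U"
proof -
  have "{t \<in> insert s U. t < s} = {t \<in> U. t < s}" "{t \<in> U - {s}. t < s} = {t \<in> U. t < s}" by auto
  then show "sg s (insert s U) = sg s U" "sg s (U - {s}) = sg s U" by (simp_all add: sg_def)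
qed

text \<open>Left exterior multiplication by x. Its partner \<open>an G y\<close> is contraction with
  y for the bilinear pairing of coordinates, so conjugates appear only when adjoints are
  taken.\<close>

definition cr :: "('a::linorder \<Rightarrow> complex) \<Rightarrow> ('a set \<Rightarrow> complex) \<Rightarrow> 'a set \<Rightarrow> complex" where
  "cr x a = (\<lambda>U. \<Sum>s\<in>U. sg s U * x s * a (U - {s}))"

definition an :: "'a::linorder set \<Rightarrow> ('a \<Rightarrow> complex) \<Rightarrow> ('a set \<Rightarrow> complex) \<Rightarrow> 'a set \<Rightarrow> complex" where
  "an G y a = (\<lambda>U. \<Sum>s\<in>G - U. sg s U * y s * a (insert s U))"

definition one :: "'a set \<Rightarrow> complex" where
  "one = (\<lambda>U. if U = {} then 1 else 0)"

definition supp :: "'a set \<Rightarrow> ('a set \<Rightarrow> complex) \<Rightarrow> bool" where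
  "supp G a \<longleftrightarrow> (\<forall>U. \<not> U \<subseteq> G \<longrightarrow> a U = 0)"

definition vsupp :: "'a set \<Rightarrow> ('a \<Rightarrow> complex) \<Rightarrow> bool" where
  "vsupp G x \<longleftrightarrow> (\<forall>s. s \<notin> G \<longrightarrow> x s = 0)"

definition ket :: "'a \<Rightarrow> 'a \<Rightarrow> complex" where
  "ket t = (\<lambda>s. if s = t then 1 else 0)"

lemma suppD: "supp G a \<Longrightarrow> \<not> U \<subseteq> G \<Longrightarrow> a U = 0"
  unfolding supp_def by blast

lemma vsuppD: "vsupp G x \<Longrightarrow> s \<notin> G \<Longrightarrow> x s = 0"
  unfolding vsupp_def by blast

lemma lin_cr: "lin (cr x)"
  by (auto simp: lin_def cr_def fun_eq_iff algebra_simps sum.distrib sum_distrib_left)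

lemma lin_an: "lin (an G y)"
  by (auto simp: lin_def an_def fun_eq_iff algebra_simps sum.distrib sum_distrib_left)

lemma cr_add: "cr (x + y) a = cr x a + cr y a"
  and cr_scl: "cr (scl c x) a = scl c (cr x a)"
  by (auto simp: cr_def fun_eq_iff algebra_simps sum.distrib sum_distrib_left)

lemma an_add: "an G (x + y) a = an G x a + an G y a"
  and an_scl: "an G (scl c x) a = scl c (an G x a)"
  by (auto simp: an_def fun_eq_iff algebra_simps sum.distrib sum_distrib_left)

lemma cr_0: "cr 0 a = 0" and an_zero: "an G 0 a = 0"
  by (auto simp: cr_def an_def fun_eq_iff)

lemma cr_sum: "cr (\<Sum>i\<in>I. f i) a = (\<Sum>i\<in>I. cr (f i) a)"
  by (induction I rule: infinite_finite_induct) (simp_all only: sum.infinite sum.empty sum.insert cr_0 cr_add simp_thms)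

lemma an_sum: "an G (\<Sum>i\<in>I. f i) a = (\<Sum>i\<in>I. an G (f i) a)"
  by (induction I rule: infinite_finite_induct) (simp_all only: sum.infinite sum.empty sum.insert an_zero an_add simp_thms)

lemma ket_expand:
  assumes "finite G" "vsupp G x"
  shows "x = (\<Sum>t\<in>G. scl (x t) (ket t))"
proof
  fix s
  have "(\<Sum>t\<in>G. scl (x t) (ket t)) s = (\<Sum>t\<in>G. if t = s then x s else 0)"
    unfolding sum_fun_apply by (rule sum.cong) (auto simp: ket_def)
  then show "x s = (\<Sum>t\<in>G. scl (x t) (ket t)) s"
    using assms by (auto simp: vsupp_def)
qed

lemma vsupp_ket: "t \<in> G \<Longrightarrow> vsupp G (ket t)"
  by (auto simp: vsupp_def ket_def)

lemma supp_one: "supp G one"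
  by (auto simp: supp_def one_def)

lemma supp_0: "supp G 0"
  by (auto simp: supp_def)

lemma supp_add: "supp G a \<Longrightarrow> supp G b \<Longrightarrow> supp G (a + b)"
  and supp_diff: "supp G a \<Longrightarrow> supp G b \<Longrightarrow> supp G (a - b)"
  and supp_scl: "supp G a \<Longrightarrow> supp G (scl c a)"
  by (auto simp: supp_def)

lemma supp_sum: "(\<And>i. i \<in> I \<Longrightarrow> supp G (f i)) \<Longrightarrow> supp G (\<Sum>i\<in>I. f i)"
  by (induction I rule: infinite_finite_induct) (auto simp: supp_0 supp_add)

lemma supp_cr:
  assumes x: "vsupp G x" and a: "supp G a"
  shows "supp G (cr x a)"
  unfolding supp_def cr_def
proof (intro allI impI sum.neutral ballI)
  fix U s assume U: "\<not> U \<subseteq> G" and s: "s \<in> U"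
  show "sg s U * x s * a (U - {s}) = 0"
  proof (cases "s \<in> G")
    case True
    then have "\<not> U - {s} \<subseteq> G" using U by blast
    then have "a (U - {s}) = 0" by (rule suppD[OF a])
    then show ?thesis by simp
  next
    case False
    then have "x s = 0" by (rule vsuppD[OF x])
    then show ?thesis by simp
  qed
qed

lemma supp_an: "supp G a \<Longrightarrow> supp G (an G y a)"
  unfolding supp_def an_def by (auto intro!: sum.neutral)

lemma an_one: "an G y one = 0"
  by (auto simp: an_def one_def fun_eq_iff)

lemma cr_cr_eq:
  assumes "finite U"
  shows "cr x (cr y a) U = (\<Sum>(s,t)\<in>{(s,t). s \<in> U \<and> t \<in> U \<and> s \<noteq> t}. sg s U * sg t (U - {s}) * x s * y t * a (U - {s,t}))"
proof -
  have "cr x (cr y a) U = (\<Sum>s\<in>U. \<Sum>t\<in>U - {s}. sg s U * sg t (U - {s}) * x s * y t * a (U - {s,t}))"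
    unfolding cr_def by (auto intro!: sum.cong simp: sum_distrib_left insert_commute Diff_insert2[symmetric] mult_ac)
  also have "\<dots> = (\<Sum>(s,t)\<in>(SIGMA s:U. U - {s}). sg s U * sg t (U - {s}) * x s * y t * a (U - {s,t}))"
    by (rule sum.Sigma) (use assms in auto)
  also have "(SIGMA s:U. U - {s}) = {(s,t). s \<in> U \<and> t \<in> U \<and> s \<noteq> t}" by auto
  finally show ?thesis .
qed

lemma cr_anticomm: "cr x (cr y a) = - cr y (cr x a)"
proof
  fix U :: "'a set"
  show "cr x (cr y a) U = (- cr y (cr x a)) U"
  proof (cases "finite U")
    case True
    let ?P = "{(s,t). s \<in> U \<and> t \<in> U \<and> s \<noteq> t}"
    have "cr y (cr x a) U = (\<Sum>(s,t)\<in>?P. sg t U * sg s (U - {t}) * y t * x s * a (U - {s,t}))"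
      unfolding cr_cr_eq[OF True]
      by (rule sum.reindex_bij_witness[of _ prod.swap prod.swap]) (auto simp: insert_commute)
    also have "\<dots> = (\<Sum>(s,t)\<in>?P. - (sg s U * sg t (U - {s}) * x s * y t * a (U - {s,t})))"
    proof (rule sum.cong[OF refl])
      fix st assume "st \<in> ?P"
      then show "(case st of (s,t) \<Rightarrow> sg t U * sg s (U - {t}) * y t * x s * a (U - {s,t})) =
        (case st of (s,t) \<Rightarrow> - (sg s U * sg t (U - {s}) * x s * y t * a (U - {s,t})))"
        using True by (auto simp: sg_remove)
    qed
    also have "\<dots> = - cr x (cr y a) U"
      unfolding cr_cr_eq[OF True] by (simp add: case_prod_unfold sum_negf)
    finally show ?thesis by simp
  qed (simp add: cr_def)
qed

lemma cr_same: "cr x (cr x a) = 0"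
proof -
  have "cr x (cr x a) U = - cr x (cr x a) U" for U
    using cr_anticomm[of x x a] by (metis uminus_apply)
  then show ?thesis by (auto simp: fun_eq_iff)
qed

lemma an_an_eq:
  assumes "finite G" "finite U"
  shows "an G x (an G y a) U = (\<Sum>(s,t)\<in>{(s,t). s \<in> G - U \<and> t \<in> G - U \<and> s \<noteq> t}. sg s U * sg t (insert s U) * x s * y t * a (insert s (insert t U)))"
proof -
  have "an G x (an G y a) U = (\<Sum>s\<in>G - U. \<Sum>t\<in>G - insert s U. sg s U * sg t (insert s U) * x s * y t * a (insert s (insert t U)))"
    unfolding an_def by (auto intro!: sum.cong simp: sum_distrib_left insert_commute mult_ac)
  also have "\<dots> = (\<Sum>(s,t)\<in>(SIGMA s:G-U. G - insert s U). sg s U * sg t (insert s U) * x s * y t * a (insert s (insert t U)))"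
    by (rule sum.Sigma) (use assms in auto)
  also have "(SIGMA s:G-U. G - insert s U) = {(s,t). s \<in> G - U \<and> t \<in> G - U \<and> s \<noteq> t}" by auto
  finally show ?thesis .
qed

lemma supp_infinite: "finite G \<Longrightarrow> supp G a \<Longrightarrow> infinite U \<Longrightarrow> a U = 0"
  unfolding supp_def by (meson finite_subset)

lemma an_anticomm:
  assumes G: "finite G" and a: "supp G a"
  shows "an G x (an G y a) = - an G y (an G x a)"
proof
  fix U :: "'a set"
  show "an G x (an G y a) U = (- an G y (an G x a)) U"
  proof (cases "finite U")
    case True
    let ?P = "{(s,t). s \<in> G - U \<and> t \<in> G - U \<and> s \<noteq> t}"
    have "an G y (an G x a) U = (\<Sum>(s,t)\<in>?P. sg t U * sg s (insert t U) * y t * x s * a (insert s (insert t U)))"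
      unfolding an_an_eq[OF G True]
      by (rule sum.reindex_bij_witness[of _ prod.swap prod.swap]) (auto simp: insert_commute)
    also have "\<dots> = (\<Sum>(s,t)\<in>?P. - (sg s U * sg t (insert s U) * x s * y t * a (insert s (insert t U))))"
    proof (rule sum.cong[OF refl])
      fix st assume "st \<in> ?P"
      then show "(case st of (s,t) \<Rightarrow> sg t U * sg s (insert t U) * y t * x s * a (insert s (insert t U))) =
        (case st of (s,t) \<Rightarrow> - (sg s U * sg t (insert s U) * x s * y t * a (insert s (insert t U))))"
        using True by (auto simp: sg_insert)
    qed
    also have "\<dots> = - an G x (an G y a) U"
      unfolding an_an_eq[OF G True] by (simp add: case_prod_unfold sum_negf)
    finally show ?thesis by simp
  next
    case False
    then show ?thesis using supp_infinite[OF G supp_an[OF supp_an[OF a]]] by simp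
  qed
qed

text \<open>The canonical anticommutation relation. Terms that use one index twice make up the
  scalar, which splits into indices outside U (create, then remove) and inside U (remove, then
  create). Every other term \<open>h s t\<close> occurs once in each operator product, with opposite
  signs.\<close>

lemma an_cr:
  assumes G: "finite G" and a: "supp G a" and x: "vsupp G x"
  shows "an G y (cr x a) = scl (\<Sum>s\<in>G. x s * y s) a - cr x (an G y a)"
proof
  fix U :: "'a set"
  show "an G y (cr x a) U = (scl (\<Sum>s\<in>G. x s * y s) a - cr x (an G y a)) U"
  proof (cases "U \<subseteq> G")
    case True
    then have fU: "finite U" using G finite_subset by blast
    define h where "h s t = sg s U * sg t (insert s U) * y s * x t * a (insert s U - {t})" for s t
    have 1: "an G y (cr x a) U = (\<Sum>s\<in>G-U. x s * y s) * a U + (\<Sum>s\<in>G-U. \<Sum>t\<in>U. h s t)"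
    proof -
      have "sg s U * y s * (\<Sum>t\<in>insert s U. sg t (insert s U) * x t * a (insert s U - {t})) =
          x s * y s * a U + (\<Sum>t\<in>U. h s t)" if "s \<in> G - U" for s
        using that fU by (simp add: h_def sum_distrib_left sg_self distrib_left sum_distrib_left mult_ac)
      then have "an G y (cr x a) U = (\<Sum>s\<in>G-U. x s * y s * a U + (\<Sum>t\<in>U. h s t))"
        unfolding an_def cr_def by (intro sum.cong) auto
      then show ?thesis by (simp add: sum.distrib sum_distrib_right)
    qed
    have 2: "cr x (an G y a) U = (\<Sum>t\<in>U. x t * y t) * a U - (\<Sum>t\<in>U. \<Sum>s\<in>G-U. h s t)"
    proof -
      have "sg t U * x t * (\<Sum>s\<in>G - (U - {t}). sg s (U - {t}) * y s * a (insert s (U - {t}))) =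
          x t * y t * a U - (\<Sum>s\<in>G-U. h s t)" if t: "t \<in> U" for t
      proof -
        have eq: "G - (U - {t}) = insert t (G - U)" using t True by auto
        have "sg t U * x t * (\<Sum>s\<in>G-U. sg s (U - {t}) * y s * a (insert s (U - {t}))) = - (\<Sum>s\<in>G-U. h s t)"
          unfolding sum_distrib_left sum_negf[symmetric]
        proof (rule sum.cong[OF refl])
          fix s assume s: "s \<in> G - U"
          then have e: "insert s (U - {t}) = insert s U - {t}" using t by auto
          have ne: "s \<noteq> t" "s \<notin> U" using s t by auto
          have "sg t U * sg s (U - {t}) = - (sg s U * sg t (insert s U))"
            using ne t fU by (auto simp: sg_remove sg_insert)
          then have "(sg t U * sg s (U - {t})) * (x t * y s * a (insert s U - {t})) = - h s t"
            by (simp add: h_def)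
          then show "sg t U * x t * (sg s (U - {t}) * y s * a (insert s (U - {t}))) = - h s t"
            unfolding e by (simp add: mult_ac)
        qed
        moreover have "sg t U * x t * (sg t (U - {t}) * y t * a (insert t (U - {t}))) = x t * y t * a U"
          using t fU by (simp add: sg_self insert_absorb mult_ac)
        ultimately show ?thesis unfolding eq using G t by (simp add: distrib_left)
      qed
      then have "cr x (an G y a) U = (\<Sum>t\<in>U. x t * y t * a U - (\<Sum>s\<in>G-U. h s t))"
        unfolding an_def cr_def by (intro sum.cong) auto
      then show ?thesis by (simp add: sum_subtractf sum_distrib_right)
    qed
    have "(\<Sum>s\<in>G. x s * y s) = (\<Sum>s\<in>G-U. x s * y s) + (\<Sum>t\<in>U. x t * y t)"
      using sum.subset_diff[OF True G] by simp
    then show ?thesis using 1 2 sum.swap[of h U "G-U"] by (simp add: algebra_simps sum.swap[of h])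
  next
    case False
    show ?thesis
      using suppD[OF supp_an[OF supp_cr[OF x a]] False] suppD[OF supp_cr[OF x supp_an[OF a]] False] suppD[OF a False]
      by simp
  qed
qed

section \<open>Derivations of the exterior algebra\<close>

lemma eta_zero [simp]: "(\<lambda>a. 0) = 0"
  by (simp add: zero_fun_def)

text \<open>Second quantization of A: a basis vector is removed and its image under A is put in,
  which gives the derivation extending \<open>mv G A\<close>. In this form its commutation rules and
  its adjoint follow from the anticommutation relations alone.\<close>

definition dv :: "'a::linorder set \<Rightarrow> ('a \<Rightarrow> 'a \<Rightarrow> complex) \<Rightarrow> ('a set \<Rightarrow> complex) \<Rightarrow> 'a set \<Rightarrow> complex" where
  "dv G A a = (\<Sum>t\<in>G. cr (\<lambda>s. A s t) (an G (ket t) a))"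

definition mv :: "'a set \<Rightarrow> ('a \<Rightarrow> 'a \<Rightarrow> complex) \<Rightarrow> ('a \<Rightarrow> complex) \<Rightarrow> 'a \<Rightarrow> complex" where
  "mv G A x = (\<lambda>s. \<Sum>t\<in>G. A s t * x t)"

definition msupp :: "'a set \<Rightarrow> ('a \<Rightarrow> 'a \<Rightarrow> complex) \<Rightarrow> bool" where
  "msupp G A \<longleftrightarrow> (\<forall>s t. s \<notin> G \<longrightarrow> A s t = 0)"

lemma msupp_col: "msupp G A \<Longrightarrow> vsupp G (\<lambda>s. A s t)"
  by (auto simp: msupp_def vsupp_def)

lemma mv_eq: "mv G A x = (\<Sum>t\<in>G. scl (x t) (\<lambda>s. A s t))"
  by (auto simp: mv_def fun_eq_iff sum_fun_apply mult.commute)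

lemma lin_dv: "lin (dv G A)"
  unfolding lin_def dv_def
  by (simp add: lin_add[OF lin_an] lin_add[OF lin_cr] lin_scl[OF lin_an] lin_scl[OF lin_cr] sum.distrib scl_sum)

lemma supp_dv: "msupp G A \<Longrightarrow> supp G a \<Longrightarrow> supp G (dv G A a)"
  unfolding dv_def by (intro supp_sum supp_cr supp_an msupp_col)

lemma dv_one: "dv G A one = 0"
  unfolding dv_def by (simp add: an_one lin_0[OF lin_cr])

lemma dv_cr:
  assumes G: "finite G" and a: "supp G a" and x: "vsupp G x"
  shows "dv G A (cr x a) = cr (mv G A x) a + cr x (dv G A a)"
proof -
  have "cr (\<lambda>s. A s t) (an G (ket t) (cr x a)) = cr (scl (x t) (\<lambda>s. A s t)) a + cr x (cr (\<lambda>s. A s t) (an G (ket t) a))"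
    if "t \<in> G" for t
  proof -
    have "(\<Sum>s\<in>G. x s * ket t s) = (\<Sum>s\<in>G. if t = s then x s else 0)"
      by (rule sum.cong) (auto simp: ket_def)
    then have "(\<Sum>s\<in>G. x s * ket t s) = x t" using that G by simp
    then show ?thesis
      unfolding an_cr[OF G a x] by (simp add: lin_diff[OF lin_cr] lin_scl[OF lin_cr] cr_scl cr_anticomm[of x "\<lambda>s. A s t"])
  qed
  then have "dv G A (cr x a) = (\<Sum>t\<in>G. cr (scl (x t) (\<lambda>s. A s t)) a + cr x (cr (\<lambda>s. A s t) (an G (ket t) a)))"
    unfolding dv_def by (intro sum.cong) auto
  also have "\<dots> = cr (mv G A x) a + cr x (dv G A a)"
    unfolding sum.distrib mv_eq cr_sum dv_def lin_sum[OF lin_cr] ..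
  finally show ?thesis .
qed

text \<open>Contractions transform under a derivation by the transpose of A; the scalars from
  \<open>an_cr\<close> reassemble to the contraction with the transposed image of y.\<close>

lemma an_dv:
  assumes G: "finite G" and a: "supp G a" and A: "msupp G A"
  shows "an G y (dv G A a) = dv G A (an G y a) + an G (\<lambda>t. \<Sum>s\<in>G. A s t * y s) a"
proof -
  let ?z = "\<lambda>t. \<Sum>s\<in>G. A s t * y s"
  have 1: "an G y (cr (\<lambda>s. A s t) (an G (ket t) a)) = scl (?z t) (an G (ket t) a) + cr (\<lambda>s. A s t) (an G (ket t) (an G y a))" for t
    unfolding an_cr[OF G supp_an[OF a] msupp_col[OF A]] an_anticomm[OF G a, of y "ket t"]
    by (simp add: lin_minus[OF lin_cr])
  have "an G y (dv G A a) = (\<Sum>t\<in>G. an G (scl (?z t) (ket t)) a) + dv G A (an G y a)"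
    unfolding dv_def lin_sum[OF lin_an] 1 sum.distrib an_scl ..
  also have "(\<Sum>t\<in>G. an G (scl (?z t) (ket t)) a) = an G (\<lambda>t. if t \<in> G then ?z t else 0) a"
  proof -
    have "(\<lambda>t. if t \<in> G then ?z t else 0) = (\<Sum>t\<in>G. scl (?z t) (ket t))"
      by (subst ket_expand[OF G, of "\<lambda>t. if t \<in> G then ?z t else 0"]) (auto simp: vsupp_def intro!: sum.cong)
    then show ?thesis by (simp only: an_sum)
  qed
  also have "\<dots> = an G ?z a"
    unfolding an_def by (intro ext sum.cong) auto
  finally show ?thesis by (simp only: add.commute)
qed

section \<open>The Hermitian product and adjoints\<close>

definition ip :: "'i set \<Rightarrow> ('i \<Rightarrow> complex) \<Rightarrow> ('i \<Rightarrow> complex) \<Rightarrow> complex" where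
  "ip I a b = (\<Sum>i\<in>I. a i * cnj (b i))"

lemma ip_simps:
  "ip I (a + b) c = ip I a c + ip I b c" "ip I a (b + c) = ip I a b + ip I a c"
  "ip I (a - b) c = ip I a c - ip I b c" "ip I a (b - c) = ip I a b - ip I a c"
  "ip I (scl k a) b = k * ip I a b" "ip I a (scl k b) = cnj k * ip I a b"
  "ip I 0 b = 0" "ip I a 0 = 0"
  by (auto simp: ip_def algebra_simps sum.distrib sum_subtractf sum_distrib_left)

lemma ip_sum: "ip I (\<Sum>j\<in>J. f j) b = (\<Sum>j\<in>J. ip I (f j) b)" "ip I a (\<Sum>j\<in>J. f j) = (\<Sum>j\<in>J. ip I a (f j))"
  by (induction J rule: infinite_finite_induct) (simp_all only: ip_simps sum.infinite sum.empty sum.insert simp_thms)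

lemma ip_cnj: "cnj (ip I a b) = ip I b a"
  by (simp add: ip_def mult.commute)

lemma ip_self_eq_0:
  assumes "finite I" "ip I a a = 0" "i \<in> I" shows "a i = 0"
proof -
  have "complex_of_real (\<Sum>i\<in>I. (cmod (a i))\<^sup>2) = 0"
    using assms(2) unfolding ip_def of_real_sum complex_norm_square by simp
  then have "(\<Sum>i\<in>I. (cmod (a i))\<^sup>2) = 0" by (simp only: of_real_eq_0_iff)
  then show ?thesis using assms(1,3) by (subst (asm) sum_nonneg_eq_0_iff) auto
qed

text \<open>Deleting s matches pairs (U,s) with s in U and pairs (V,s) with s outside V, and
  \<open>sg\<close> does not notice whether s itself belongs to the set.\<close>

lemma ip_cr:
  assumes G: "finite G" and x: "vsupp G x"
  shows "ip (Pow G) (cr x a) b = ip (Pow G) a (an G (\<lambda>s. cnj (x s)) b)"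
proof -
  let ?h = "\<lambda>U s. sg s U * x s * a (U - {s}) * cnj (b U)"
  have "ip (Pow G) (cr x a) b = (\<Sum>U\<in>Pow G. \<Sum>s\<in>U. ?h U s)"
    unfolding ip_def cr_def sum_distrib_right ..
  also have "\<dots> = (\<Sum>(U,s)\<in>(SIGMA U:Pow G. U). ?h U s)"
    by (rule sum.Sigma) (use G finite_subset in auto)
  also have "\<dots> = (\<Sum>(V,s)\<in>(SIGMA V:Pow G. G - V). sg s V * x s * a V * cnj (b (insert s V)))"
    by (rule sum.reindex_bij_witness[of _ "\<lambda>(V,s). (insert s V, s)" "\<lambda>(U,s). (U - {s}, s)"])
      (auto simp: insert_absorb sg_self)
  also have "\<dots> = (\<Sum>V\<in>Pow G. \<Sum>s\<in>G-V. sg s V * x s * a V * cnj (b (insert s V)))"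
    by (rule sum.Sigma[symmetric]) (use G in auto)
  also have "\<dots> = ip (Pow G) a (an G (\<lambda>s. cnj (x s)) b)"
    unfolding ip_def an_def cnj_sum sum_distrib_left by (intro sum.cong) (auto simp: mult_ac)
  finally show ?thesis .
qed

lemma ip_an:
  assumes G: "finite G" and x: "vsupp G x"
  shows "ip (Pow G) (an G x a) b = ip (Pow G) a (cr (\<lambda>s. cnj (x s)) b)"
proof -
  have "vsupp G (\<lambda>s. cnj (x s))" using x by (auto simp: vsupp_def)
  from ip_cr[OF G this, of b a] have "ip (Pow G) (cr (\<lambda>s. cnj (x s)) b) a = ip (Pow G) b (an G x a)" by simp
  then show ?thesis by (metis ip_cnj)
qed

lemma ip_dv:
  assumes G: "finite G" and A: "msupp G A" "\<And>s t. t \<notin> G \<Longrightarrow> A s t = 0"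
  shows "ip (Pow G) (dv G A a) b = ip (Pow G) a (dv G (\<lambda>s t. cnj (A t s)) b)"
proof -
  have k: "(\<lambda>s. cnj (ket t s)) = (ket t :: 'a \<Rightarrow> complex)" for t :: 'a by (auto simp: ket_def)
  have "ip (Pow G) (dv G A a) b = (\<Sum>t\<in>G. ip (Pow G) a (cr (ket t) (an G (\<lambda>s. cnj (A s t)) b)))"
    unfolding dv_def ip_sum by (intro sum.cong refl) (simp add: ip_cr[OF G msupp_col[OF A(1)]] ip_an[OF G vsupp_ket] k)
  also have "\<dots> = ip (Pow G) a (\<Sum>t\<in>G. cr (ket t) (an G (\<lambda>s. cnj (A s t)) b))"
    unfolding ip_sum ..
  also have "(\<Sum>t\<in>G. cr (ket t) (an G (\<lambda>s. cnj (A s t)) b)) = (\<Sum>t\<in>G. \<Sum>s\<in>G. scl (cnj (A s t)) (cr (ket t) (an G (ket s) b)))"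
  proof (rule sum.cong[OF refl])
    fix t assume "t \<in> G"
    have "(\<lambda>s. cnj (A s t)) = (\<Sum>s\<in>G. scl (cnj (A s t)) (ket s))"
      by (rule ket_expand[OF G]) (use A in \<open>auto simp: msupp_def vsupp_def\<close>)
    then have "an G (\<lambda>s. cnj (A s t)) b = (\<Sum>s\<in>G. scl (cnj (A s t)) (an G (ket s) b))"
      by (simp only: an_sum an_scl)
    then show "cr (ket t) (an G (\<lambda>s. cnj (A s t)) b) = (\<Sum>s\<in>G. scl (cnj (A s t)) (cr (ket t) (an G (ket s) b)))"
      by (simp only: lin_sum[OF lin_cr] lin_scl[OF lin_cr])
  qed
  also have "\<dots> = (\<Sum>s\<in>G. \<Sum>t\<in>G. scl (cnj (A s t)) (cr (ket t) (an G (ket s) b)))"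
    by (rule sum.swap)
  also have "\<dots> = dv G (\<lambda>s t. cnj (A t s)) b"
    unfolding dv_def
  proof (rule sum.cong[OF refl])
    fix s assume "s \<in> G"
    have "(\<lambda>t. cnj (A s t)) = (\<Sum>t\<in>G. scl (cnj (A s t)) (ket t))"
      by (rule ket_expand[OF G]) (use A in \<open>auto simp: msupp_def vsupp_def\<close>)
    then have "cr (\<lambda>t. cnj (A s t)) z = (\<Sum>t\<in>G. scl (cnj (A s t)) (cr (ket t) z))" for z
      by (simp only: cr_sum cr_scl)
    then show "(\<Sum>t\<in>G. scl (cnj (A s t)) (cr (ket t) (an G (ket s) b))) = cr (\<lambda>t. cnj (A s t)) (an G (ket s) b)" by simp
  qed
  finally show ?thesis .
qed

section \<open>Wedges of lists of vectors\<close>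

definition wl :: "('a::linorder \<Rightarrow> complex) list \<Rightarrow> 'a set \<Rightarrow> complex" where
  "wl xs = foldr cr xs one"

lemma wl_simps [simp]: "wl [] = one" "wl (x # xs) = cr x (wl xs)"
  by (simp_all add: wl_def)

lemma supp_wl: "\<forall>x\<in>set xs. vsupp G x \<Longrightarrow> supp G (wl xs)"
  by (induction xs) (auto simp: supp_one supp_cr)

lemma cr_wl_member: "x \<in> set xs \<Longrightarrow> cr x (wl xs) = 0"
proof (induction xs)
  case (Cons y xs)
  then show ?case
    using cr_anticomm[of x y "wl xs"] by (auto simp: cr_same lin_0[OF lin_cr])
qed simp

lemma an_wl_zero:
  assumes "finite G" "\<forall>x\<in>set xs. vsupp G x" "\<forall>x\<in>set xs. (\<Sum>s\<in>G. x s * y s) = 0"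
  shows "an G y (wl xs) = 0"
  using assms(2,3)
proof (induction xs)
  case (Cons x xs)
  then show ?case using an_cr[OF assms(1) supp_wl, of xs x y]
    by (simp add: scl_simps lin_0[OF lin_cr])
qed (simp add: an_one)

text \<open>The determinant of a triangular Gram matrix: moved to the other side as a contraction,
  the first x annihilates all later ys and so hits only the first one.\<close>

lemma ip_wl_triangular:
  assumes G: "finite G" and len: "length xs = length ys"
    and "\<forall>x\<in>set xs. vsupp G x" "\<forall>y\<in>set ys. vsupp G y"
    and "\<And>i j. i < j \<Longrightarrow> j < length xs \<Longrightarrow> ip G (xs ! i) (ys ! j) = 0"
  shows "ip (Pow G) (wl xs) (wl ys) = (\<Prod>i<length xs. ip G (xs ! i) (ys ! i))"
  using assms(2-)
proof (induction xs ys rule: list_induct2)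
  case Nil
  have "ip (Pow G) one one = (\<Sum>U\<in>Pow G. if U = {} then 1 else 0)"
    unfolding ip_def by (rule sum.cong) (auto simp: one_def)
  then show ?case using G by simp
next
  case (Cons x xs y ys)
  let ?x = "\<lambda>s. cnj (x s)"
  have z: "an G ?x (wl ys) = 0"
  proof (rule an_wl_zero[OF G])
    show "\<forall>z\<in>set ys. (\<Sum>s\<in>G. z s * ?x s) = 0"
    proof
      fix z assume "z \<in> set ys"
      then obtain j where j: "j < length ys" "z = ys ! j" by (auto simp: in_set_conv_nth)
      have "ip G x z = 0" using Cons.prems(3)[of 0 "Suc j"] j Cons.hyps by simp
      then show "(\<Sum>s\<in>G. z s * ?x s) = 0" using ip_cnj[of G x z] by (simp add: ip_def)
    qed
  qed (use Cons.prems in auto)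
  have IH: "ip (Pow G) (wl xs) (wl ys) = (\<Prod>i<length xs. ip G (xs ! i) (ys ! i))"
    using Cons.prems(1,2) Cons.prems(3)[of "Suc _" "Suc _"] by (intro Cons.IH) auto
  have "ip (Pow G) (wl (x # xs)) (wl (y # ys)) = ip (Pow G) (wl xs) (an G ?x (cr y (wl ys)))"
    using ip_cr[OF G, of x] Cons.prems by simp
  also have "an G ?x (cr y (wl ys)) = scl (\<Sum>s\<in>G. y s * cnj (x s)) (wl ys)"
    using Cons.prems z by (subst an_cr[OF G supp_wl]) (auto simp: lin_0[OF lin_cr])
  also have "(\<Sum>s\<in>G. y s * cnj (x s)) = cnj (ip G x y)"
    by (simp add: ip_def mult.commute)
  also have "ip (Pow G) (wl xs) (scl (cnj (ip G x y)) (wl ys)) = ip G x y * (\<Prod>i<length xs. ip G (xs ! i) (ys ! i))"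
    by (simp add: ip_simps IH)
  finally show ?case by (simp add: prod.lessThan_Suc_shift del: prod.lessThan_Suc)
qed

text \<open>Column operations in operator form. A factor may change by anything that vanishes on all
  a killed by the later factors, because the wedge of those later factors is such an a. Applications
  only have to show that the unwanted summands occur further down the list.\<close>

lemma wl_cong_unitriangular:
  assumes "length xs = length ys"
    and "\<And>i a. i < length xs \<Longrightarrow> (\<And>x. x \<in> set (drop (Suc i) xs) \<Longrightarrow> cr x a = 0) \<Longrightarrow> cr (ys ! i) a = cr (xs ! i) a"
  shows "wl ys = wl xs"
  using assms
proof (induction xs ys rule: list_induct2)
  case (Cons x xs y ys)
  have "wl ys = wl xs" using Cons.prems[of "Suc _"] by (intro Cons.IH) auto
  moreover have "cr y (wl xs) = cr x (wl xs)" using Cons.prems[of 0 "wl xs"] cr_wl_member[of _ xs] by auto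
  ultimately show ?case by simp
qed simp

lemma cr_ket: "cr (ket t) a U = (if finite U \<and> t \<in> U then sg t U * a (U - {t}) else 0)"
proof (cases "finite U")
  case True
  have "cr (ket t) a U = (\<Sum>s\<in>U. if t = s then sg t U * a (U - {t}) else 0)"
    unfolding cr_def by (rule sum.cong) (auto simp: ket_def)
  then show ?thesis using True by simp
qed (simp add: cr_def)

lemma an_ket: "finite G \<Longrightarrow> an G (ket t) a U = (if t \<in> G - U then sg t U * a (insert t U) else 0)"
proof -
  assume G: "finite G"
  have "an G (ket t) a U = (\<Sum>s\<in>G-U. if t = s then sg t U * a (insert t U) else 0)"
    unfolding an_def by (rule sum.cong) (auto simp: ket_def)
  then show ?thesis using G by simp
qed

text \<open>Only the support is recorded; signs are irrelevant in the non-vanishing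
  arguments.\<close>

lemma wl_kets:
  assumes "distinct xs"
  shows "wl (map ket xs) U \<noteq> 0 \<longleftrightarrow> U = set xs"
  using assms
proof (induction xs arbitrary: U)
  case (Cons x xs)
  have "wl (map ket (x # xs)) U \<noteq> 0 \<longleftrightarrow> finite U \<and> x \<in> U \<and> U - {x} = set xs"
    unfolding list.map wl_simps cr_ket using Cons.IH[of "U - {x}"] Cons.prems by auto
  also have "\<dots> \<longleftrightarrow> U = set (x # xs)" using Cons.prems by auto
  finally show ?case .
qed (simp add: one_def)

lemma wl_kets_sorted:
  assumes "sorted_wrt (<) xs"
  shows "wl (map ket xs) = ket (set xs)"
proof
  fix U
  have d: "distinct xs" using assms strict_sorted_iff by blast
  have "wl (map ket xs) (set xs) = 1" using assms
  proof (induction xs)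
    case (Cons x xs)
    have e: "{t \<in> insert x (set xs). t < x} = {}" using Cons.prems by auto
    have "x \<notin> set xs" using Cons.prems by auto
    then show ?case using Cons unfolding list.map wl_simps cr_ket sg_def list.set e by simp
  qed (simp add: one_def)
  then show "wl (map ket xs) U = ket (set xs) U"
    using wl_kets[OF d, of U] by (auto simp: ket_def)
qed

section \<open>Subspaces and orthogonal projections\<close>

definition sub :: "('i \<Rightarrow> complex) set \<Rightarrow> bool" where
  "sub M \<longleftrightarrow> 0 \<in> M \<and> (\<forall>a\<in>M. \<forall>b\<in>M. a + b \<in> M) \<and> (\<forall>c. \<forall>a\<in>M. scl c a \<in> M)"

lemma sub_0: "sub M \<Longrightarrow> 0 \<in> M"
  and sub_add: "sub M \<Longrightarrow> a \<in> M \<Longrightarrow> b \<in> M \<Longrightarrow> a + b \<in> M"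
  and sub_scl: "sub M \<Longrightarrow> a \<in> M \<Longrightarrow> scl c a \<in> M"
  by (auto simp: sub_def)

lemma sub_diff: "sub M \<Longrightarrow> a \<in> M \<Longrightarrow> b \<in> M \<Longrightarrow> a - b \<in> M"
  using sub_add[of M a "scl (-1) b"] sub_scl[of M b "-1"] by (simp add: scl_simps)

lemma sub_sum: "sub M \<Longrightarrow> (\<And>i. i \<in> I \<Longrightarrow> f i \<in> M) \<Longrightarrow> (\<Sum>i\<in>I. f i) \<in> M"
  by (induction I rule: infinite_finite_induct) (auto simp: sub_0 sub_add)

global_interpretation fspace: vector_space "scl :: complex \<Rightarrow> ('i \<Rightarrow> complex) \<Rightarrow> 'i \<Rightarrow> complex"
  defines fspan = fspace.span and fdim = fspace.dim and findep = fspace.dependent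
  by standard (auto simp: scl_def fun_eq_iff algebra_simps)

lemma sub_subspace: "sub M \<longleftrightarrow> fspace.subspace M"
  by (auto simp: sub_def fspace.subspace_def)

lemma sub_fspan: "sub (fspan S)"
  by (simp add: sub_subspace fspace.subspace_span)

text \<open>The ambient space of all Hermitian arguments: \<open>ip I\<close> sees only the
  coordinates in I, hence is definite here, and finite I makes the space finite-dimensional.\<close>

definition isupp :: "'i set \<Rightarrow> ('i \<Rightarrow> complex) set" where
  "isupp I = {a. \<forall>i. i \<notin> I \<longrightarrow> a i = 0}"

lemma isupp_fspan: "finite I \<Longrightarrow> isupp I \<subseteq> fspan (ket ` I)"
proof
  fix a assume I: "finite I" and a: "a \<in> isupp I"
  have "a = (\<Sum>t\<in>I. scl (a t) (ket t))"
    by (rule ket_expand[OF I]) (use a in \<open>auto simp: isupp_def vsupp_def\<close>)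
  also have "\<dots> \<in> fspan (ket ` I)"
    by (intro sub_sum sub_fspan sub_scl fspace.span_base) auto
  finally show "a \<in> fspan (ket ` I)" .
qed

lemma ip_self_isupp: "finite I \<Longrightarrow> a \<in> isupp I \<Longrightarrow> ip I a a = 0 \<Longrightarrow> a = 0"
  using ip_self_eq_0[of I a] by (fastforce simp: isupp_def)

lemma sub_finite_basis:
  assumes I: "finite I" and M: "sub M" "M \<subseteq> isupp I"
  shows "\<exists>B. finite B \<and> B \<subseteq> M \<and> \<not> findep B \<and> M = fspan B \<and> card B = fdim M"
proof -
  obtain B where B: "B \<subseteq> M" "\<not> findep B" "M \<subseteq> fspan B" "card B = fdim M"
    by (rule fspace.basis_exists[of M])
  have "B \<subseteq> fspan (ket ` I)" using B(1) M(2) isupp_fspan[OF I] by (meson subset_trans)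
  then have "finite B"
    using fspace.independent_span_bound[OF finite_imageI[OF I] B(2)] by simp
  moreover have "fspan B \<subseteq> M" using B(1) M(1) by (simp add: fspace.span_minimal sub_subspace)
  ultimately show ?thesis using B by (intro exI[of _ B]) auto
qed

lemma fdim_less:
  assumes I: "finite I" and M: "sub M" "M \<subseteq> isupp I" and L: "sub L" "L \<subset> M"
  shows "fdim L < fdim M"
proof -
  obtain B where B: "finite B" "B \<subseteq> L" "\<not> findep B" "L = fspan B" "card B = fdim L"
    using sub_finite_basis[OF I L(1)] L(2) M(2) by (meson psubset_imp_subset subset_trans)
  obtain C where C: "B \<subseteq> C" "C \<subseteq> M" "\<not> findep C" "M \<subseteq> fspan C"
    using fspace.maximal_independent_subset_extend[OF subset_trans[OF B(2) psubset_imp_subset[OF L(2)]] B(3)] by metis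
  have "C \<subseteq> fspan (ket ` I)" using C(2) M(2) isupp_fspan[OF I] by (meson subset_trans)
  then have "finite C"
    using fspace.independent_span_bound[OF finite_imageI[OF I] C(3)] by simp
  moreover have "card C = fdim M" using C by (intro fspace.dim_unique[symmetric]) auto
  moreover have "B \<noteq> C" using B(4) C(4) L(2) by (metis psubset_imp_subset psubset_subset_trans order_less_irrefl)
  ultimately show ?thesis using psubset_card_mono[of C B] C(1) B(5) by auto
qed

text \<open>Gram-Schmidt by induction on the spanning set: a new vector b is replaced by its part
  \<open>b'\<close> orthogonal to the old span, and if that part is zero the span does not
  grow.\<close>

lemma projection_fspan:
  assumes I: "finite I" and B: "finite B" "B \<subseteq> isupp I"
  shows "\<exists>v\<in>fspan B. \<forall>y\<in>fspan B. ip I y (x - v) = 0"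
  using B
proof (induction B arbitrary: x rule: finite_induct)
  case empty
  then show ?case by (simp add: ip_simps)
next
  case (insert b B)
  obtain p where p: "p \<in> fspan B" "\<forall>y\<in>fspan B. ip I y (b - p) = 0" using insert by blast
  obtain v where v: "v \<in> fspan B" "\<forall>y\<in>fspan B. ip I y (x - v) = 0" using insert by blast
  define b' where "b' = b - p"
  have sB: "fspan B \<subseteq> fspan (insert b B)" by (rule fspace.span_mono) auto
  have bi: "b \<in> fspan (insert b B)" by (rule fspace.span_base) auto
  have b'i: "b' \<in> fspan (insert b B)" unfolding b'_def using bi p(1) sB by (intro sub_diff sub_fspan) auto
  have dec: "\<exists>k. \<exists>z\<in>fspan B. y = scl k b' + z" if y: "y \<in> fspan (insert b B)" for y
  proof -
    obtain k where k: "y - scl k b \<in> fspan B" using fspace.span_breakdown_eq y by blast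
    have "y = scl k b' + (y - scl k b + scl k p)" by (auto simp: b'_def fun_eq_iff algebra_simps)
    moreover have "y - scl k b + scl k p \<in> fspan B" using k p(1) by (intro sub_add sub_scl sub_fspan)
    ultimately show ?thesis by blast
  qed
  have spI: "fspan B \<subseteq> isupp I"
    using insert.prems by (intro fspace.span_minimal) (auto simp: fspace.subspace_def isupp_def)
  show ?case
  proof (cases "ip I b' b' = 0")
    case True
    then have "b' = 0" using insert.prems p(1) spI by (intro ip_self_isupp[OF I]) (auto simp: b'_def isupp_def)
    then have "fspan (insert b B) \<subseteq> fspan B" using dec by (fastforce simp: scl_simps)
    then show ?thesis using v sB by blast
  next
    case False
    define c where "c = ip I x b' / ip I b' b'"
    have r: "cnj (ip I b' b') = ip I b' b'" by (rule ip_cnj)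
    have vb: "ip I v b' = 0" "ip I b' v = 0" using v(1) p(2) ip_cnj[of I v b'] by (auto simp: b'_def)
    have "ip I y (x - (v + scl c b')) = 0" if "y \<in> fspan (insert b B)" for y
    proof -
      obtain k z where z: "z \<in> fspan B" "y = scl k b' + z" using dec[OF \<open>y \<in> _\<close>] by blast
      have e: "x - (v + scl c b') = (x - v) - scl c b'" by auto
      have "ip I z (x - v) = 0" "ip I z b' = 0" using z v p by (auto simp: b'_def)
      then have "ip I z (x - (v + scl c b')) = 0"
        unfolding e by (simp only: ip_simps(4)[of I z "x - v"] ip_simps(6)) simp
      moreover have "ip I b' (x - (v + scl c b')) = 0"
        using False vb by (simp add: ip_simps c_def r ip_cnj)
      ultimately show ?thesis unfolding z(2) by (simp only: ip_simps(1,5)) simp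
    qed
    moreover have "v + scl c b' \<in> fspan (insert b B)"
      using v(1) sB b'i by (intro sub_add sub_scl sub_fspan) auto
    ultimately show ?thesis by blast
  qed
qed

lemma projection:
  assumes "finite I" "sub M" "M \<subseteq> isupp I"
  shows "\<exists>v\<in>M. \<forall>y\<in>M. ip I y (x - v) = 0"
proof -
  obtain B where B: "finite B" "B \<subseteq> M" "M = fspan B"
    using sub_finite_basis[OF assms] by metis
  then show ?thesis using projection_fspan[OF assms(1) B(1), of x] assms(3) by auto
qed

section \<open>The adjoint action as a derivation\<close>

definition vm :: "mat \<Rightarrow> nat \<times> nat \<Rightarrow> complex" where
  "vm X = (\<lambda>p. X (fst p) (snd p))"

definition nsupp :: "nat \<Rightarrow> mat \<Rightarrow> bool" where
  "nsupp N X \<longleftrightarrow> (\<forall>i j. N \<le> i \<or> N \<le> j \<longrightarrow> X i j = 0)"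

text \<open>The matrix of ad X on gl_N with respect to the elementary matrices.\<close>

definition adm :: "nat \<Rightarrow> mat \<Rightarrow> nat \<times> nat \<Rightarrow> nat \<times> nat \<Rightarrow> complex" where
  "adm N X = (\<lambda>s t. if t \<in> grid N then vm (bracket N X (Emat t)) s else 0)"

lemma finite_grid [simp]: "finite (grid N)"
  by (simp add: grid_def)

lemma wedge_vec: "wedge (vec X) a = cr (vm X) a"
proof
  fix U
  show "wedge (vec X) a U = cr (vm X) a U"
  proof (cases "finite U")
    case True
    let ?h = "\<lambda>S. wsign S (U - S) * vec X S * a (U - S)"
    have "wedge (vec X) a U = (\<Sum>S\<in>(\<lambda>s. {s}) ` U. ?h S)"
      unfolding wedge_def
    proof (rule sum.mono_neutral_right)
      show "\<forall>S\<in>Pow U - (\<lambda>s. {s}) ` U. ?h S = 0"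
      proof
        fix S assume S: "S \<in> Pow U - (\<lambda>s. {s}) ` U"
        then have "card S \<noteq> 1" by (auto simp: card_1_singleton_iff)
        then show "?h S = 0" by (simp add: vec_def)
      qed
    qed (use True in auto)
    also have "\<dots> = (\<Sum>s\<in>U. ?h {s})"
      by (subst sum.reindex) (auto simp: inj_on_def)
    also have "\<dots> = cr (vm X) a U"
      unfolding cr_def
    proof (rule sum.cong[OF refl])
      fix s assume "s \<in> U"
      have "{(s', t). s' \<in> {s} \<and> t \<in> U - {s} \<and> t < s'} = Pair s ` {t \<in> U. t < s}" by auto
      then have "wsign {s} (U - {s}) = sg s U"
        unfolding wsign_def sg_def by (simp add: card_image inj_on_def)
      then show "?h {s} = sg s U * vm X s * a (U - {s})" by (simp add: vec_def vm_def)
    qed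
    finally show ?thesis .
  qed (simp add: wedge_def cr_def)
qed

lemma wedge_list_eq: "wedge_list xs = wl (map vm xs)"
proof (induction xs)
  case Nil
  then show ?case by (simp add: wedge_list_def ext_one_def one_def)
next
  case (Cons x xs)
  then show ?case unfolding wedge_list_def by (simp add: wedge_vec)
qed

lemma vm_Emat: "vm (Emat p) = ket p"
  by (auto simp: vm_def Emat_def ket_def fun_eq_iff prod_eq_iff)

lemma vsupp_vm: "vsupp (grid N) (vm X) \<longleftrightarrow> nsupp N X"
  unfolding vsupp_def vm_def nsupp_def grid_def by (auto simp: not_less)

lemma nsupp_bracket:
  assumes "nsupp N X" "nsupp N Y" shows "nsupp N (bracket N X Y)"
  using assms by (auto simp: nsupp_def bracket_def mmul_def)

lemma nsupp_Emat: "p \<in> grid N \<Longrightarrow> nsupp N (Emat p)"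
  by (auto simp: nsupp_def Emat_def grid_def)

lemma bracket_Emat: "k < N \<Longrightarrow> l < N \<Longrightarrow>
    bracket N X (Emat (k,l)) i j = (if j = l then X i k else 0) - (if i = k then X l j else 0)"
proof -
  assume a: "k < N" "l < N"
  have "(\<Sum>m<N. X i m * Emat (k,l) m j) = (\<Sum>m<N. if m = k then (if j = l then X i k else 0) else 0)"
    by (rule sum.cong) (auto simp: Emat_def)
  moreover have "(\<Sum>m<N. Emat (k,l) i m * X m j) = (\<Sum>m<N. if m = l then (if i = k then X l j else 0) else 0)"
    by (rule sum.cong) (auto simp: Emat_def)
  ultimately show ?thesis using a by (simp add: bracket_def mmul_def)
qed

lemma adm_eq: "adm N X (i,j) (k,l) = (if k < N \<and> l < N then (if j = l then X i k else 0) - (if i = k then X l j else 0) else 0)"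
  by (auto simp: adm_def vm_def bracket_Emat grid_def)

lemma msupp_adm:
  assumes "nsupp N X"
  shows "msupp (grid N) (adm N X)" "t \<notin> grid N \<Longrightarrow> adm N X s t = 0"
proof -
  have "vsupp (grid N) (vm (bracket N X (Emat t)))" if "t \<in> grid N" for t
    using that assms by (simp add: vsupp_vm nsupp_bracket nsupp_Emat)
  then show "msupp (grid N) (adm N X)" by (auto simp: msupp_def adm_def vsupp_def)
qed (simp add: adm_def)

lemma mv_adm:
  assumes "nsupp N X" "nsupp N Y"
  shows "mv (grid N) (adm N X) (vm Y) = vm (bracket N X Y)"
proof
  fix p :: "nat \<times> nat" obtain i j where p: "p = (i,j)" by force
  have "mv (grid N) (adm N X) (vm Y) p = (\<Sum>k<N. \<Sum>l<N. adm N X (i,j) (k,l) * Y k l)"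
    unfolding mv_def grid_def p sum.cartesian_product by (rule sum.cong) (auto simp: vm_def)
  also have "\<dots> = (\<Sum>k<N. \<Sum>l<N. (if l = j then X i k * Y k l else 0) - (if k = i then Y k l * X l j else 0))"
    by (intro sum.cong refl) (auto simp: adm_eq algebra_simps)
  also have "\<dots> = (\<Sum>k<N. \<Sum>l<N. if l = j then X i k * Y k l else 0) - (\<Sum>l<N. \<Sum>k<N. if k = i then Y k l * X l j else 0)"
    by (simp add: sum_subtractf sum.swap[of "\<lambda>k l. if k = i then Y k l * X l j else 0"])
  also have "\<dots> = vm (bracket N X Y) p"
  proof -
    have "(\<Sum>l<N. if l = j then X i k * Y k l else 0) = X i k * Y k j" if "k < N" for k
      using assms by (auto simp: nsupp_def not_less)
    moreover have "(\<Sum>k<N. if k = i then Y k l * X l j else 0) = Y i l * X l j" if "l < N" for l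
      using assms by (auto simp: nsupp_def not_less)
    ultimately show ?thesis by (simp add: p vm_def bracket_def mmul_def)
  qed
  finally show "mv (grid N) (adm N X) (vm Y) p = vm (bracket N X Y) p" .
qed

lemma der_eq:
  assumes X: "nsupp N X" and "\<forall>m\<in>set ms. nsupp N m"
  shows "der N X ms = dv (grid N) (adm N X) (wl (map vm ms))"
  using assms(2)
proof (induction ms)
  case Nil
  then show ?case by (simp add: der_def dv_one)
next
  case (Cons m ms)
  have "der N X (m # ms) = (\<Sum>j<length (m # ms). wedge_list ((m # ms)[j := bracket N X ((m # ms) ! j)]))"
    by (auto simp: der_def fun_eq_iff sum_fun_apply)
  also have "\<dots> = wedge_list (bracket N X m # ms) + (\<Sum>j<length ms. cr (vm m) (wedge_list (ms[j := bracket N X (ms ! j)])))"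
    unfolding length_Cons sum.lessThan_Suc_shift by (simp add: wedge_list_eq)
  also have "(\<Sum>j<length ms. cr (vm m) (wedge_list (ms[j := bracket N X (ms ! j)]))) = cr (vm m) (der N X ms)"
    unfolding lin_sum[OF lin_cr, symmetric] by (rule arg_cong[where f = "cr (vm m)"]) (auto simp: der_def fun_eq_iff sum_fun_apply)
  also have "wedge_list (bracket N X m # ms) + cr (vm m) (der N X ms) = dv (grid N) (adm N X) (wl (map vm (m # ms)))"
  proof -
    have "supp (grid N) (wl (map vm ms))" using Cons.prems by (intro supp_wl) (auto simp: vsupp_vm)
    then show ?thesis
      using Cons X by (simp add: dv_cr vsupp_vm mv_adm wedge_list_eq)
  qed
  finally show ?case .
qed

lemma supp_isupp: "supp G a \<longleftrightarrow> a \<in> isupp (Pow G)"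
  by (auto simp: supp_def isupp_def)

text \<open>The link from the given action, specified on sorted wedges of elementary matrices, to
  the derivation calculus. Sorting makes each such wedge the basis vector \<open>ket S\<close> with
  no sign.\<close>

lemma act_eq:
  assumes X: "nsupp (msize T n) X" and a: "supp (grid (msize T n)) a"
  shows "act T n X a = dv (grid (msize T n)) (adm (msize T n) X) a"
proof -
  let ?G = "grid (msize T n)"
  have d: "der (msize T n) X (map Emat (sorted_list_of_set S)) = dv ?G (adm (msize T n) X) (ket S)" if "S \<subseteq> ?G" for S
  proof -
    have fS: "finite S" using that by (rule finite_subset) simp
    have e1: "map vm (map Emat (sorted_list_of_set S)) = map ket (sorted_list_of_set S)" by (simp add: vm_Emat)
    have e2: "wl (map ket (sorted_list_of_set S)) = ket S"
      using wl_kets_sorted[OF strict_sorted_list_of_set[of S]] fS by simp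
    have "\<forall>m\<in>set (map Emat (sorted_list_of_set S)). nsupp (msize T n) m"
      using that fS by (auto simp: nsupp_Emat)
    then show ?thesis by (subst der_eq[OF X]) (simp_all only: e1 e2)
  qed
  have "act T n X a = (\<Sum>S\<in>Pow ?G. scl (a S) (dv ?G (adm (msize T n) X) (ket S)))"
    unfolding act_def by (auto simp: fun_eq_iff sum_fun_apply d intro!: sum.cong)
  also have "\<dots> = dv ?G (adm (msize T n) X) (\<Sum>S\<in>Pow ?G. scl (a S) (ket S))"
    by (simp only: lin_sum[OF lin_dv] lin_scl[OF lin_dv])
  also have "(\<Sum>S\<in>Pow ?G. scl (a S) (ket S)) = a"
    by (rule ket_expand[symmetric]) (use a in \<open>auto simp: supp_def vsupp_def\<close>)
  finally show ?thesis .
qed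

text \<open>The conjugate transpose. As the Lie algebra is stable under it, the adjoint of the
  action of X is again the action of an element, which is the source of complete reducibility
  here.\<close>

definition ctr :: "mat \<Rightarrow> mat" where
  "ctr X = (\<lambda>i j. cnj (X j i))"

lemma nsupp_ctr: "nsupp N X \<Longrightarrow> nsupp N (ctr X)"
  by (auto simp: nsupp_def ctr_def)

lemma adm_ctr: "nsupp N X \<Longrightarrow> (\<lambda>s t. cnj (adm N X t s)) = adm N (ctr X)"
proof (intro ext)
  fix s t :: "nat \<times> nat" assume X: "nsupp N X"
  obtain i j k l where s: "s = (i,j)" "t = (k,l)" by force
  show "cnj (adm N X t s) = adm N (ctr X) s t"
    using X unfolding s adm_eq by (auto simp: ctr_def nsupp_def not_less)
qed

lemma ip_dv_adm:
  assumes "nsupp N X"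
  shows "ip (Pow (grid N)) (dv (grid N) (adm N X) a) b = ip (Pow (grid N)) a (dv (grid N) (adm N (ctr X)) b)"
  using ip_dv[OF finite_grid msupp_adm(1)[OF assms] msupp_adm(2)[OF assms]] adm_ctr[OF assms] by simp

lemma lie_nsupp: "X \<in> lie T n \<Longrightarrow> nsupp (msize T n) X"
  by (auto simp: lie_def nsupp_def)

definition bar :: "nat \<Rightarrow> nat \<Rightarrow> nat" where
  "bar N i = N - 1 - i"

lemma bar_lt [simp]: "i < N \<Longrightarrow> bar N i < N" and bar_bar [simp]: "i < N \<Longrightarrow> bar N (bar N i) = i"
  by (auto simp: bar_def)

text \<open>The form is antidiagonal with these entries, so membership in the Lie algebra becomes a
  relation between an entry of X and the entry reflected in the antidiagonal.\<close>

definition sig :: "lie_type \<Rightarrow> nat \<Rightarrow> nat \<Rightarrow> complex" where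
  "sig T n i = (if T = TypeC \<and> \<not> i < n then -1 else 1)"

definition sgnT :: "lie_type \<Rightarrow> complex" where
  "sgnT T = (if T = TypeC then 1 else -1)"

lemma form_eq: "i < msize T n \<Longrightarrow> j < msize T n \<Longrightarrow> form T n i j = (if j = bar (msize T n) i then sig T n i else 0)"
  by (cases T) (auto simp: form_def msize_def bar_def sig_def)

lemma sig_simps [simp]: "cnj (sig T n i) = sig T n i" "sig T n i * sig T n i = 1" "sig T n i \<noteq> 0"
  "sgnT T * sgnT T = 1" "cnj (sgnT T) = sgnT T" "sgnT T \<noteq> 0"
  by (auto simp: sig_def sgnT_def)

lemma sig_bar: "i < msize T n \<Longrightarrow> sig T n (bar (msize T n) i) = - sgnT T * sig T n i"
  by (cases T) (auto simp: sig_def sgnT_def bar_def msize_def)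

lemma lie_iff: "X \<in> lie T n \<longleftrightarrow> nsupp (msize T n) X \<and>
   (\<forall>k<msize T n. \<forall>i<msize T n. sig T n k * X k i + sig T n i * X (bar (msize T n) i) (bar (msize T n) k) = 0)"
proof -
  let ?N = "msize T n"
  have 1: "(\<Sum>k<?N. X k i * form T n k j) + (\<Sum>k<?N. form T n i k * X k j) =
     sig T n (bar ?N j) * X (bar ?N j) i + sig T n i * X (bar ?N i) j" if "i < ?N" "j < ?N" for i j
  proof -
    have "(\<Sum>k<?N. X k i * form T n k j) = (\<Sum>k<?N. if k = bar ?N j then sig T n k * X k i else 0)"
      using that by (intro sum.cong) (auto simp: form_eq bar_def)
    moreover have "(\<Sum>k<?N. form T n i k * X k j) = (\<Sum>k<?N. if k = bar ?N i then sig T n i * X k j else 0)"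
      using that by (intro sum.cong) (auto simp: form_eq)
    ultimately show ?thesis using that by simp
  qed
  have "(\<forall>i<?N. \<forall>j<?N. sig T n (bar ?N j) * X (bar ?N j) i + sig T n i * X (bar ?N i) j = 0) \<longleftrightarrow>
    (\<forall>k<?N. \<forall>i<?N. sig T n k * X k i + sig T n i * X (bar ?N i) (bar ?N k) = 0)"
    by (metis bar_bar bar_lt)
  then show ?thesis unfolding lie_def nsupp_def using 1 by auto
qed

lemma lie_ctr: "X \<in> lie T n \<Longrightarrow> ctr X \<in> lie T n"
proof -
  let ?N = "msize T n"
  assume X: "X \<in> lie T n"
  have "sig T n k * cnj (X i k) + sig T n i * cnj (X (bar ?N k) (bar ?N i)) = 0" if "k < ?N" "i < ?N" for i k
  proof -
    have "sig T n i * X i k + sig T n k * X (bar ?N k) (bar ?N i) = 0"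
      using X that by (auto simp: lie_iff)
    then have "sig T n i * sig T n k * cnj (sig T n i * X i k + sig T n k * X (bar ?N k) (bar ?N i)) = 0" by simp
    then have "(sig T n i * sig T n i) * (sig T n k * cnj (X i k)) + (sig T n k * sig T n k) * (sig T n i * cnj (X (bar ?N k) (bar ?N i))) = 0"
      by (simp only: complex_cnj_add complex_cnj_mult sig_simps(1) distrib_left mult_ac)
    then show ?thesis by simp
  qed
  then show ?thesis using X by (auto simp: lie_iff nsupp_ctr) (simp add: ctr_def)
qed

section \<open>An irreducible submodule through a highest weight vector\<close>

lemma Lam_supp: "a \<in> Lam T n \<Longrightarrow> supp (grid (msize T n)) a"
proof -
  assume "a \<in> Lam T n"
  then obtain k :: nat and c xs where a: "a = (\<lambda>U. \<Sum>i<k. c i * wedge_list (xs i) U)" "\<forall>i<k. set (xs i) \<subseteq> lie T n"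
    unfolding Lam_def by blast
  have "a = (\<Sum>i<k. scl (c i) (wl (map vm (xs i))))"
    unfolding a(1) by (auto simp: fun_eq_iff sum_fun_apply wedge_list_eq)
  moreover have "supp (grid (msize T n)) (\<Sum>i<k. scl (c i) (wl (map vm (xs i))))"
    using a(2) by (intro supp_sum supp_scl supp_wl) (auto simp: vsupp_vm lie_nsupp subset_iff)
  ultimately show ?thesis by simp
qed

lemma ext_zero_0: "ext_zero = 0"
  by (simp add: ext_zero_def fun_eq_iff)

lemma submodule_iff: "submodule T n W \<longleftrightarrow> W \<subseteq> Lam T n \<and> sub W \<and> (\<forall>X\<in>lie T n. \<forall>a\<in>W. act T n X a \<in> W)"
  unfolding submodule_def sub_def ext_zero_0 plus_fun_def scl_def by auto

definition hwv :: "lie_type \<Rightarrow> nat \<Rightarrow> (nat \<Rightarrow> real) \<Rightarrow> ext \<Rightarrow> bool" where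
  "hwv T n lam v \<longleftrightarrow> v \<noteq> 0 \<and> (\<forall>H\<in>cartan T n. act T n H v = scl (weight_val n lam H) v) \<and> (\<forall>X\<in>nplus T n. act T n X v = 0)"

text \<open>In a W of minimal dimension, the orthogonal complement Q of a submodule W' is again a
  submodule, because the Lie algebra is closed under \<open>ctr\<close>. Split v = p + q
  accordingly: whichever part is nonzero is a highest weight vector of weight lam in a smaller
  submodule.\<close>

lemma irreducible_from_hwv:
  assumes M: "submodule T n M" and v: "v \<in> M" "hwv T n lam v"
  shows "\<exists>W. irreducible_submodule T n W \<and> has_highest_weight T n W lam"
proof -
  let ?N = "msize T n" let ?G = "grid ?N" let ?I = "Pow ?G"
  let ?P = "\<lambda>W. submodule T n W \<and> (\<exists>v\<in>W. hwv T n lam v)"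
  have fI: "finite ?I" by simp
  have si: "W \<subseteq> isupp ?I" "sub W" if "submodule T n W" for W
    using that Lam_supp by (auto simp: submodule_iff supp_isupp)
  obtain W where W: "?P W" and min: "\<And>W'. ?P W' \<Longrightarrow> fdim W \<le> fdim W'"
    using ex_has_least_nat[of ?P M fdim] M v by blast
  have sW: "submodule T n W" using W by blast
  obtain v where v: "v \<in> W" "hwv T n lam v" using W by blast
  have actd: "act T n X a = dv ?G (adm ?N X) a" if "X \<in> lie T n" "a \<in> W" for X a
    using that si[OF sW] by (intro act_eq) (auto simp: lie_nsupp supp_isupp)
  have "W' = {0}" if W': "submodule T n W'" "W' \<subseteq> W" "W' \<noteq> W" for W'
  proof (rule ccontr)
    assume nz: "W' \<noteq> {0}"
    define Q where "Q = {w \<in> W. \<forall>y\<in>W'. ip ?I y w = 0}"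
    have QW: "Q \<subseteq> W" by (auto simp: Q_def)
    have int0: "a = 0" if "a \<in> W'" "a \<in> Q" for a
      using that si[OF sW] QW by (intro ip_self_isupp[OF fI]) (auto simp: Q_def)
    have subQ: "sub Q" using si(2)[OF sW] by (auto simp: sub_def Q_def ip_simps)
    have actQ: "act T n X a \<in> Q" if X: "X \<in> lie T n" and a: "a \<in> Q" for X a
    proof -
      have aW: "a \<in> W" using a QW by auto
      then have "act T n X a \<in> W" using sW X by (auto simp: submodule_iff)
      moreover have "ip ?I y (act T n X a) = 0" if y: "y \<in> W'" for y
      proof -
        have yW: "y \<in> W" using y W' by auto
        have cc: "ctr (ctr X) = X" by (simp add: ctr_def)
        have "ip ?I y (act T n X a) = ip ?I (act T n (ctr X) y) a"
          using ip_dv_adm[OF nsupp_ctr[OF lie_nsupp[OF X]], of y a] actd[OF X aW] actd[OF lie_ctr[OF X] yW] cc by simp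
        also have "act T n (ctr X) y \<in> W'" using W'(1) lie_ctr[OF X] y by (auto simp: submodule_iff)
        then have "ip ?I (act T n (ctr X) y) a = 0" using a by (auto simp: Q_def)
        finally show ?thesis .
      qed
      ultimately show ?thesis by (auto simp: Q_def)
    qed
    have Q: "submodule T n Q" using subQ actQ QW sW by (auto simp: submodule_iff)
    obtain p where p: "p \<in> W'" "\<forall>y\<in>W'. ip ?I y (v - p) = 0"
      using projection[OF fI si(2)[OF W'(1)] si(1)[OF W'(1)]] by blast
    define q where "q = v - p"
    have qQ: "q \<in> Q" using p v W' si(2)[OF sW] by (auto simp: Q_def q_def intro!: sub_diff)
    have vpq: "v = p + q" by (simp add: q_def)
    have split: "act T n X v = act T n X p + act T n X q" if "X \<in> lie T n" for X
    proof -
      have "p \<in> W" "q \<in> W" using p W' qQ QW by auto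
      then show ?thesis using actd[OF that v(1)] actd[OF that] lin_add[OF lin_dv, of ?G "adm ?N X" p q] vpq by simp
    qed
    \<comment> \<open>The defect of p in the eigenvector equation is minus the defect of q, so it
      lies both in W' and in Q and must vanish.\<close>
    have key: "act T n X p = scl c p \<and> act T n X q = scl c q" if X: "X \<in> lie T n" and e: "act T n X v = scl c v" for X c
    proof -
      have e2: "act T n X p - scl c p = scl c q - act T n X q"
        using split[OF X] e unfolding vpq by (auto simp: scl_simps fun_eq_iff algebra_simps)
      have "act T n X p - scl c p \<in> W'"
        using W'(1) X p by (auto simp: submodule_iff intro!: sub_diff sub_scl)
      moreover have "act T n X p - scl c p \<in> Q"
        unfolding e2 using actQ[OF X qQ] qQ subQ by (intro sub_diff sub_scl)
      ultimately have "act T n X p - scl c p = 0" by (rule int0)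
      then show ?thesis using e2 by simp
    qed
    have cl: "H \<in> cartan T n \<Longrightarrow> H \<in> lie T n" "X \<in> nplus T n \<Longrightarrow> X \<in> lie T n" for H X
      by (auto simp: cartan_def nplus_def)
    have "hwv T n lam p \<or> hwv T n lam q"
    proof -
      have "p \<noteq> 0 \<or> q \<noteq> 0" using v vpq by (auto simp: hwv_def)
      moreover have "act T n H p = scl (weight_val n lam H) p \<and> act T n H q = scl (weight_val n lam H) q" if "H \<in> cartan T n" for H
        using that v key[OF cl(1)[OF that]] by (auto simp: hwv_def)
      moreover have "act T n X p = 0 \<and> act T n X q = 0" if "X \<in> nplus T n" for X
        using that v key[OF cl(2)[OF that], of 0] by (auto simp: hwv_def scl_simps)
      ultimately show ?thesis by (auto simp: hwv_def)
    qed
    then have "?P W' \<or> ?P Q" using W'(1) Q p(1) qQ by blast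
    moreover have "fdim W' < fdim W" using si[OF sW] si(2)[OF W'(1)] W' by (intro fdim_less[OF fI]) auto
    moreover have "fdim Q < fdim W"
    proof (intro fdim_less[OF fI] psubsetI)
      show "Q \<noteq> W"
      proof
        assume "Q = W"
        then have "W' \<subseteq> {0}" using int0 W'(2) by auto
        then show False using nz sub_0[OF si(2)[OF W'(1)]] by auto
      qed
    qed (use si[OF sW] subQ QW in auto)
    ultimately show False using min[of W'] min[of Q] by auto
  qed
  moreover have "W \<noteq> {ext_zero}" using v by (auto simp: ext_zero_0 hwv_def)
  ultimately have "irreducible_submodule T n W"
    using sW unfolding irreducible_submodule_def ext_zero_0 by blast
  moreover have "has_highest_weight T n W lam"
    using v unfolding has_highest_weight_def hwv_def ext_zero_0 scl_def by blast
  ultimately show ?thesis by blast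
qed

section \<open>Decomposable vectors attached to a matrix\<close>

definition colv :: "nat \<Rightarrow> mat \<Rightarrow> nat \<Rightarrow> nat \<Rightarrow> complex" where
  "colv N g k = (\<lambda>i. if i < N then g i k else 0)"

text \<open>The columns are taken in descending order so that lower columns stand later in the
  wedge, as \<open>wl_cong_unitriangular\<close> requires for adding multiples of them. The boxes in
  \<open>Psi\<close> are listed in descending order for the same reason.\<close>

definition wc :: "nat \<Rightarrow> mat \<Rightarrow> nat \<Rightarrow> nat set \<Rightarrow> complex" where
  "wc N g c = wl (map (colv N g) (rev [0..<c]))"

text \<open>The matrix (u w^T + s w u^T) J, where J is the matrix of the form and s is its opposite symmetry sign;
  these matrices span the Lie algebra.\<close>

definition theta :: "lie_type \<Rightarrow> nat \<Rightarrow> (nat \<Rightarrow> complex) \<Rightarrow> (nat \<Rightarrow> complex) \<Rightarrow> mat" where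
  "theta T n u w = (\<lambda>i j. if i < msize T n \<and> j < msize T n
     then (u i * w (bar (msize T n) j) + sgnT T * w i * u (bar (msize T n) j)) * sig T n (bar (msize T n) j) else 0)"

definition th :: "lie_type \<Rightarrow> nat \<Rightarrow> (nat \<Rightarrow> complex) \<Rightarrow> (nat \<Rightarrow> complex) \<Rightarrow> nat \<times> nat \<Rightarrow> complex" where
  "th T n u w = vm (theta T n u w)"

definition pairs :: "lie_type \<Rightarrow> nat \<Rightarrow> mat \<Rightarrow> nat \<times> nat \<Rightarrow> mat" where
  "pairs T n g = (\<lambda>(i,j). theta T n (colv (msize T n) g i) (colv (msize T n) g j))"

definition Psi :: "lie_type \<Rightarrow> nat \<Rightarrow> (nat \<times> nat) set \<Rightarrow> mat \<Rightarrow> ext" where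
  "Psi T n B g = wedge_list (map (pairs T n g) (rev (sorted_list_of_set B)))"

lemma vsupp_colv: "vsupp {..<N} (colv N g k)"
  by (auto simp: vsupp_def colv_def)

lemma supp_wc: "supp {..<N} (wc N g c)"
  unfolding wc_def by (rule supp_wl) (auto simp: vsupp_colv)

lemma sum_bar: "(\<Sum>j<N. f (bar N j)) = (\<Sum>j<N. f j)"
  by (rule sum.reindex_bij_witness[of _ "bar N" "bar N"]) auto

lemma nsupp_theta: "nsupp (msize T n) (theta T n u w)"
  by (auto simp: nsupp_def theta_def)

lemma theta_lie: "theta T n u w \<in> lie T n"
proof -
  let ?N = "msize T n"
  have "sig T n k * theta T n u w k i + sig T n i * theta T n u w (bar ?N i) (bar ?N k) = 0" if "k < ?N" "i < ?N" for k i
  proof -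
    have 1: "sig T n k * sig T n (bar ?N i) = - sgnT T * (sig T n k * sig T n i)" using that by (simp add: sig_bar)
    have "sig T n k * theta T n u w k i + sig T n i * theta T n u w (bar ?N i) (bar ?N k)
      = (sig T n k * sig T n (bar ?N i)) * (u k * w (bar ?N i) + sgnT T * w k * u (bar ?N i))
        + (sig T n k * sig T n i) * (u (bar ?N i) * w k + sgnT T * w (bar ?N i) * u k)"
      using that by (simp add: theta_def algebra_simps)
    also have "\<dots> = 0"
    proof -
      have "sgnT T = 1 \<or> sgnT T = -1" by (auto simp: sgnT_def)
      then show ?thesis unfolding 1 by (auto simp: algebra_simps)
    qed
    finally show ?thesis .
  qed
  then show ?thesis by (auto simp: lie_iff nsupp_theta)
qed

lemma th_add: "th T n (u + u') w = th T n u w + th T n u' w" "th T n u (w + w') = th T n u w + th T n u w'"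
  and th_scl: "th T n (scl c u) w = scl c (th T n u w)" "th T n u (scl c w) = scl c (th T n u w)"
  by (auto simp: th_def vm_def theta_def fun_eq_iff algebra_simps)

lemma th_0: "th T n 0 w = 0" "th T n u 0 = 0"
  by (auto simp: th_def vm_def theta_def fun_eq_iff)

lemma th_sum: "th T n (\<Sum>i\<in>I. f i) w = (\<Sum>i\<in>I. th T n (f i) w)" "th T n u (\<Sum>i\<in>I. f i) = (\<Sum>i\<in>I. th T n u (f i))"
  by (induction I rule: infinite_finite_induct) (simp_all only: th_0 th_add sum.infinite sum.empty sum.insert simp_thms)

lemma th_swap: "th T n w u = scl (sgnT T) (th T n u w)"
proof -
  have "sgnT T = 1 \<or> sgnT T = -1" by (auto simp: sgnT_def)
  then show ?thesis by (auto simp: th_def vm_def theta_def fun_eq_iff algebra_simps)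
qed

lemma vsupp_th: "vsupp (grid (msize T n)) (th T n u w)"
  by (simp add: th_def vsupp_vm nsupp_theta)

text \<open>Up to the factor 2 this is the product induced on the symmetric or the exterior square.
  The matrix of the form is a signed permutation, hence unitary, and drops out: its signs square to
  1 and \<open>bar\<close> only permutes the summation index.\<close>

lemma ip_th:
  fixes T n defines "N \<equiv> msize T n"
  shows "ip (grid N) (th T n u w) (th T n u' w') =
     2 * (ip {..<N} u u' * ip {..<N} w w' + sgnT T * ip {..<N} u w' * ip {..<N} w u')"
proof -
  have s: "sgnT T * (sgnT T * z) = z" for z by (simp flip: mult.assoc)
  have g: "sig T n a * (sig T n a * z) = z" for a z by (simp flip: mult.assoc)
  have "ip (grid N) (th T n u w) (th T n u' w') =
    (\<Sum>i<N. \<Sum>j<N. (u i * w (bar N j) + sgnT T * w i * u (bar N j)) * cnj (u' i * w' (bar N j) + sgnT T * w' i * u' (bar N j)))"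
    unfolding ip_def grid_def sum.cartesian_product
    by (rule sum.cong) (auto simp: th_def vm_def theta_def N_def g algebra_simps)
  also have "\<dots> = (\<Sum>i<N. \<Sum>j<N. (u i * w j + sgnT T * w i * u j) * cnj (u' i * w' j + sgnT T * w' i * u' j))"
    by (intro sum.cong refl sum_bar[where f = "\<lambda>j. (u _ * w j + sgnT T * w _ * u j) * cnj (u' _ * w' j + sgnT T * w' _ * u' j)"])
  also have "\<dots> = (\<Sum>i<N. \<Sum>j<N. (u i * cnj (u' i)) * (w j * cnj (w' j)) + sgnT T * ((u i * cnj (w' i)) * (w j * cnj (u' j)))
      + sgnT T * ((w i * cnj (u' i)) * (u j * cnj (w' j))) + (w i * cnj (w' i)) * (u j * cnj (u' j)))"
    by (intro sum.cong refl) (simp add: algebra_simps s)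
  also have "\<dots> = ip {..<N} u u' * ip {..<N} w w' + sgnT T * (ip {..<N} u w' * ip {..<N} w u')
      + sgnT T * (ip {..<N} w u' * ip {..<N} u w') + ip {..<N} w w' * ip {..<N} u u'"
    unfolding ip_def sum.distrib unfolding sum_product unfolding sum_distrib_left ..
  finally show ?thesis by (simp add: algebra_simps)
qed

text \<open>Equivariance of theta. With J the matrix of the form, J X = - X^T J turns right
  multiplication by X into its action on the transposed vectors; \<open>key\<close> is this step in
  coordinates.\<close>

lemma mv_th:
  fixes T n defines "N \<equiv> msize T n"
  assumes X: "X \<in> lie T n"
  shows "mv (grid N) (adm N X) (th T n u w) = th T n (mv {..<N} X u) w + th T n u (mv {..<N} X w)"
proof -
  have rel: "sig T n (bar N k) * X k j = - (sig T n (bar N j) * X (bar N j) (bar N k))" if "k < N" "j < N" for k j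
  proof -
    have "sig T n k * X k j + sig T n j * X (bar N j) (bar N k) = 0"
      using X that by (auto simp: lie_iff N_def)
    then have "sig T n k * X k j = - (sig T n j * X (bar N j) (bar N k))" by (simp add: add_eq_0_iff2)
    then show ?thesis using that by (simp add: sig_bar N_def mult.assoc)
  qed
  have key: "(\<Sum>k<N. v (bar N k) * sig T n (bar N k) * X k j) = - (sig T n (bar N j) * mv {..<N} X v (bar N j))"
    if "j < N" for v j
  proof -
    have "(\<Sum>k<N. v (bar N k) * sig T n (bar N k) * X k j) = (\<Sum>k<N. - (sig T n (bar N j) * (X (bar N j) (bar N k) * v (bar N k))))"
    proof (rule sum.cong[OF refl])
      fix k assume "k \<in> {..<N}"
      then have "v (bar N k) * sig T n (bar N k) * X k j = v (bar N k) * (- (sig T n (bar N j) * X (bar N j) (bar N k)))"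
        using rel[of k j] that by (simp only: mult.assoc lessThan_iff)
      then show "v (bar N k) * sig T n (bar N k) * X k j = - (sig T n (bar N j) * (X (bar N j) (bar N k) * v (bar N k)))"
        by simp
    qed
    also have "\<dots> = - (sig T n (bar N j) * (\<Sum>k<N. X (bar N j) (bar N k) * v (bar N k)))"
      by (simp add: sum_negf sum_distrib_left)
    also have "(\<Sum>k<N. X (bar N j) (bar N k) * v (bar N k)) = mv {..<N} X v (bar N j)"
      unfolding mv_def by (rule sum_bar)
    finally show ?thesis .
  qed
  have "bracket N X (theta T n u w) i j = theta T n (mv {..<N} X u) w i j + theta T n u (mv {..<N} X w) i j" for i j
  proof (cases "i < N \<and> j < N")
    case True
    have "mmul N X (theta T n u w) i j = (mv {..<N} X u i * w (bar N j) + sgnT T * mv {..<N} X w i * u (bar N j)) * sig T n (bar N j)"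
      using True unfolding mmul_def mv_def N_def
      by (simp add: theta_def sum.distrib sum_distrib_left sum_distrib_right algebra_simps)
    moreover have "mmul N (theta T n u w) X i j =
       u i * (\<Sum>k<N. w (bar N k) * sig T n (bar N k) * X k j) + sgnT T * w i * (\<Sum>k<N. u (bar N k) * sig T n (bar N k) * X k j)"
      using True unfolding mmul_def sum_distrib_left N_def sum.distrib[symmetric]
      by (intro sum.cong refl) (simp add: theta_def algebra_simps)
    ultimately show ?thesis using True unfolding bracket_def by (simp only: key) (simp add: theta_def N_def[symmetric] algebra_simps)
  next
    case False
    then show ?thesis
      using nsupp_bracket[OF lie_nsupp[OF X] nsupp_theta[of T n u w]] by (auto simp: nsupp_def theta_def N_def not_less)
  qed
  then have "vm (bracket N X (theta T n u w)) = th T n (mv {..<N} X u) w + th T n u (mv {..<N} X w)"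
    by (auto simp: th_def vm_def fun_eq_iff)
  then show ?thesis using mv_adm[OF lie_nsupp[OF X] nsupp_theta[of T n u w]] unfolding N_def th_def by simp
qed

lemma Psi_eq: "Psi T n B g = wl (map (\<lambda>(i,j). th T n (colv (msize T n) g i) (colv (msize T n) g j)) (rev (sorted_list_of_set B)))"
  unfolding Psi_def wedge_list_eq map_map by (rule arg_cong[where f = wl]) (auto simp: pairs_def th_def)

lemma Psi_sum_Lam: "(\<Sum>i<(k::nat). scl (c i) (Psi T n B (g i))) \<in> Lam T n"
  unfolding Lam_def
proof (rule CollectI, intro exI conjI)
  show "(\<Sum>i<k. scl (c i) (Psi T n B (g i))) = (\<lambda>U. \<Sum>i<k. c i * wedge_list (map (pairs T n (g i)) (rev (sorted_list_of_set B))) U)"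
    by (auto simp: fun_eq_iff sum_fun_apply Psi_def)
qed (auto simp: pairs_def theta_lie)

section \<open>The boxes and columns of a 0-1 sequence\<close>

text \<open>The pairs (p,j) are the boxes of a Young diagram in Frobenius notation, shifted by e = 1 in
  the orthogonal case, where theta(u,u) = 0; the multiset collects its column lengths. The number p
  counts the ones read so far, q the zeros.\<close>

inductive em :: "nat \<Rightarrow> nat \<Rightarrow> nat \<Rightarrow> nat \<Rightarrow> (nat \<times> nat) set \<Rightarrow> nat multiset \<Rightarrow> bool" for N e where
  em0: "em N e 0 0 {} {#}"
| em1: "em N e p q B C \<Longrightarrow> p + q + 2 * e < N + 1 \<Longrightarrow> em N e (p + 1) q (B \<union> {(p,j) | j. p + e \<le> j \<and> j < N - q}) (add_mset (N - q) C)"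
| em2: "em N e p q B C \<Longrightarrow> p + q + 2 * e < N + 1 \<Longrightarrow> em N e p (q + 1) B (add_mset p C)"

lemma em_finite: "em N e p q B C \<Longrightarrow> finite B"
proof (induction rule: em.induct)
  case (em1 p q B C)
  have "{(p,j) | j. p + e \<le> j \<and> j < N - q} = Pair p ` {p + e..<N - q}" by auto
  then show ?case using em1 by simp
qed auto

lemma em_box: "em N e p q B C \<Longrightarrow> (i,j) \<in> B \<Longrightarrow> i < p \<and> i + e \<le> j \<and> j < N"
  by (induction rule: em.induct) auto

lemma em_row: "em N e p q B C \<Longrightarrow> i < p \<Longrightarrow> i + e \<le> j \<Longrightarrow> j < N - q \<Longrightarrow> (i,j) \<in> B"
  by (induction rule: em.induct) (auto simp: less_Suc_eq)

text \<open>The closure property behind the invariance of Psi under upper unitriangular matrices: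
  every smaller pair produced by a column operation is again a box.\<close>

lemma em_ideal: "em N e p q B C \<Longrightarrow> (i,j) \<in> B \<Longrightarrow> i' \<le> i \<Longrightarrow> j' \<le> j \<Longrightarrow> i' + e \<le> j' \<Longrightarrow> (i',j') \<in> B"
proof (induction rule: em.induct)
  case (em1 p q B C)
  show ?case
  proof (cases "(i,j) \<in> B")
    case False
    then have ij: "i = p" "j < N - q" using em1.prems(1) by auto
    show ?thesis
    proof (cases "i' = p")
      case True
      then show ?thesis using ij em1.prems by simp
    next
      case False
      then have "i' < p" "j' < N - q" using ij em1.prems by linarith+
      then show ?thesis using em_row[OF em1.hyps(1)] em1.prems(4) by simp
    qed
  qed (use em1 in simp)
qed auto

lemma em_col: "em N e p q B C \<Longrightarrow> c \<in># C \<Longrightarrow> c \<le> N"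
  by (induction rule: em.induct) auto

section \<open>The reproducing kernel\<close>

definition mm :: "nat \<Rightarrow> mat \<Rightarrow> (nat \<Rightarrow> nat \<Rightarrow> complex) \<Rightarrow> mat" where
  "mm N g U = (\<lambda>i j. \<Sum>k<N. g i k * U k j)"

lemma colv_mm: "colv N (mm N g U) j = (\<Sum>k<N. scl (U k j) (colv N g k))"
  by (auto simp: colv_def mm_def fun_eq_iff sum_fun_apply mult.commute)

definition pairing :: "nat \<Rightarrow> mat \<Rightarrow> mat \<Rightarrow> nat \<Rightarrow> nat \<Rightarrow> complex" where
  "pairing N g h i k = ip {..<N} (colv N g i) (colv N h k)"

text \<open>Positivity of the Hermitian part of the Gram matrix makes all its leading minors nonzero, so that
  it has a triangular factorization.\<close>

definition gp :: "nat \<Rightarrow> mat \<Rightarrow> mat \<Rightarrow> bool" where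
  "gp N g h \<longleftrightarrow> (\<forall>x. (\<exists>i<N. x i \<noteq> 0) \<longrightarrow> Re (ip {..<N} (mv {..<N} g x) (mv {..<N} h x)) > 0)"

lemma ip_mv_right: "ip {..<N} a (mv {..<N} h x) = (\<Sum>k<N. cnj (x k) * ip {..<N} a (colv N h k))"
proof -
  have "ip {..<N} a (mv {..<N} h x) = (\<Sum>i<N. \<Sum>k<N. cnj (x k) * (a i * cnj (h i k)))"
    by (simp add: ip_def mv_def sum_distrib_left mult_ac)
  also have "\<dots> = (\<Sum>k<N. \<Sum>i<N. cnj (x k) * (a i * cnj (h i k)))" by (rule sum.swap)
  finally show ?thesis by (simp add: ip_def colv_def sum_distrib_left)
qed

lemma mv_add: "mv G g (x + y) = mv G g x + mv G g y" and mv_scl: "mv G g (scl c x) = scl c (mv G g x)"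
  by (auto simp: mv_def fun_eq_iff algebra_simps sum.distrib sum_distrib_left)

lemma pairing_mm: "pairing N (mm N g U) h j k = ip {..<N} (mv {..<N} g (\<lambda>i. U i j)) (colv N h k)"
  unfolding pairing_def ip_def by (intro sum.cong refl) (auto simp: colv_def mm_def mv_def)

text \<open>Were the pivot zero as well, g x would be orthogonal to every column of h that enters h
  x, against positivity at x.\<close>

lemma pairing_pivot:
  assumes "gp N g h" "j < N" "x j = 1" "\<And>i. j < i \<Longrightarrow> x i = 0"
    "\<And>k. k < j \<Longrightarrow> ip {..<N} (mv {..<N} g x) (colv N h k) = 0"
  shows "ip {..<N} (mv {..<N} g x) (colv N h j) \<noteq> 0"
proof
  assume z: "ip {..<N} (mv {..<N} g x) (colv N h j) = 0"
  have "ip {..<N} (mv {..<N} g x) (mv {..<N} h x) = 0"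
    unfolding ip_mv_right
  proof (rule sum.neutral, rule ballI)
    fix k assume "k \<in> {..<N}"
    show "cnj (x k) * ip {..<N} (mv {..<N} g x) (colv N h k) = 0"
      using assms(4)[of k] assms(5)[of k] z by (cases k j rule: linorder_cases) auto
  qed
  moreover have "\<exists>i<N. x i \<noteq> 0" using assms(2,3) by auto
  ultimately show False using assms(1) unfolding gp_def by fastforce
qed

text \<open>Gaussian elimination: the pairings with columns k < j are cleared one after another in
  the inner induction, each with the solution already found for that smaller index, whose pivot
  \<open>L\<close> is nonzero.\<close>

lemma triangular_column:
  assumes gp: "gp N g h" and "j < N"
  shows "\<exists>x. x j = 1 \<and> (\<forall>i>j. x i = 0) \<and> (\<forall>k<j. ip {..<N} (mv {..<N} g x) (colv N h k) = 0)"
  using assms(2)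
proof (induction j rule: less_induct)
  case (less j)
  have "\<exists>x. x j = 1 \<and> (\<forall>i>j. x i = 0) \<and> (\<forall>k<m. ip {..<N} (mv {..<N} g x) (colv N h k) = 0)" if "m \<le> j" for m
    using that
  proof (induction m)
    case 0
    show ?case by (rule exI[of _ "ket j"]) (simp add: ket_def)
  next
    case (Suc m)
    then obtain x where x: "x j = 1" "\<forall>i>j. x i = 0" "\<forall>k<m. ip {..<N} (mv {..<N} g x) (colv N h k) = 0" by auto
    obtain y where y: "y m = 1" "\<forall>i>m. y i = 0" "\<forall>k<m. ip {..<N} (mv {..<N} g y) (colv N h k) = 0"
      using less.IH[of m] Suc.prems less.prems by auto
    define L where "L = ip {..<N} (mv {..<N} g y) (colv N h m)"
    have L: "L \<noteq> 0" unfolding L_def using Suc.prems less.prems y by (intro pairing_pivot[OF gp]) auto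
    define c where "c = - (ip {..<N} (mv {..<N} g x) (colv N h m) / L)"
    have "ip {..<N} (mv {..<N} g (x + scl c y)) (colv N h k) = 0" if "k < Suc m" for k
    proof (cases "k = m")
      case True
      have "ip {..<N} (mv {..<N} g (x + scl c y)) (colv N h m) = ip {..<N} (mv {..<N} g x) (colv N h m) + c * L"
        unfolding mv_add mv_scl ip_simps L_def ..
      then show ?thesis using L True by (simp add: c_def)
    next
      case False
      then show ?thesis using that x(3) y(3) by (simp add: mv_add mv_scl ip_simps)
    qed
    moreover have "(x + scl c y) j = 1" "\<forall>i>j. (x + scl c y) i = 0" using x y Suc.prems by auto
    ultimately show ?case by blast
  qed
  from this[of j] show ?case by simp
qed

lemma triangularize:
  assumes gp: "gp N g h"
  shows "\<exists>U. (\<forall>j<N. U j j = 1) \<and> (\<forall>i j. j < N \<longrightarrow> j < i \<longrightarrow> U i j = 0) \<and>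
    (\<forall>j<N. \<forall>k<j. pairing N (mm N g U) h j k = 0)"
proof -
  have "\<forall>j. \<exists>x. j < N \<longrightarrow> x j = 1 \<and> (\<forall>i>j. x i = 0) \<and> (\<forall>k<j. ip {..<N} (mv {..<N} g x) (colv N h k) = 0)"
    using triangular_column[OF gp] by blast
  then obtain X where X: "\<forall>j. j < N \<longrightarrow> X j j = 1 \<and> (\<forall>i>j. X j i = 0) \<and> (\<forall>k<j. ip {..<N} (mv {..<N} g (X j)) (colv N h k) = 0)"
    by metis
  then show ?thesis by (intro exI[of _ "\<lambda>i j. X j i"]) (simp add: pairing_mm)
qed

lemma drop_sorted_desc:
  fixes xs :: "'a::linorder list"
  assumes "sorted_wrt (>) xs" "t < length xs" "y \<in> set xs" "y < xs ! t"
  shows "y \<in> set (drop (Suc t) xs)"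
proof -
  obtain s where s: "s < length xs" "y = xs ! s" using assms(3) by (auto simp: in_set_conv_nth)
  have "t < s"
  proof (rule ccontr)
    assume "\<not> t < s"
    then consider "s = t" | "s < t" by linarith
    then show False
    proof cases
      case 2
      then have "xs ! s > xs ! t" using assms(1,2) sorted_wrt_nth_less by blast
      then show False using s assms(4) by (metis order_less_asym)
    qed (use s assms in auto)
  qed
  then have "drop (Suc t) xs ! (s - Suc t) = y" "s - Suc t < length (drop (Suc t) xs)" using s by auto
  then show ?thesis using nth_mem by metis
qed

lemma sorted_rev_list: "finite B \<Longrightarrow> sorted_wrt (>) (rev (sorted_list_of_set B))"
  using strict_sorted_list_of_set[of B] by (simp add: sorted_wrt_rev)

lemma wc_mm:
  assumes "c \<le> N" "\<forall>j<N. U j j = 1" "\<forall>i j. j < N \<longrightarrow> j < i \<longrightarrow> U i j = 0"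
  shows "wc N (mm N g U) c = wc N g c"
  unfolding wc_def
proof (rule wl_cong_unitriangular)
  fix t a assume t: "t < length (map (colv N g) (rev [0..<c]))"
    and z: "\<And>x. x \<in> set (drop (Suc t) (map (colv N g) (rev [0..<c]))) \<Longrightarrow> cr x a = 0"
  define j where "j = rev [0..<c] ! t"
  have jc: "j < c" using t nth_mem[of t "rev [0..<c]"] by (auto simp: j_def)
  have zz: "cr (colv N g k) a = 0" if "k < j" for k
  proof -
    have "k \<in> set (drop (Suc t) (rev [0..<c]))"
      using t that jc by (intro drop_sorted_desc) (auto simp: sorted_wrt_rev j_def)
    then show ?thesis by (intro z) (auto simp: drop_map)
  qed
  have "cr (colv N (mm N g U) j) a = (\<Sum>k<N. scl (U k j) (cr (colv N g k) a))"
    by (simp only: colv_mm cr_sum cr_scl)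
  also have "\<dots> = (\<Sum>k<N. if k = j then cr (colv N g j) a else 0)"
  proof (intro sum.cong refl)
    fix k assume "k \<in> {..<N}"
    show "scl (U k j) (cr (colv N g k) a) = (if k = j then cr (colv N g j) a else 0)"
    proof (cases k j rule: linorder_cases)
      case less
      then show ?thesis by (simp add: zz scl_simps)
    next
      case equal
      then show ?thesis using assms jc by (simp add: scl_simps)
    next
      case greater
      then have "U k j = 0" using assms jc by simp
      then show ?thesis using greater by (simp add: scl_simps)
    qed
  qed
  also have "\<dots> = cr (colv N g j) a" using jc assms(1) by simp
  finally show "cr (map (colv N (mm N g U)) (rev [0..<c]) ! t) a = cr (map (colv N g) (rev [0..<c]) ! t) a"
    using t by (simp add: j_def)
qed simp

definition ofs :: "lie_type \<Rightarrow> nat" where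
  "ofs T = (if T = TypeC then 0 else 1)"

text \<open>Expanding both columns at a box (i,j) yields theta of columns i' <= i and j' <= j. Apart
  from the box itself, such a pair is a smaller box of B, the reflection of one, or, in the
  orthogonal case, a diagonal pair, where theta vanishes. Smaller boxes stand later in the wedge and
  therefore kill the summand.\<close>

lemma Psi_mm:
  assumes em: "em N (ofs T) p q B C" and N: "N = msize T n"
    and U: "\<forall>j<N. U j j = 1" "\<forall>i j. j < N \<longrightarrow> j < i \<longrightarrow> U i j = 0"
  shows "Psi T n B (mm N g U) = Psi T n B g"
  unfolding Psi_eq
proof (rule wl_cong_unitriangular)
  let ?bs = "rev (sorted_list_of_set B)"
  let ?f = "\<lambda>g (i,j). th T n (colv (msize T n) g i) (colv (msize T n) g j)"
  note ep = em_finite[OF em] em_box[OF em] em_row[OF em] em_ideal[OF em]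
  fix t a assume t: "t < length (map (?f g) ?bs)" and z: "\<And>x. x \<in> set (drop (Suc t) (map (?f g) ?bs)) \<Longrightarrow> cr x a = 0"
  obtain i j where ij: "?bs ! t = (i,j)" by force
  have ijB: "(i,j) \<in> B" using t nth_mem[of t ?bs] ij ep(1) by auto
  have b: "i + ofs T \<le> j" "j < N" "i < N" using ep(2)[OF ijB] by auto
  let ?c = "\<lambda>i. colv N g i"
  have z1: "cr (th T n (?c i') (?c j')) a = 0" if "(i',j') \<in> B" "(i',j') < (i,j)" for i' j'
  proof -
    have "(i',j') \<in> set (drop (Suc t) ?bs)"
      using t that ep(1) ij by (intro drop_sorted_desc sorted_rev_list) auto
    then have "?f g (i',j') \<in> set (drop (Suc t) (map (?f g) ?bs))" unfolding drop_map set_map by (rule imageI)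
    then show ?thesis using z N by auto
  qed
  have z2: "cr (th T n (?c i') (?c j')) a = 0" if ne: "(i',j') \<noteq> (i,j)" and le: "i' \<le> i" "j' \<le> j" for i' j'
  proof -
    consider "i' + ofs T \<le> j'" | "j' + ofs T \<le> i'" | "i' = j'" "ofs T = 1" by (cases "T = TypeC"; cases i' j' rule: linorder_cases) (auto simp: ofs_def)
    then show ?thesis
    proof cases
      case 1
      show ?thesis using ep(4)[OF ijB le 1] ne le by (intro z1) (auto simp: less_prod_def)
    next
      case 2
      show ?thesis
      proof (cases "i' = j'")
        case True
        then show ?thesis using ep(4)[OF ijB le] 2 ne le by (intro z1) (auto simp: less_prod_def)
      next
        case False
        then have "j' < i'" using 2 by auto
        then have "(j',i') \<in> B" "(j',i') < (i,j)" using ep(4)[OF ijB, of j' i'] 2 le b by (auto simp: less_prod_def)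
        then have "cr (th T n (?c j') (?c i')) a = 0" by (rule z1)
        then show ?thesis by (subst th_swap) (simp add: cr_scl scl_simps)
      qed
    next
      case 3
      have "T \<noteq> TypeC" using 3 by (auto simp: ofs_def)
      then have "th T n (?c i') (?c i') x = 0" for x
        using fun_cong[OF th_swap[of T n "?c i'" "?c i'"], of x] by (simp add: sgnT_def)
      then have "th T n (?c i') (?c i') = 0" by auto
      then show ?thesis using 3 by (simp add: cr_0)
    qed
  qed
  have "cr (th T n (colv N (mm N g U) i) (colv N (mm N g U) j)) a =
     (\<Sum>j'<N. \<Sum>i'<N. scl (U j' j * U i' i) (cr (th T n (?c i') (?c j')) a))"
    by (simp only: colv_mm th_sum th_scl cr_sum cr_scl scl_sum scl_simps(3))
  also have "\<dots> = (\<Sum>j'<N. \<Sum>i'<N. if i' = i then (if j' = j then cr (th T n (?c i) (?c j)) a else 0) else 0)"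
  proof (intro sum.cong refl)
    fix i' j' assume ij': "j' \<in> {..<N}" "i' \<in> {..<N}"
    show "scl (U j' j * U i' i) (cr (th T n (?c i') (?c j')) a) = (if i' = i then (if j' = j then cr (th T n (?c i) (?c j)) a else 0) else 0)"
    proof (cases "i' \<le> i \<and> j' \<le> j")
      case True
      then show ?thesis using z2[of i' j'] U(1) b by (cases "(i',j') = (i,j)") (auto simp: scl_simps)
    next
      case False
      then have "U j' j * U i' i = 0" using U(2) b by (auto simp: not_le)
      then show ?thesis using False by (auto simp: scl_simps)
    qed
  qed
  also have "\<dots> = cr (th T n (?c i) (?c j)) a" using b by simp
  finally show "cr (map (?f (mm N g U)) ?bs ! t) a = cr (map (?f g) ?bs ! t) a"
    using t ij N by simp
qed simp

lemma ip_wc_triangular: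
  assumes "c \<le> N" "\<forall>j<N. \<forall>k<j. pairing N g h j k = 0"
  shows "ip (Pow {..<N}) (wc N g c) (wc N h c) = (\<Prod>k<c. pairing N g h k k)"
proof -
  have "ip (Pow {..<N}) (wc N g c) (wc N h c) = (\<Prod>i<c. pairing N g h (c - Suc i) (c - Suc i))"
    unfolding wc_def
  proof (subst ip_wl_triangular)
    fix i j assume "i < j" "j < length (map (colv N g) (rev [0..<c]))"
    then show "ip {..<N} (map (colv N g) (rev [0..<c]) ! i) (map (colv N h) (rev [0..<c]) ! j) = 0"
      using assms by (auto simp: rev_nth pairing_def)
  qed (auto simp: vsupp_colv rev_nth pairing_def intro!: prod.cong)
  also have "\<dots> = (\<Prod>k<c. pairing N g h k k)"
    by (rule prod.nat_diff_reindex)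
  finally show ?thesis .
qed

text \<open>The squared norm of theta(e_i, e_j) for orthonormal vectors; its two terms reinforce
  each other on the diagonal, which B meets only in type C.\<close>

definition kap :: "nat \<times> nat \<Rightarrow> complex" where
  "kap = (\<lambda>(i,j). if i = j then 4 else 2)"

text \<open>Triangularity passes to theta: for a lexicographically larger box against a smaller one,
  both products in \<open>ip_th\<close> contain a pairing of a higher with a lower column.\<close>

lemma ip_Psi_triangular:
  assumes em: "em N (ofs T) p q B C" and N: "N = msize T n"
    and M: "\<forall>j<N. \<forall>k<j. pairing N g h j k = 0"
  shows "ip (Pow (grid N)) (Psi T n B g) (Psi T n B h) = (\<Prod>(i,j)\<in>B. kap (i,j) * (pairing N g h i i * pairing N g h j j))"
proof -
  let ?bs = "rev (sorted_list_of_set B)"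
  let ?f = "\<lambda>g (i,j). th T n (colv (msize T n) g i) (colv (msize T n) g j)"
  note ep = em_finite[OF em] em_box[OF em] em_row[OF em] em_ideal[OF em]
  have e: "ip (grid N) (?f g (i,j)) (?f h (k,l)) = 2 * (pairing N g h i k * pairing N g h j l + sgnT T * pairing N g h i l * pairing N g h j k)" for i j k l
    unfolding N by (simp add: ip_th pairing_def)
  have off: "ip (grid N) (?f g b) (?f h b') = 0" if bB: "b \<in> B" "b' \<in> B" "b > b'" for b b'
  proof -
    obtain i j k l where b: "b = (i,j)" "b' = (k,l)" by force
    have "i + ofs T \<le> j" "j < N" "i < N" "k + ofs T \<le> l" "l < N" using ep(2) bB b by fastforce+
    moreover have "k < i \<or> k = i \<and> l < j" using bB b by (auto simp: less_prod_def)
    ultimately have "pairing N g h i k * pairing N g h j l = 0" "pairing N g h i l * pairing N g h j k = 0"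
      using M by auto
    then show ?thesis unfolding b e by auto
  qed
  have dg: "ip (grid N) (?f g b) (?f h b) = (case b of (i,j) \<Rightarrow> kap (i,j) * (pairing N g h i i * pairing N g h j j))" if bB: "b \<in> B" for b
  proof -
    obtain i j where b: "b = (i,j)" by force
    have ij: "i + ofs T \<le> j" "j < N" using ep(2) bB b by auto
    show ?thesis
    proof (cases "i = j")
      case True
      then have "T = TypeC" using ij by (auto simp: ofs_def split: if_splits)
      then show ?thesis unfolding b e using True by (simp add: kap_def sgnT_def)
    next
      case False
      then have "pairing N g h j i = 0" using M ij by auto
      then show ?thesis unfolding b e using False by (simp add: kap_def)
    qed
  qed
  have "ip (Pow (grid N)) (Psi T n B g) (Psi T n B h) = (\<Prod>t<length ?bs. ip (grid N) (?f g (?bs ! t)) (?f h (?bs ! t)))"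
    unfolding Psi_eq
  proof (subst ip_wl_triangular)
    fix s t assume st: "s < t" "t < length (map (?f g) ?bs)"
    then have "?bs ! s > ?bs ! t" using sorted_rev_list[OF ep(1)] sorted_wrt_nth_less by fastforce
    moreover have "?bs ! s \<in> B" "?bs ! t \<in> B" using st nth_mem[of s ?bs] nth_mem[of t ?bs] ep(1) by auto
    ultimately show "ip (grid N) (map (?f g) ?bs ! s) (map (?f h) ?bs ! t) = 0"
      using st off by simp
  qed (auto simp: N vsupp_th)
  also have "\<dots> = prod_list (map (\<lambda>b. ip (grid N) (?f g b) (?f h b)) ?bs)"
    by (simp add: prod.list_conv_set_nth atLeast0LessThan)
  also have "\<dots> = (\<Prod>b\<in>B. ip (grid N) (?f g b) (?f h b))"
    using ep(1) by (subst prod.distinct_set_conv_list[symmetric]) auto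
  also have "\<dots> = (\<Prod>b\<in>B. case b of (i,j) \<Rightarrow> kap (i,j) * (pairing N g h i i * pairing N g h j j))"
    by (intro prod.cong refl dg)
  finally show ?thesis .
qed

text \<open>The last factor stands for the N + 1 - 2e - p - q columns not yet read, all of length at
  least p. When the sequence is complete it is 1, and boxes and columns give the same monomial in
  the L k. This is the combinatorial content of the kernel formula.\<close>

lemma em_prod:
  fixes L :: "nat \<Rightarrow> complex"
  assumes "em N e p q B C" "e \<le> 1"
  shows "(\<Prod>(i,j)\<in>B. L i * L j) = (\<Prod>c\<in>#C. \<Prod>k<c. L k) * (\<Prod>k<p. L k ^ (N + 1 - 2 * e - p - q))"
  using assms(1)
proof induction
  case em0
  then show ?case by simp
next
  case (em1 p q B C)
  note ep = em_finite[OF em1.hyps(1)] em_box[OF em1.hyps(1)]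
  let ?R = "{(p,j) | j. p + e \<le> j \<and> j < N - q}"
  have R: "?R = Pair p ` {p + e..<N - q}" by auto
  define r where "r = N - 2 * e - p - q"
  have r: "N + 1 - 2 * e - p - q = Suc r" "N + 1 - 2 * e - (p + 1) - q = r" "N - q = p + 2 * e + r"
    using em1.hyps(2) by (auto simp: r_def)
  have "(\<Prod>(i,j)\<in>B \<union> ?R. L i * L j) = (\<Prod>(i,j)\<in>B. L i * L j) * (\<Prod>(i,j)\<in>?R. L i * L j)"
    using ep(1,2) by (intro prod.union_disjoint) (auto simp: R)
  also have "(\<Prod>(i,j)\<in>?R. L i * L j) = (\<Prod>j=p+e..<N-q. L p * L j)"
    unfolding R by (subst prod.reindex) (auto simp: inj_on_def)
  also have "\<dots> = L p ^ (N - q - (p + e)) * (\<Prod>j=p+e..<N-q. L j)"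
    by (simp add: prod.distrib)
  also have "(\<Prod>j=p+e..<N-q. L j) * L p ^ (N - q - (p + e)) = (\<Prod>j=p..<N-q. L j) * L p ^ r"
  proof (cases "e = 0")
    case True
    then show ?thesis using r by simp
  next
    case False
    then have e: "e = 1" using assms(2) by linarith
    \<comment> \<open>The row of boxes omits the diagonal but consists of r + 1 boxes, so one power
      of \<open>L p\<close> is free to fill the missing factor.\<close>
    have "(\<Prod>j=p..<N-q. L j) = L p * (\<Prod>j=p+1..<N-q. L j)"
      using r(3) e by (simp only: Suc_eq_plus1[symmetric]) (rule prod.atLeast_Suc_lessThan, linarith)
    moreover have "N - q - (p + e) = Suc r" using r(3) e by linarith
    ultimately show ?thesis by (simp only: e power_Suc mult_ac)
  qed
  then have "L p ^ (N - q - (p + e)) * (\<Prod>j=p+e..<N-q. L j) = (\<Prod>j=p..<N-q. L j) * L p ^ r" by (simp add: mult.commute)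
  also have "(\<Prod>(i,j)\<in>B. L i * L j) * ((\<Prod>j=p..<N-q. L j) * L p ^ r) =
      (\<Prod>c\<in>#C. \<Prod>k<c. L k) * (((\<Prod>k<p. L k) * (\<Prod>j=p..<N-q. L j)) * ((\<Prod>k<p. L k ^ r) * L p ^ r))"
    unfolding em1.IH r by (simp add: prod.distrib mult_ac)
  also have "(\<Prod>k<p. L k) * (\<Prod>j=p..<N-q. L j) = (\<Prod>k<N-q. L k)"
    using r prod.atLeastLessThan_concat[of 0 p "N-q" L] by (simp add: atLeast0LessThan)
  finally show ?case unfolding r by (simp add: mult_ac)
next
  case (em2 p q B C)
  define r where "r = N - 2 * e - p - q"
  have r: "N + 1 - 2 * e - p - q = Suc r" "N + 1 - 2 * e - p - (q + 1) = r"
    using em2.hyps(2) by (auto simp: r_def)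
  show ?case unfolding em2.IH r by (simp add: prod.distrib mult_ac)
qed

section \<open>First-order jets of polynomial functions\<close>

text \<open>Value and derivative at 0, read off from the coefficients of a polynomial. This keeps
  differentiation algebraic, and the pair is determined by the function.\<close>

definition jet :: "(complex \<Rightarrow> complex) \<Rightarrow> complex \<Rightarrow> complex \<Rightarrow> bool" where
  "jet F a b \<longleftrightarrow> (\<exists>p. (\<forall>t. F t = poly p t) \<and> coeff p 0 = a \<and> coeff p (Suc 0) = b)"

definition pfun :: "(complex \<Rightarrow> complex) \<Rightarrow> bool" where
  "pfun F \<longleftrightarrow> (\<exists>p. \<forall>t. F t = poly p t)"

lemma jet_pfun: "jet F a b \<Longrightarrow> pfun F"
  by (auto simp: jet_def pfun_def)

lemma pfun_jet: "pfun F \<Longrightarrow> \<exists>a b. jet F a b"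
  by (auto simp: jet_def pfun_def)

lemma jet_linear: "jet (\<lambda>t. a + t * b) a b"
  unfolding jet_def by (rule exI[of _ "[:a, b:]"]) auto

lemma jet_quadratic: "jet (\<lambda>t. a + t * b + t * t * c) a b"
  unfolding jet_def by (rule exI[of _ "[:a, b, c:]"]) (auto simp: algebra_simps)

lemma jet_const: "jet (\<lambda>t. a) a 0"
  using jet_linear[of a 0] by simp

lemma jet_zero: "jet 0 0 0"
  using jet_const[of 0] by simp

lemma jet_add: "jet F a b \<Longrightarrow> jet H c d \<Longrightarrow> jet (\<lambda>t. F t + H t) (a + c) (b + d)"
  unfolding jet_def by (metis coeff_add poly_add)

lemma jet_mult: "jet F a b \<Longrightarrow> jet H c d \<Longrightarrow> jet (\<lambda>t. F t * H t) (a * c) (a * d + b * c)"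
proof -
  assume "jet F a b" "jet H c d"
  then obtain p q where p: "\<forall>t. F t = poly p t" "coeff p 0 = a" "coeff p (Suc 0) = b"
    and q: "\<forall>t. H t = poly q t" "coeff q 0 = c" "coeff q (Suc 0) = d" unfolding jet_def by blast
  show ?thesis unfolding jet_def
    by (rule exI[of _ "p * q"]) (use p q in \<open>auto simp: coeff_mult\<close>)
qed

lemma jet_sum: "(\<And>i. i \<in> I \<Longrightarrow> jet (F i) (a i) (b i)) \<Longrightarrow> jet (\<lambda>t. \<Sum>i\<in>I. F i t) (\<Sum>i\<in>I. a i) (\<Sum>i\<in>I. b i)"
  by (induction I rule: infinite_finite_induct) (auto intro: jet_add jet_zero)

lemma jet_cmult: "jet F a b \<Longrightarrow> jet (\<lambda>t. c * F t) (c * a) (c * b)"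
  using jet_mult[OF jet_const[of c], of F a b] by simp

lemma jet_unique: "jet F a b \<Longrightarrow> jet F c d \<Longrightarrow> a = c \<and> b = d"
  unfolding jet_def by (metis poly_eq_poly_eq_iff ext)

lemma pfun_const: "pfun (\<lambda>t. a)"
  using jet_pfun[OF jet_const] .

lemma pfun_zero: "pfun 0"
  using pfun_const[of 0] by simp

lemma pfun_linear: "pfun (\<lambda>t. a + t * b)"
  using jet_pfun[OF jet_linear] .

lemma pfun_add: "pfun F \<Longrightarrow> pfun H \<Longrightarrow> pfun (\<lambda>t. F t + H t)"
  and pfun_mult: "pfun F \<Longrightarrow> pfun H \<Longrightarrow> pfun (\<lambda>t. F t * H t)"
  using jet_add[of F _ _ H] jet_mult[of F _ _ H] pfun_jet jet_pfun by meson+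

lemma pfun_sum: "(\<And>i. i \<in> I \<Longrightarrow> pfun (F i)) \<Longrightarrow> pfun (\<lambda>t. \<Sum>i\<in>I. F i t)"
  by (induction I rule: infinite_finite_induct) (auto intro: pfun_add pfun_zero)

text \<open>Conjugating the argument too keeps the function polynomial; this handles the
  conjugate-linear slot of \<open>ip\<close>.\<close>

lemma pfun_cnj: "pfun F \<Longrightarrow> pfun (\<lambda>t. cnj (F (cnj t)))"
  unfolding pfun_def by (metis complex_cnj_cnj poly_cnj)

lemma pfun_prod_mset: "(\<And>c. c \<in># C \<Longrightarrow> pfun (F c)) \<Longrightarrow> pfun (\<lambda>t. \<Prod>c\<in>#C. F c t)"
  by (induction C) (auto intro: pfun_mult pfun_const)

lemma pfun_eq_large:
  assumes "pfun F" "pfun H" "\<And>t::real. t \<ge> t0 \<Longrightarrow> F (of_real t) = H (of_real t)"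
  shows "F = H"
proof -
  obtain p q where p: "\<And>t. F t = poly p t" and q: "\<And>t. H t = poly q t"
    using assms(1,2) unfolding pfun_def by blast
  have "complex_of_real ` {t0..} \<subseteq> {t. poly (p - q) t = 0}"
    using assms(3) p q by auto
  moreover have "infinite (complex_of_real ` {t0..})"
    using infinite_Ici[of t0] by (simp add: finite_image_iff inj_on_def)
  ultimately have "infinite {t. poly (p - q) t = 0}" using finite_subset by blast
  then have "p - q = 0" using poly_roots_finite by blast
  then show ?thesis using p q by (simp add: fun_eq_iff)
qed

lemma pfun_nonzero:
  assumes "pfun F" "F s \<noteq> 0" shows "finite {t. F t = 0}"
proof -
  obtain p where p: "\<And>t. F t = poly p t" using assms(1) unfolding pfun_def by blast
  have "p \<noteq> 0" using assms(2) p by auto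
  then show ?thesis using poly_roots_finite[of p] p by simp
qed

lemma pfun_wl: "(\<And>f s. f \<in> set fs \<Longrightarrow> pfun (\<lambda>t. f t s)) \<Longrightarrow> pfun (\<lambda>t. wl (map (\<lambda>f. f t) fs) U)"
proof (induction fs arbitrary: U)
  case (Cons f fs)
  have "pfun (\<lambda>t. \<Sum>s\<in>U. sg s U * f t s * wl (map (\<lambda>f. f t) fs) (U - {s}))"
    using Cons by (intro pfun_sum pfun_mult pfun_const Cons.IH) auto
  then show ?case by (simp add: cr_def)
qed (simp add: pfun_const)

lemma jet_wl:
  assumes "finite G"
    and "\<And>f s. f \<in> set fs \<Longrightarrow> jet (\<lambda>t. f t s) (f 0 s) (mv G A (f 0) s)"
    and "\<And>f. f \<in> set fs \<Longrightarrow> vsupp G (f 0)"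
  shows "jet (\<lambda>t. wl (map (\<lambda>f. f t) fs) U) (wl (map (\<lambda>f. f 0) fs) U) (dv G A (wl (map (\<lambda>f. f 0) fs)) U)"
  using assms(2,3)
proof (induction fs arbitrary: U)
  case (Cons f fs)
  let ?w = "wl (map (\<lambda>f. f 0) fs)"
  have s: "supp G ?w" using Cons.prems by (intro supp_wl) auto
  have IH: "jet (\<lambda>t. wl (map (\<lambda>f. f t) fs) V) (?w V) (dv G A ?w V)" for V
    using Cons.prems by (intro Cons.IH) auto
  have "jet (\<lambda>t. \<Sum>s\<in>U. sg s U * (f t s * wl (map (\<lambda>f. f t) fs) (U - {s})))
     (\<Sum>s\<in>U. sg s U * (f 0 s * ?w (U - {s})))
     (\<Sum>s\<in>U. sg s U * (f 0 s * dv G A ?w (U - {s}) + mv G A (f 0) s * ?w (U - {s})))"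
    using Cons.prems(1)[of f] IH by (intro jet_sum jet_cmult jet_mult) auto
  moreover have "(\<Sum>s\<in>U. sg s U * (f 0 s * dv G A ?w (U - {s}) + mv G A (f 0) s * ?w (U - {s}))) = dv G A (cr (f 0) ?w) U"
    using Cons.prems(2)[of f] by (simp add: dv_cr[OF assms(1) s]) (simp add: cr_def algebra_simps sum.distrib)
  ultimately show ?case by (simp add: cr_def mult.assoc)
qed (simp add: dv_one jet_const)

text \<open>The curve g + t A g replaces exp(tA) g: it has the same first-order jet and is
  polynomial in t.\<close>

definition line :: "nat \<Rightarrow> mat \<Rightarrow> mat \<Rightarrow> complex \<Rightarrow> mat" where
  "line N A g t = (\<lambda>i j. g i j + t * mmul N A g i j)"

lemma line_0: "line N A g 0 = g"
  by (simp add: line_def)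

lemma mv_colv: "nsupp N A \<Longrightarrow> mv {..<N} A (colv N g j) = colv N (mmul N A g) j"
  by (auto simp: mv_def colv_def mmul_def nsupp_def fun_eq_iff not_less)

lemma colv_line: "nsupp N A \<Longrightarrow> colv N (line N A g t) j = colv N g j + scl t (mv {..<N} A (colv N g j))"
  unfolding mv_colv by (auto simp: colv_def line_def fun_eq_iff)

lemma jet_wc:
  assumes "nsupp N A"
  shows "jet (\<lambda>t. wc N (line N A g t) c U) (wc N g c U) (dv {..<N} A (wc N g c) U)"
proof -
  let ?fs = "map (\<lambda>j t. colv N (line N A g t) j) (rev [0..<c])"
  have "jet (\<lambda>t. wl (map (\<lambda>f. f t) ?fs) U) (wl (map (\<lambda>f. f 0) ?fs) U) (dv {..<N} A (wl (map (\<lambda>f. f 0) ?fs)) U)"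
  proof (rule jet_wl)
    fix f s assume "f \<in> set ?fs"
    then obtain j where f: "f = (\<lambda>t. colv N (line N A g t) j)" by auto
    show "jet (\<lambda>t. f t s) (f 0 s) (mv {..<N} A (f 0) s)"
      using jet_linear[of "colv N g j s" "mv {..<N} A (colv N g j) s"]
      unfolding f line_0 colv_line[OF assms] by simp
  qed (auto simp: vsupp_colv)
  then show ?thesis by (simp add: comp_def line_0 wc_def)
qed

lemma jet_Psi:
  assumes A: "A \<in> lie T n" and N: "N = msize T n"
  shows "jet (\<lambda>t. Psi T n B (line N A g t) U) (Psi T n B g U) (dv (grid N) (adm N A) (Psi T n B g) U)"
proof -
  let ?fs = "map (\<lambda>(i,j) t. th T n (colv N (line N A g t) i) (colv N (line N A g t) j)) (rev (sorted_list_of_set B))"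
  have nA: "nsupp N A" using lie_nsupp[OF A] N by simp
  have "jet (\<lambda>t. wl (map (\<lambda>f. f t) ?fs) U) (wl (map (\<lambda>f. f 0) ?fs) U) (dv (grid N) (adm N A) (wl (map (\<lambda>f. f 0) ?fs)) U)"
  proof (rule jet_wl)
    fix f s assume "f \<in> set ?fs"
    then obtain i j where f: "f = (\<lambda>t. th T n (colv N (line N A g t) i) (colv N (line N A g t) j))" by auto
    let ?u = "colv N g i" and ?w = "colv N g j"
    let ?u' = "mv {..<N} A ?u" and ?w' = "mv {..<N} A ?w"
    have "jet (\<lambda>t. th T n ?u ?w s + t * (th T n ?u' ?w s + th T n ?u ?w' s) + t * t * th T n ?u' ?w' s) (th T n ?u ?w s) (th T n ?u' ?w s + th T n ?u ?w' s)"
      by (rule jet_quadratic)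
    moreover have "mv (grid N) (adm N A) (th T n ?u ?w) s = th T n ?u' ?w s + th T n ?u ?w' s"
      using mv_th[OF A] N by simp
    moreover have "th T n (?u + scl t ?u') (?w + scl t ?w') s =
        th T n ?u ?w s + t * (th T n ?u' ?w s + th T n ?u ?w' s) + t * t * th T n ?u' ?w' s" for t
      unfolding th_add th_scl by (simp add: algebra_simps)
    ultimately show "jet (\<lambda>t. f t s) (f 0 s) (mv (grid N) (adm N A) (f 0) s)"
      unfolding f line_0 colv_line[OF nA] by simp
  qed (auto simp: vsupp_th N)
  then show ?thesis by (simp add: comp_def line_0 Psi_eq N case_prod_unfold)
qed

lemma form_bound:
  fixes x :: "nat \<Rightarrow> complex"
  shows "cmod (ip {..<N} (mv {..<N} A x) x) \<le> (\<Sum>i<N. \<Sum>j<N. cmod (A i j)) * Re (ip {..<N} x x)"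
proof -
  let ?S = "\<Sum>i<N. (cmod (x i))\<^sup>2"
  have S: "Re (ip {..<N} x x) = ?S"
    by (simp add: ip_def complex_norm_square[symmetric] flip: of_real_power)
  have le: "cmod (x i) * cmod (x j) \<le> ?S" if "i < N" "j < N" for i j
  proof -
    have m: "(cmod (x k))\<^sup>2 \<le> ?S" if "k < N" for k
      using that by (intro member_le_sum) auto
    show ?thesis
    proof (cases "cmod (x i) \<le> cmod (x j)")
      case True
      then have "cmod (x i) * cmod (x j) \<le> (cmod (x j))\<^sup>2" by (simp add: power2_eq_square mult_right_mono)
      then show ?thesis using m[OF that(2)] by linarith
    next
      case False
      then have "cmod (x i) * cmod (x j) \<le> (cmod (x i))\<^sup>2" by (simp add: power2_eq_square mult_left_mono)
      then show ?thesis using m[OF that(1)] by linarith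
    qed
  qed
  have "cmod (ip {..<N} (mv {..<N} A x) x) \<le> (\<Sum>i<N. \<Sum>j<N. cmod (A i j * x j * cnj (x i)))"
    unfolding ip_def mv_def sum_distrib_right by (rule order_trans[OF norm_sum]) (intro sum_mono norm_sum)
  also have "\<dots> \<le> (\<Sum>i<N. \<Sum>j<N. cmod (A i j) * ?S)"
  proof (intro sum_mono)
    fix i j assume "i \<in> {..<N}" "j \<in> {..<N}"
    then have "cmod (A i j) * (cmod (x i) * cmod (x j)) \<le> cmod (A i j) * ?S"
      by (intro mult_left_mono le) auto
    then show "cmod (A i j * x j * cnj (x i)) \<le> cmod (A i j) * ?S" by (simp add: norm_mult mult_ac)
  qed
  finally show ?thesis by (simp add: S sum_distrib_right)
qed

definition aff :: "mat \<Rightarrow> mat \<Rightarrow> complex \<Rightarrow> mat" where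
  "aff g h t = (\<lambda>i j. g i j + t * h i j)"

abbreviation sh :: "mat \<Rightarrow> complex \<Rightarrow> mat" where
  "sh g \<equiv> aff g (\<lambda>i j. if i = j then 1 else 0)"

lemma mv_sh: "i < N \<Longrightarrow> mv {..<N} (sh g t) x i = mv {..<N} g x i + t * x i"
proof -
  assume i: "i < N"
  have "mv {..<N} (sh g t) x i = (\<Sum>j<N. g i j * x j + (if j = i then t * x i else 0))"
    unfolding mv_def aff_def by (intro sum.cong) (auto simp: algebra_simps)
  then show ?thesis using i by (simp add: sum.distrib mv_def)
qed

text \<open>The Hermitian expression is t^2 |x|^2 plus terms of degree at most one in t, each
  bounded by a multiple of |x|^2. \<open>R\<close> adds up the three bounds, and for t >= R + 1 the
  square dominates.\<close>

lemma gp_large: "\<exists>t0. \<forall>t\<ge>t0. gp N (sh g (of_real t)) (sh h (of_real t))"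
proof -
  let ?b = "\<lambda>A. \<Sum>i<N. \<Sum>j<N. cmod (A i j :: complex)"
  let ?P = "\<lambda>k j. pairing N g h j k"
  define R where "R = ?b g + ?b h + ?b ?P"
  have R: "?b g \<ge> 0" "?b h \<ge> 0" "?b ?P \<ge> 0" by (auto intro!: sum_nonneg)
  have "gp N (sh g (of_real t)) (sh h (of_real t))" if t: "t \<ge> R + 1" for t
    unfolding gp_def
  proof (intro allI impI)
    fix x :: "nat \<Rightarrow> complex" assume "\<exists>i<N. x i \<noteq> 0"
    then obtain i where i: "i < N" "x i \<noteq> 0" by blast
    define S where "S = Re (ip {..<N} x x)"
    have "S = (\<Sum>i<N. (cmod (x i))\<^sup>2)"
      by (simp add: S_def ip_def complex_norm_square[symmetric] flip: of_real_power)
    moreover have "\<dots> > 0" by (rule sum_pos2[of _ i]) (use i in auto)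
    ultimately have S: "S > 0" by simp
    let ?gx = "mv {..<N} g x" and ?hx = "mv {..<N} h x"
    have "ip {..<N} (mv {..<N} (sh g (of_real t)) x) (mv {..<N} (sh h (of_real t)) x) = ip {..<N} (?gx + scl (of_real t) x) (?hx + scl (of_real t) x)"
      unfolding ip_def by (intro sum.cong) (auto simp: mv_sh)
    also have "\<dots> = ip {..<N} ?gx ?hx + of_real t * ip {..<N} ?gx x + of_real t * ip {..<N} x ?hx + of_real (t * t) * ip {..<N} x x"
      by (simp add: ip_simps algebra_simps)
    finally have e: "Re (ip {..<N} (mv {..<N} (sh g (of_real t)) x) (mv {..<N} (sh h (of_real t)) x)) =
       Re (ip {..<N} ?gx ?hx) + t * Re (ip {..<N} ?gx x) + t * Re (ip {..<N} x ?hx) + t * t * S"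
      by (simp add: S_def)
    have "ip {..<N} ?gx ?hx = ip {..<N} (mv {..<N} ?P x) x"
    proof -
      have "ip {..<N} ?gx (colv N h k) = mv {..<N} ?P x k" for k
      proof -
        have "?gx i = (\<Sum>j<N. scl (x j) (colv N g j)) i" if "i < N" for i
          using that by (simp add: mv_def colv_def sum_fun_apply mult.commute)
        then have "ip {..<N} ?gx (colv N h k) = ip {..<N} (\<Sum>j<N. scl (x j) (colv N g j)) (colv N h k)"
          unfolding ip_def by (intro sum.cong) auto
        then show ?thesis by (simp add: ip_sum ip_simps mv_def pairing_def mult.commute)
      qed
      then show ?thesis unfolding ip_mv_right by (simp add: ip_def mult.commute)
    qed
    then have "cmod (ip {..<N} ?gx ?hx) \<le> ?b ?P * S" using form_bound[of N ?P x] S_def by simp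
    moreover have "cmod (ip {..<N} ?gx x) \<le> ?b g * S" using form_bound[of N g x] S_def by simp
    moreover have "cmod (ip {..<N} x ?hx) \<le> ?b h * S"
      using form_bound[of N h x] S_def ip_cnj[of "{..<N}" ?hx x] by (metis complex_mod_cnj)
    ultimately have b: "Re (ip {..<N} ?gx ?hx) \<ge> - (?b ?P * S)" "Re (ip {..<N} ?gx x) \<ge> - (?b g * S)" "Re (ip {..<N} x ?hx) \<ge> - (?b h * S)"
      using abs_Re_le_cmod by (smt (verit))+
    have t0: "t \<ge> 1" using t R by (simp add: R_def)
    have "t * Re (ip {..<N} ?gx x) \<ge> t * - (?b g * S)" "t * Re (ip {..<N} x ?hx) \<ge> t * - (?b h * S)"
      using mult_left_mono[OF b(2), of t] mult_left_mono[OF b(3), of t] t0 by auto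
    moreover have "?b ?P * S \<le> t * (?b ?P * S)" using mult_right_mono[OF t0, of "?b ?P * S"] R S by simp
    moreover have "t * S * (t - R) \<ge> t * S * 1" using t t0 S by (intro mult_left_mono) auto
    moreover have "t * S > 0" using t0 S by simp
    ultimately show "Re (ip {..<N} (mv {..<N} (sh g (of_real t)) x) (mv {..<N} (sh h (of_real t)) x)) > 0"
      unfolding e using b(1) by (simp add: R_def algebra_simps)
  qed
  then show ?thesis by blast
qed

lemma pfun_colv_aff: "pfun (\<lambda>t. colv N (aff g h t) j s)"
proof (cases "s < N")
  case True
  have "colv N (aff g h t) j s = g s j + t * h s j" for t
    using True by (simp add: colv_def aff_def)
  then show ?thesis by (simp only: pfun_linear)
next
  case False
  then show ?thesis by (simp add: colv_def pfun_zero)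
qed

lemma pfun_wc_aff: "pfun (\<lambda>t. wc N (aff g h t) c U)"
proof -
  have "pfun (\<lambda>t. wl (map (\<lambda>f. f t) (map (\<lambda>j t. colv N (aff g h t) j) (rev [0..<c]))) U)"
    by (rule pfun_wl) (auto intro: pfun_colv_aff)
  then show ?thesis by (simp add: comp_def wc_def)
qed

lemma pfun_Psi_aff: "pfun (\<lambda>t. Psi T n B (aff g h t) U)"
proof -
  let ?N = "msize T n"
  have th: "pfun (\<lambda>t. th T n (colv ?N (aff g h t) i) (colv ?N (aff g h t) j) s)" for i j s
  proof -
    have "pfun (\<lambda>t. if P then (colv ?N (aff g h t) i a * colv ?N (aff g h t) j b + c * colv ?N (aff g h t) j a * colv ?N (aff g h t) i b) * d else 0)" for P a b c d
      by (cases P) (auto intro!: pfun_add pfun_mult pfun_const pfun_colv_aff pfun_zero)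
    then show ?thesis unfolding th_def vm_def theta_def .
  qed
  have "pfun (\<lambda>t. wl (map (\<lambda>f. f t) (map (\<lambda>(i,j) t. th T n (colv ?N (aff g h t) i) (colv ?N (aff g h t) j)) (rev (sorted_list_of_set B)))) U)"
    by (rule pfun_wl) (auto intro: th)
  then show ?thesis by (simp add: comp_def Psi_eq case_prod_unfold)
qed

lemma kernel:
  assumes em: "em N (ofs T) p q B C" and N: "N = msize T n" and len: "p + q + 2 * ofs T = N + 1"
  shows "ip (Pow (grid N)) (Psi T n B g) (Psi T n B h) =
    (\<Prod>b\<in>B. kap b) * (\<Prod>c\<in>#C. ip (Pow {..<N}) (wc N g c) (wc N h c))"
proof -
  have gpc: "ip (Pow (grid N)) (Psi T n B g) (Psi T n B h) =
    (\<Prod>b\<in>B. kap b) * (\<Prod>c\<in>#C. ip (Pow {..<N}) (wc N g c) (wc N h c))" if gp: "gp N g h" for g h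
  proof -
    obtain U where U: "\<forall>j<N. U j j = 1" "\<forall>i j. j < N \<longrightarrow> j < i \<longrightarrow> U i j = 0" "\<forall>j<N. \<forall>k<j. pairing N (mm N g U) h j k = 0"
      using triangularize[OF gp] by blast
    let ?L = "\<lambda>k. pairing N (mm N g U) h k k"
    have "ip (Pow (grid N)) (Psi T n B g) (Psi T n B h) = (\<Prod>(i,j)\<in>B. kap (i,j) * (?L i * ?L j))"
      using ip_Psi_triangular[OF em N U(3)] Psi_mm[OF em N U(1,2)] by simp
    also have "\<dots> = (\<Prod>b\<in>B. kap b) * (\<Prod>(i,j)\<in>B. ?L i * ?L j)"
      unfolding prod.distrib[symmetric] by (intro prod.cong) auto
    also have "(\<Prod>(i,j)\<in>B. ?L i * ?L j) = (\<Prod>c\<in>#C. \<Prod>k<c. ?L k)"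
      using em_prod[OF em, of ?L] len by (simp add: ofs_def split: if_splits)
    also have "\<dots> = (\<Prod>c\<in>#C. ip (Pow {..<N}) (wc N g c) (wc N h c))"
    proof (rule arg_cong[where f = prod_mset], rule image_mset_cong)
      fix c assume "c \<in># C"
      then have c: "c \<le> N" using em_col[OF em] by simp
      show "(\<Prod>k<c. ?L k) = ip (Pow {..<N}) (wc N g c) (wc N h c)"
        using ip_wc_triangular[OF c U(3)] wc_mm[OF c U(1,2)] by simp
    qed
    finally show ?thesis .
  qed
  \<comment> \<open>With \<open>cnj t\<close> in the conjugate-linear slot both sides are polynomial
    in t. For real t both matrices are shifted by the same multiple of the identity, so the positive
    case applies once t is large; t = 0 then returns the given g and h.\<close>
  define F where "F t = ip (Pow (grid N)) (Psi T n B (sh g t)) (Psi T n B (sh h (cnj t)))" for t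
  define H where "H t = (\<Prod>b\<in>B. kap b) * (\<Prod>c\<in>#C. ip (Pow {..<N}) (wc N (sh g t) c) (wc N (sh h (cnj t)) c))" for t
  obtain t0 where t0: "\<forall>t\<ge>t0. gp N (sh g (of_real t)) (sh h (of_real t))" using gp_large by blast
  have "F = H"
  proof (rule pfun_eq_large)
    show "pfun F" unfolding F_def ip_def
      by (intro pfun_sum pfun_mult pfun_Psi_aff pfun_cnj)
    show "pfun H" unfolding H_def ip_def
      by (intro pfun_sum pfun_mult pfun_prod_mset pfun_const pfun_wc_aff pfun_cnj)
    show "F (of_real t) = H (of_real t)" if "t \<ge> t0" for t
      using gpc[of "sh g (of_real t)" "sh h (of_real t)"] t0 that by (simp add: F_def H_def)
  qed
  then have "F 0 = H 0" by simp
  then show ?thesis by (simp add: F_def H_def aff_def)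
qed

section \<open>From semi-invariant functions to highest weight vectors\<close>

text \<open>Linear combinations of products of maximal minors in the leading c columns, c running
  through the list.\<close>

fun rep :: "nat \<Rightarrow> nat list \<Rightarrow> (mat \<Rightarrow> complex) \<Rightarrow> bool" where
  "rep N [] f = (\<exists>k. \<forall>g. f g = k)"
| "rep N (c # cs) f = (\<exists>h. (\<forall>S. rep N cs (h S)) \<and> (\<forall>g. f g = (\<Sum>S\<in>Pow {..<N}. wc N g c S * h S g)))"

text \<open>Coordinates of the tensor product of the wedges of leading columns, one factor per entry
  of the list; its Gram kernel is the product over columns in \<open>kernel\<close>.\<close>

fun tens :: "nat \<Rightarrow> nat list \<Rightarrow> mat \<Rightarrow> nat set list \<Rightarrow> complex" where
  "tens N [] g [] = 1"
| "tens N (c # cs) g (S # Ss) = wc N g c S * tens N cs g Ss"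
| "tens N cs g Ss = 0"

definition idx :: "nat \<Rightarrow> nat list \<Rightarrow> nat set list set" where
  "idx N cs = {Ss. length Ss = length cs \<and> set Ss \<subseteq> Pow {..<N}}"

lemma idx_simps: "idx N [] = {[]}" "idx N (c # cs) = (\<lambda>(S,Ss). S # Ss) ` (Pow {..<N} \<times> idx N cs)"
proof -
  show "idx N (c # cs) = (\<lambda>(S,Ss). S # Ss) ` (Pow {..<N} \<times> idx N cs)"
  proof (intro equalityI subsetI)
    fix Ss assume "Ss \<in> idx N (c # cs)"
    then show "Ss \<in> (\<lambda>(S,Ss). S # Ss) ` (Pow {..<N} \<times> idx N cs)"
      by (cases Ss) (auto simp: idx_def)
  next
    fix Ss assume "Ss \<in> (\<lambda>(S,Ss). S # Ss) ` (Pow {..<N} \<times> idx N cs)"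
    then show "Ss \<in> idx N (c # cs)" by (auto 0 3 simp: idx_def)
  qed
qed (auto simp: idx_def)

lemma finite_idx: "finite (idx N cs)"
  by (induction cs) (auto simp: idx_simps)

lemma sum_idx_Cons: "(\<Sum>Ss\<in>idx N (c # cs). F Ss) = (\<Sum>S\<in>Pow {..<N}. \<Sum>Ss\<in>idx N cs. F (S # Ss))"
  unfolding idx_simps sum.cartesian_product
  by (subst sum.reindex) (auto simp: inj_on_def intro!: sum.cong)

lemma tens_isupp: "tens N cs g \<in> isupp (idx N cs)"
proof -
  have "Ss \<notin> idx N cs \<Longrightarrow> tens N cs g Ss = 0" for Ss
  proof (induction N cs g Ss rule: tens.induct)
    case (2 N c cs g S Ss)
    show ?case
    proof (cases "S \<subseteq> {..<N}")
      case True
      then have "Ss \<notin> idx N cs" using 2 by (auto simp: idx_def)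
      then show ?thesis using 2 by simp
    next
      case False
      then show ?thesis using suppD[OF supp_wc[of N g c], of S] by simp
    qed
  qed (auto simp: idx_def)
  then show ?thesis by (auto simp: isupp_def)
qed

lemma ip_tens: "ip (idx N cs) (tens N cs g) (tens N cs h) = (\<Prod>c\<leftarrow>cs. ip (Pow {..<N}) (wc N g c) (wc N h c))"
proof (induction cs)
  case (Cons c cs)
  have "ip (idx N (c # cs)) (tens N (c # cs) g) (tens N (c # cs) h) =
    (\<Sum>S\<in>Pow {..<N}. \<Sum>Ss\<in>idx N cs. (wc N g c S * cnj (wc N h c S)) * (tens N cs g Ss * cnj (tens N cs h Ss)))"
    unfolding ip_def sum_idx_Cons by (intro sum.cong refl) (simp add: mult_ac)
  also have "\<dots> = ip (Pow {..<N}) (wc N g c) (wc N h c) * ip (idx N cs) (tens N cs g) (tens N cs h)"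
    unfolding ip_def sum_product ..
  finally show ?case using Cons by simp
qed (simp add: ip_def idx_simps)

lemma rep_tens: "rep N cs f \<Longrightarrow> \<exists>z. \<forall>g. f g = (\<Sum>Ss\<in>idx N cs. tens N cs g Ss * z Ss)"
proof (induction cs arbitrary: f)
  case Nil
  then obtain k where "\<forall>g. f g = k" by auto
  then show ?case by (intro exI[of _ "\<lambda>_. k"]) (simp add: idx_simps)
next
  case (Cons c cs)
  then obtain h where h: "\<And>S. rep N cs (h S)" "\<And>g. f g = (\<Sum>S\<in>Pow {..<N}. wc N g c S * h S g)" by auto
  have "\<forall>S. \<exists>z. \<forall>g. h S g = (\<Sum>Ss\<in>idx N cs. tens N cs g Ss * z Ss)" using Cons.IH h(1) by blast
  then obtain z where z: "\<And>S g. h S g = (\<Sum>Ss\<in>idx N cs. tens N cs g Ss * z S Ss)" by metis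
  show ?case
    by (intro exI[of _ "\<lambda>Ss. z (hd Ss) (tl Ss)"]) (simp add: h(2) z sum_idx_Cons sum_distrib_left mult.assoc)
qed

definition comb :: "(mat \<Rightarrow> 'i \<Rightarrow> complex) \<Rightarrow> ('i \<Rightarrow> complex) set" where
  "comb F = {a. \<exists>k c g. a = (\<Sum>i<(k::nat). scl (c i) (F (g i)))}"

lemma combI: "(\<Sum>i<(k::nat). scl (c i) (F (g i))) \<in> comb F"
  unfolding comb_def by (rule CollectI, intro exI, rule refl)

lemma combE: "a \<in> comb F \<Longrightarrow> (\<And>(k::nat) c g. a = (\<Sum>i<k. scl (c i) (F (g i))) \<Longrightarrow> P) \<Longrightarrow> P"
  unfolding comb_def by auto

lemma comb_base: "F g \<in> comb F"
  unfolding comb_def by (rule CollectI, rule exI[of _ 1], rule exI[of _ "\<lambda>_. 1"], rule exI[of _ "\<lambda>_. g"]) (simp add: scl_simps)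

lemma sum_lessThan_add: "(\<Sum>i<k + (m::nat). F i) = (\<Sum>i<k. F i) + (\<Sum>i<m. F (k + i) :: 'a::comm_monoid_add)"
  by (induction m) (simp_all add: add.assoc)

lemma sub_comb: "sub (comb F)"
  unfolding sub_def
proof (intro conjI ballI allI)
  show "0 \<in> comb F" unfolding comb_def by (rule CollectI, rule exI[of _ 0]) simp
next
  fix a b assume "a \<in> comb F" "b \<in> comb F"
  obtain k c g where a: "a = (\<Sum>i<(k::nat). scl (c i) (F (g i)))" using \<open>a \<in> comb F\<close> by (rule combE)
  obtain k' c' g' where b: "b = (\<Sum>i<(k'::nat). scl (c' i) (F (g' i)))" using \<open>b \<in> comb F\<close> by (rule combE)
  let ?c = "\<lambda>i. if i < k then c i else c' (i - k)" and ?g = "\<lambda>i. if i < k then g i else g' (i - k)"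
  have "(\<Sum>i<k + k'. scl (?c i) (F (?g i))) = (\<Sum>i<k. scl (?c i) (F (?g i))) + (\<Sum>i<k'. scl (?c (k + i)) (F (?g (k + i))))"
    by (rule sum_lessThan_add)
  also have "\<dots> = a + b" unfolding a b by simp
  finally have e: "(\<Sum>i<k + k'. scl (?c i) (F (?g i))) = a + b" .
  show "a + b \<in> comb F" unfolding e[symmetric] by (rule combI)
next
  fix d a assume "a \<in> comb F"
  then obtain k c g where a: "a = (\<Sum>i<(k::nat). scl (c i) (F (g i)))" by (rule combE)
  have e: "scl d a = (\<Sum>i<k. scl (d * c i) (F (g i)))" unfolding a by (simp add: scl_sum scl_simps)
  show "scl d a \<in> comb F" unfolding e by (rule combI)
qed

lemma comb_isupp: "(\<And>g. F g \<in> isupp I) \<Longrightarrow> comb F \<subseteq> isupp I"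
  by (auto simp: comb_def isupp_def sum_fun_apply intro!: sum.neutral)

lemma comb_orthogonal:
  assumes "\<And>g. ip I (F g) r = 0" "a \<in> comb F" shows "ip I a r = 0"
proof -
  obtain k c g where a: "a = (\<Sum>i<(k::nat). scl (c i) (F (g i)))" using assms(2) by (rule combE)
  show ?thesis unfolding a ip_sum ip_simps assms(1) by simp
qed

text \<open>The component of V orthogonal to M pairs with the curve to a function that is
  identically zero, so its pairing with the derivative V vanishes too.\<close>

lemma derivative_in_sub:
  assumes I: "finite I" and M: "sub M" "M \<subseteq> isupp I" and V: "V \<in> isupp I"
    and F: "\<And>t. F t \<in> M" and j: "\<And>i. i \<in> I \<Longrightarrow> jet (\<lambda>t. F t i) (a i) (V i)"
  shows "V \<in> M"
proof -
  obtain v where v: "v \<in> M" "\<forall>y\<in>M. ip I y (V - v) = 0" using projection[OF I M] by blast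
  let ?r = "V - v"
  have "jet (\<lambda>t. \<Sum>i\<in>I. cnj (?r i) * F t i) (\<Sum>i\<in>I. cnj (?r i) * a i) (\<Sum>i\<in>I. cnj (?r i) * V i)"
    by (intro jet_sum jet_cmult j)
  then have "jet (\<lambda>t. ip I (F t) ?r) (ip I a ?r) (ip I V ?r)" by (simp add: ip_def mult.commute)
  moreover have "ip I (F t) ?r = 0" for t using v(2) F by blast
  ultimately have "jet (\<lambda>t. 0) (ip I a ?r) (ip I V ?r)" by (simp del: eta_zero)
  then have "ip I V ?r = 0" using jet_unique[OF _ jet_const[of 0]] by blast
  then have "ip I ?r ?r = 0" using v by (simp add: ip_simps(3))
  moreover have "?r \<in> isupp I" using V v(1) M(2) by (auto simp: isupp_def)
  ultimately have "?r = 0" by (intro ip_self_isupp[OF I])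
  then show ?thesis using v(1) by simp
qed

theorem irreducible_from_function:
  assumes em: "em N (ofs T) p q B (mset cs)" and N: "N = msize T n" and len: "p + q + 2 * ofs T = N + 1"
    and f: "rep N cs f" "f g0 \<noteq> 0"
    and jf: "\<And>A g. A \<in> lie T n \<Longrightarrow> (\<And>i j. i < j \<Longrightarrow> A i j = 0) \<Longrightarrow> jet (\<lambda>t. f (line N A g t)) (f g) (wt A * f g)"
    and wt0: "\<And>A. A \<in> lie T n \<Longrightarrow> (\<And>i j. i \<le> j \<Longrightarrow> A i j = 0) \<Longrightarrow> wt A = 0"
    and wtH: "\<And>H. H \<in> cartan T n \<Longrightarrow> wt H = weight_val n lam H"
  shows "\<exists>W. irreducible_submodule T n W \<and> has_highest_weight T n W lam"
proof -
  let ?G = "grid N" let ?I = "Pow ?G" let ?M = "comb (Psi T n B)"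
  have fI: "finite ?I" by simp
  define k where "k = (\<Prod>b\<in>B. kap b)"
  have k: "k \<noteq> 0" unfolding k_def using em_finite[OF em] by (auto simp: kap_def split: if_splits)
  have ker: "ip ?I (Psi T n B g) (Psi T n B h) = k * ip (idx N cs) (tens N cs g) (tens N cs h)" for g h
  proof -
    have "(\<Prod>c\<leftarrow>cs. ip (Pow {..<N}) (wc N g c) (wc N h c)) = (\<Prod>c\<in>#mset cs. ip (Pow {..<N}) (wc N g c) (wc N h c))"
      by (metis mset_map prod_mset_prod_list)
    then show ?thesis using kernel[OF em N len, of g h] ip_tens[of N cs g h] by (simp add: k_def)
  qed
  have Psis: "Psi T n B g \<in> isupp ?I" for g
  proof -
    have "Psi T n B g \<in> Lam T n"
      using Psi_sum_Lam[of "\<lambda>_. 1" T n B "\<lambda>_. g" 1] by (simp add: scl_simps)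
    then show ?thesis using Lam_supp N by (simp add: supp_isupp)
  qed
  have sM: "sub ?M" "?M \<subseteq> isupp ?I" using sub_comb comb_isupp Psis by blast+
  have MLam: "?M \<subseteq> Lam T n"
  proof
    fix a assume "a \<in> ?M"
    then obtain m c g where a: "a = (\<Sum>i<(m::nat). scl (c i) (Psi T n B (g i)))" by (rule combE)
    show "a \<in> Lam T n" unfolding a by (rule Psi_sum_Lam)
  qed
  have actd: "act T n X a = dv ?G (adm N X) a" if "X \<in> lie T n" "a \<in> ?M" for X a
  proof -
    have "supp (grid (msize T n)) a" using that(2) sM(2) N by (auto simp: supp_isupp)
    then show ?thesis using act_eq[OF lie_nsupp[OF that(1)]] N by simp
  qed
  have dPsi: "dv ?G (adm N X) (Psi T n B g) \<in> ?M" if X: "X \<in> lie T n" for X g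
  proof (rule derivative_in_sub[OF fI sM])
    show "dv ?G (adm N X) (Psi T n B g) \<in> isupp ?I"
      using Psis lie_nsupp[OF X] N by (auto simp: supp_isupp[symmetric] intro!: supp_dv msupp_adm)
    show "jet (\<lambda>t. Psi T n B (line N X g t) U) (Psi T n B g U) (dv ?G (adm N X) (Psi T n B g) U)" for U
      by (rule jet_Psi[OF X N])
  qed (rule comb_base)
  have dM: "dv ?G (adm N X) a \<in> ?M" if X: "X \<in> lie T n" and a: "a \<in> ?M" for X a
  proof -
    obtain m c g where a: "a = (\<Sum>i<(m::nat). scl (c i) (Psi T n B (g i)))" using a by (rule combE)
    show ?thesis unfolding a lin_sum[OF lin_dv] lin_scl[OF lin_dv] by (intro sub_sum sub_scl sub_comb dPsi X)
  qed
  have subm: "submodule T n ?M"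
    unfolding submodule_iff using MLam sM(1) dM actd by auto
  obtain z where z: "\<And>g. f g = (\<Sum>Ss\<in>idx N cs. tens N cs g Ss * z Ss)" using rep_tens[OF f(1)] by blast
  let ?z = "\<lambda>Ss. cnj (z Ss)"
  have fz: "f g = ip (idx N cs) (tens N cs g) ?z" for g by (simp add: z ip_def)
  \<comment> \<open>Only the values of the functional on the tensors of matrices matter, so it may
    be projected to their span. There it is a combination of such tensors, and the same combination
    of Psi values can be formed.\<close>
  obtain w where w: "w \<in> comb (tens N cs)" "\<forall>y\<in>comb (tens N cs). ip (idx N cs) y (?z - w) = 0"
    using projection[OF finite_idx sub_comb comb_isupp[of "tens N cs", OF tens_isupp], of ?z] by blast
  obtain m c h where wm: "w = (\<Sum>i<(m::nat). scl (c i) (tens N cs (h i)))" using w(1) by (rule combE)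
  \<comment> \<open>The kernel formula contributes the factor k and the product is conjugate-linear
    in its second argument, hence the division by \<open>cnj k\<close>.\<close>
  define v where "v = (\<Sum>i<m. scl (c i / cnj k) (Psi T n B (h i)))"
  have vM: "v \<in> ?M" unfolding v_def by (intro sub_sum sub_scl sub_comb comb_base)
  have fv: "ip ?I (Psi T n B g) v = f g" for g
  proof -
    have "f g = ip (idx N cs) (tens N cs g) w"
      using w(2) comb_base[of "tens N cs" g] unfolding fz by (simp add: ip_simps(4))
    also have "\<dots> = ip ?I (Psi T n B g) v"
      unfolding wm v_def ip_sum ip_simps ker using k by (intro sum.cong) auto
    finally show ?thesis by simp
  qed
  have vnz: "v \<noteq> 0" using fv[of g0] f(2) by (auto simp: ip_simps)
  have dfv: "ip ?I (dv ?G (adm N A) (Psi T n B g)) v = wt A * f g" if A: "A \<in> lie T n" and low: "\<And>i j. i < j \<Longrightarrow> A i j = 0" for A g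
  proof -
    have "jet (\<lambda>t. \<Sum>U\<in>?I. cnj (v U) * Psi T n B (line N A g t) U) (\<Sum>U\<in>?I. cnj (v U) * Psi T n B g U)
      (\<Sum>U\<in>?I. cnj (v U) * dv ?G (adm N A) (Psi T n B g) U)"
      by (intro jet_sum jet_cmult jet_Psi[OF A N])
    then have "jet (\<lambda>t. ip ?I (Psi T n B (line N A g t)) v) (ip ?I (Psi T n B g) v) (ip ?I (dv ?G (adm N A) (Psi T n B g)) v)"
      by (simp add: ip_def mult.commute)
    then show ?thesis unfolding fv using jet_unique[OF _ jf[OF A low]] by blast
  qed
  \<comment> \<open>Equations for v may thus be tested against all Psi(g), where they turn into
    equations for f.\<close>
  have zero: "r = 0" if r: "r \<in> ?M" "\<And>g. ip ?I (Psi T n B g) r = 0" for r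
  proof -
    have "ip ?I r r = 0" by (rule comb_orthogonal[OF r(2) r(1)])
    then show ?thesis using sM(2) r(1) by (intro ip_self_isupp[OF fI]) auto
  qed
  have adj: "ip ?I a (dv ?G (adm N X) b) = ip ?I (dv ?G (adm N (ctr X)) a) b" if X: "X \<in> lie T n" for X a b
  proof -
    have cc: "ctr (ctr X) = X" by (simp add: ctr_def)
    show ?thesis using ip_dv_adm[OF nsupp_ctr[OF lie_nsupp[OF X]], of a b] cc N by simp
  qed
  have "hwv T n lam v"
    unfolding hwv_def
  proof (intro conjI ballI)
    show "v \<noteq> 0" by (rule vnz)
  next
    fix H assume H: "H \<in> cartan T n"
    then have Hl: "H \<in> lie T n" and Hd: "\<And>i j. i \<noteq> j \<Longrightarrow> H i j = 0" by (auto simp: cartan_def)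
    have cl: "ctr H \<in> lie T n" "ctr H \<in> cartan T n" using lie_ctr[OF Hl] Hd by (auto simp: cartan_def ctr_def)
    have wv: "weight_val n lam (ctr H) = cnj (weight_val n lam H)" by (simp add: weight_val_def ctr_def)
    let ?r = "dv ?G (adm N H) v - scl (weight_val n lam H) v"
    have "ip ?I (Psi T n B g) ?r = 0" for g
    proof -
      have "ip ?I (Psi T n B g) (dv ?G (adm N H) v) = wt (ctr H) * f g"
        unfolding adj[OF Hl] using Hd by (intro dfv cl) (auto simp: ctr_def)
      then show ?thesis by (simp add: ip_simps fv wtH[OF cl(2)] wv)
    qed
    then have "?r = 0" using dM[OF Hl vM] vM by (intro zero sub_diff sub_scl sub_comb) auto
    then show "act T n H v = scl (weight_val n lam H) v" using actd[OF Hl vM] by simp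
  next
    fix X assume X: "X \<in> nplus T n"
    then have Xl: "X \<in> lie T n" and Xu: "\<And>i j. j \<le> i \<Longrightarrow> X i j = 0" by (auto simp: nplus_def)
    \<comment> \<open>The adjoint of an element of n+ is strictly lower triangular, where
      \<open>wt\<close> vanishes.\<close>
    have "ip ?I (Psi T n B g) (dv ?G (adm N X) v) = 0" for g
    proof -
      have "ip ?I (Psi T n B g) (dv ?G (adm N X) v) = wt (ctr X) * f g"
        unfolding adj[OF Xl] using Xu lie_ctr[OF Xl] by (intro dfv) (auto simp: ctr_def)
      moreover have "wt (ctr X) = 0" using Xu by (intro wt0 lie_ctr[OF Xl]) (auto simp: ctr_def)
      ultimately show ?thesis by simp
    qed
    then have "dv ?G (adm N X) v = 0" using dM[OF Xl vM] by (intro zero)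
    then show "act T n X v = 0" using actd[OF Xl vM] by simp
  qed
  then show ?thesis using irreducible_from_hwv[OF subm vM] by blast
qed

section \<open>Semi-invariant functions with given column lengths\<close>

definition wtm :: "nat multiset \<Rightarrow> mat \<Rightarrow> complex" where
  "wtm ms A = (\<Sum>m\<in>#ms. \<Sum>i<m. A i i)"

text \<open>C lists the column lengths that f uses, ms the leading minors whose product has the same weight.\<close>

definition good :: "lie_type \<Rightarrow> nat \<Rightarrow> nat multiset \<Rightarrow> nat multiset \<Rightarrow> (mat \<Rightarrow> complex) \<Rightarrow> bool" where
  "good T n C ms f \<longleftrightarrow> (\<exists>cs. mset cs = C \<and> rep (msize T n) cs f) \<and> (\<exists>g. f g \<noteq> 0) \<and>
     (\<forall>A\<in>lie T n. (\<forall>i j. i < j \<longrightarrow> A i j = 0) \<longrightarrow> (\<forall>g. jet (\<lambda>t. f (line (msize T n) A g t)) (f g) (wtm ms A * f g)))"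

lemma rep_ConsI:
  "(\<And>S. rep N cs (h S)) \<Longrightarrow> (\<And>g. f g = (\<Sum>S\<in>Pow {..<N}. wc N g c S * h S g)) \<Longrightarrow> rep N (c # cs) f"
  unfolding rep.simps by (rule exI[of _ h]) simp

lemma rep_ConsE:
  assumes "rep N (c # cs) f"
  obtains h where "\<forall>S. rep N cs (h S)" "\<forall>g. f g = (\<Sum>S\<in>Pow {..<N}. wc N g c S * h S g)"
  using assms by auto

lemma rep_cmult: "rep N cs f \<Longrightarrow> rep N cs (\<lambda>g. k * f g)"
proof (induction cs arbitrary: f)
  case (Cons c cs)
  obtain h where "\<forall>S. rep N cs (h S)" "\<forall>g. f g = (\<Sum>S\<in>Pow {..<N}. wc N g c S * h S g)"
    using Cons.prems(1) by (rule rep_ConsE)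
  note h = this[rule_format]
  show ?case
    by (rule rep_ConsI[where h = "\<lambda>S g. k * h S g"]) (use Cons.IH h in \<open>simp_all add: sum_distrib_left mult_ac\<close>)
qed auto

lemma rep_append: "rep N cs f \<Longrightarrow> rep N ds f' \<Longrightarrow> rep N (cs @ ds) (\<lambda>g. f g * f' g)"
proof (induction cs arbitrary: f)
  case Nil
  then obtain k where "\<And>g. f g = k" by auto
  then show ?case using rep_cmult[OF Nil(2), of k] by simp
next
  case (Cons c cs)
  obtain h where "\<forall>S. rep N cs (h S)" "\<forall>g. f g = (\<Sum>S\<in>Pow {..<N}. wc N g c S * h S g)"
    using Cons.prems(1) by (rule rep_ConsE)
  note h = this[rule_format]
  show ?case unfolding append_Cons
  proof (rule rep_ConsI)
    show "rep N (cs @ ds) (\<lambda>g. h S g * f' g)" for S using Cons.IH[OF h(1) Cons.prems(2)] .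
    show "f g * f' g = (\<Sum>S\<in>Pow {..<N}. wc N g c S * (h S g * f' g))" for g
      unfolding h(2) sum_distrib_right by (simp add: mult.assoc)
  qed
qed

lemma rep_pfun: "rep N cs f \<Longrightarrow> pfun (\<lambda>t. f (aff g h t))"
proof (induction cs arbitrary: f)
  case Nil
  then obtain k where "\<And>g. f g = k" by auto
  then show ?case by (simp add: pfun_const)
next
  case (Cons c cs)
  obtain h' where "\<forall>S. rep N cs (h' S)" "\<forall>g. f g = (\<Sum>S\<in>Pow {..<N}. wc N g c S * h' S g)"
    using Cons.prems(1) by (rule rep_ConsE)
  note h = this[rule_format]
  show ?case unfolding h(2) by (intro pfun_sum pfun_mult pfun_wc_aff Cons.IH h(1))
qed

lemma good_empty: "good T n {#} {#} (\<lambda>g. 1)"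
  unfolding good_def wtm_def by (auto simp: jet_const intro: exI[of _ "[]"])

text \<open>The point is a common place of non-vanishing: on the line through g and g' both
  functions are nonzero polynomials in the parameter, so some point avoids all their zeros.\<close>

lemma good_mult:
  assumes "good T n C ms f" "good T n C' ms' f'"
  shows "good T n (C + C') (ms + ms') (\<lambda>g. f g * f' g)"
proof -
  let ?N = "msize T n"
  obtain cs ds where r: "mset cs = C" "rep ?N cs f" "mset ds = C'" "rep ?N ds f'"
    using assms unfolding good_def by blast
  obtain g g' where g: "f g \<noteq> 0" "f' g' \<noteq> 0" using assms unfolding good_def by blast
  let ?a = "\<lambda>t. aff g (\<lambda>i j. g' i j - g i j) t"
  have "?a 0 = g" "?a 1 = g'" by (auto simp: aff_def)
  then have "finite {t. f (?a t) = 0}" "finite {t. f' (?a t) = 0}"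
    using pfun_nonzero[OF rep_pfun[OF r(2)], where s = 0] pfun_nonzero[OF rep_pfun[OF r(4)], where s = 1] g by force+
  then have "finite ({t. f (?a t) = 0} \<union> {t. f' (?a t) = 0})" by blast
  from ex_new_if_finite[OF infinite_UNIV_char_0 this]
  obtain t where "t \<notin> {t. f (?a t) = 0} \<union> {t. f' (?a t) = 0}" ..
  then have nz: "f (?a t) * f' (?a t) \<noteq> 0" by auto
  have "jet (\<lambda>t. f (line ?N A g t) * f' (line ?N A g t)) (f g * f' g) (wtm (ms + ms') A * (f g * f' g))"
    if "A \<in> lie T n" "\<forall>i j. i < j \<longrightarrow> A i j = 0" for A g
  proof -
    have "jet (\<lambda>t. f (line ?N A g t) * f' (line ?N A g t)) (f g * f' g) (f g * (wtm ms' A * f' g) + wtm ms A * f g * f' g)"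
      using assms that unfolding good_def by (intro jet_mult) blast+
    moreover have "f g * (wtm ms' A * f' g) + wtm ms A * f g * f' g = wtm (ms + ms') A * (f g * f' g)"
      by (simp add: wtm_def algebra_simps)
    ultimately show ?thesis by simp
  qed
  moreover have "mset (cs @ ds) = C + C'" "rep ?N (cs @ ds) (\<lambda>g. f g * f' g)" using r by (auto intro: rep_append)
  ultimately show ?thesis unfolding good_def using nz by blast
qed

section \<open>Functionals on wedges of leading columns\<close>

definition linf :: "(('i \<Rightarrow> complex) \<Rightarrow> complex) \<Rightarrow> bool" where
  "linf F \<longleftrightarrow> (\<forall>a b. F (a + b) = F a + F b) \<and> (\<forall>c a. F (scl c a) = c * F a)"

lemma linf_add: "linf F \<Longrightarrow> F (a + b) = F a + F b" and linf_scl: "linf F \<Longrightarrow> F (scl c a) = c * F a"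
  by (auto simp: linf_def)

lemma linf_0: "linf F \<Longrightarrow> F 0 = 0"
  using linf_scl[of F 0 0] by (simp add: scl_simps)

lemma linf_sum: "linf F \<Longrightarrow> F (\<Sum>i\<in>I. f i) = (\<Sum>i\<in>I. F (f i))"
  by (induction I rule: infinite_finite_induct) (simp_all only: linf_0 linf_add sum.infinite sum.empty sum.insert simp_thms)

lemma linf_minus: "linf F \<Longrightarrow> F (- b) = - F b"
  using linf_scl[of F "-1" b] by (simp add: scl_simps)

lemma linf_comp: "linf F \<Longrightarrow> lin H \<Longrightarrow> linf (\<lambda>a. F (H a))"
  by (auto simp: linf_def lin_def)

lemma linf_sums: "(\<And>i. i \<in> I \<Longrightarrow> linf (F i)) \<Longrightarrow> linf (\<lambda>a. \<Sum>i\<in>I. F i a)"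
  by (auto simp: linf_def sum.distrib sum_distrib_left intro!: sum.cong)

lemma linf_cmult: "linf F \<Longrightarrow> linf (\<lambda>a. k * F a)"
  by (auto simp: linf_def algebra_simps)

lemma linf_eval: "linf (\<lambda>a. a U)"
  by (auto simp: linf_def)

lemma linf_expand:
  assumes "linf F" "supp {..<N} a" shows "F a = (\<Sum>S\<in>Pow {..<N::nat}. a S * F (ket S))"
proof -
  have "a = (\<Sum>S\<in>Pow {..<N}. scl (a S) (ket S))"
    by (rule ket_expand) (use assms(2) in \<open>auto simp: supp_def vsupp_def\<close>)
  then have "F a = F (\<Sum>S\<in>Pow {..<N}. scl (a S) (ket S))" by (rule arg_cong)
  then show ?thesis by (simp only: linf_sum[OF assms(1)] linf_scl[OF assms(1)])
qed

text \<open>Infinitesimal invariance of F suffices: along \<open>line\<close> the derivative of the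
  wedge is its image under the derivation of A, and F, being a finite combination of coordinates,
  commutes with taking jets.\<close>

lemma good_of_linear:
  fixes T n defines "N \<equiv> msize T n"
  assumes F: "linf F"
    and inv: "\<And>A a. A \<in> lie T n \<Longrightarrow> (\<And>i j. i < j \<Longrightarrow> A i j = 0) \<Longrightarrow> supp {..<N} a \<Longrightarrow> F (dv {..<N} A a) = wtm ms A * F a"
    and nz: "F (wc N g c) \<noteq> 0"
  shows "good T n {#c#} ms (\<lambda>g. F (wc N g c))"
  unfolding good_def
proof (intro conjI ballI allI impI)
  have "rep N [c] (\<lambda>g. F (wc N g c))"
    by (rule rep_ConsI[where h = "\<lambda>S g. F (ket S)"]) (use linf_expand[OF F supp_wc] in simp_all)
  then show "\<exists>cs. mset cs = {#c#} \<and> rep (msize T n) cs (\<lambda>g. F (wc N g c))"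
    unfolding N_def by (intro exI[of _ "[c]"]) auto
  show "\<exists>g. F (wc N g c) \<noteq> 0" using nz by blast
  fix A g assume A: "A \<in> lie T n" "\<forall>i j. i < j \<longrightarrow> A i j = 0"
  have nA: "nsupp N A" "msupp {..<N} A" using lie_nsupp[OF A(1)] by (auto simp: N_def msupp_def nsupp_def)
  have "jet (\<lambda>t. \<Sum>S\<in>Pow {..<N}. F (ket S) * wc N (line N A g t) c S) (\<Sum>S\<in>Pow {..<N}. F (ket S) * wc N g c S)
     (\<Sum>S\<in>Pow {..<N}. F (ket S) * dv {..<N} A (wc N g c) S)"
    by (intro jet_sum jet_cmult jet_wc nA)
  then have "jet (\<lambda>t. F (wc N (line N A g t) c)) (F (wc N g c)) (F (dv {..<N} A (wc N g c)))"
    unfolding linf_expand[OF F supp_wc] linf_expand[OF F supp_dv[OF nA(2) supp_wc]] by (simp only: mult.commute)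
  then show "jet (\<lambda>t. F (wc N (line (msize T n) A g t) c)) (F (wc N g c)) (wtm ms A * F (wc N g c))"
    using inv[OF A(1) _ supp_wc] A(2) by (simp add: N_def)
qed

lemma good_of_bilinear:
  fixes T n defines "N \<equiv> msize T n"
  assumes F: "\<And>b. linf (\<lambda>a. F a b)" "\<And>a. linf (F a)"
    and inv: "\<And>A a b. A \<in> lie T n \<Longrightarrow> (\<And>i j. i < j \<Longrightarrow> A i j = 0) \<Longrightarrow> supp {..<N} a \<Longrightarrow> supp {..<N} b \<Longrightarrow>
       F (dv {..<N} A a) b + F a (dv {..<N} A b) = wtm ms A * F a b"
    and nz: "F (wc N g c) (wc N g d) \<noteq> 0"
  shows "good T n {#c,d#} ms (\<lambda>g. F (wc N g c) (wc N g d))"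
  unfolding good_def
proof (intro conjI ballI allI impI)
  have ex: "F a b = (\<Sum>S\<in>Pow {..<N}. \<Sum>S'\<in>Pow {..<N}. F (ket S) (ket S') * (a S * b S'))"
    if "supp {..<N} a" "supp {..<N} b" for a b
  proof -
    have "F a b = (\<Sum>S\<in>Pow {..<N}. a S * F (ket S) b)"
      using linf_expand[OF F(1) that(1)] .
    also have "\<dots> = (\<Sum>S\<in>Pow {..<N}. a S * (\<Sum>S'\<in>Pow {..<N}. b S' * F (ket S) (ket S')))"
      by (subst linf_expand[OF F(2) that(2)]) (rule refl)
    finally show ?thesis by (simp add: sum_distrib_left mult_ac)
  qed
  have "rep N [d] (\<lambda>g. F (ket S) (wc N g d))" for S
    by (rule rep_ConsI[where h = "\<lambda>S' g. F (ket S) (ket S')"]) (use linf_expand[OF F(2) supp_wc] in simp_all)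
  then have "rep N [c,d] (\<lambda>g. F (wc N g c) (wc N g d))"
    by (rule rep_ConsI) (rule linf_expand[OF F(1) supp_wc])
  then show "\<exists>cs. mset cs = {#c,d#} \<and> rep (msize T n) cs (\<lambda>g. F (wc N g c) (wc N g d))"
    unfolding N_def by (intro exI[of _ "[c,d]"]) auto
  show "\<exists>g. F (wc N g c) (wc N g d) \<noteq> 0" using nz by blast
  fix A g assume A: "A \<in> lie T n" "\<forall>i j. i < j \<longrightarrow> A i j = 0"
  have nA: "nsupp N A" "msupp {..<N} A" using lie_nsupp[OF A(1)] by (auto simp: N_def msupp_def nsupp_def)
  let ?a = "wc N g c" and ?b = "wc N g d"
  note s = supp_wc[of N g] supp_dv[OF nA(2) supp_wc[of N g]]
  have "jet (\<lambda>t. \<Sum>S\<in>Pow {..<N}. \<Sum>S'\<in>Pow {..<N}. F (ket S) (ket S') * (wc N (line N A g t) c S * wc N (line N A g t) d S'))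
     (\<Sum>S\<in>Pow {..<N}. \<Sum>S'\<in>Pow {..<N}. F (ket S) (ket S') * (?a S * ?b S'))
     (\<Sum>S\<in>Pow {..<N}. \<Sum>S'\<in>Pow {..<N}. F (ket S) (ket S') * (?a S * dv {..<N} A ?b S' + dv {..<N} A ?a S * ?b S'))"
    by (intro jet_sum jet_cmult jet_mult jet_wc nA)
  then have "jet (\<lambda>t. F (wc N (line N A g t) c) (wc N (line N A g t) d)) (F ?a ?b) (F ?a (dv {..<N} A ?b) + F (dv {..<N} A ?a) ?b)"
    by (simp only: ex[OF supp_wc supp_wc] ex[OF s(1) s(2)] ex[OF s(2) s(1)] distrib_left sum.distrib)
  moreover have "F ?a (dv {..<N} A ?b) + F (dv {..<N} A ?a) ?b = wtm ms A * F ?a ?b"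
    using inv[OF A(1) _ s(1) s(1)] A(2) by (simp only: add.commute)
  ultimately show "jet (\<lambda>t. F (wc N (line (msize T n) A g t) c) (wc N (line (msize T n) A g t) d)) (F ?a ?b) (wtm ms A * F ?a ?b)"
    by (simp add: N_def)
qed

text \<open>A lower triangular A sends a basis vector to the same or higher indices. To arrive at
  {..<m} by inserting s < m, one must have removed some t <= s outside {..<m} - {s}, that is t = s.
  Only the partial trace survives.\<close>

lemma dv_leading:
  fixes N :: nat
  assumes low: "\<And>s t. s < t \<Longrightarrow> A s t = 0" and m: "m \<le> N"
  shows "dv {..<N} A a {..<m} = (\<Sum>s<m. A s s) * a {..<m}"
proof -
  have "cr (\<lambda>s. A s t) (an {..<N} (ket t) a) {..<m} = (if t < m then A t t * a {..<m} else 0)" if "t < N" for t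
  proof -
    have "sg s {..<m} * A s t * an {..<N} (ket t) a ({..<m} - {s}) = (if s = t then A t t * a {..<m} else 0)" if s: "s < m" for s
    proof (cases s t rule: linorder_cases)
      case less
      then show ?thesis using low by simp
    next
      case equal
      then have "an {..<N} (ket t) a ({..<m} - {s}) = sg t {..<m} * a {..<m}"
        using s \<open>t < N\<close> by (subst an_ket) (auto simp: sg_self insert_absorb)
      then show ?thesis using equal by simp
    next
      case greater
      then show ?thesis using s by (simp add: an_ket)
    qed
    then have "cr (\<lambda>s. A s t) (an {..<N} (ket t) a) {..<m} = (\<Sum>s<m. if s = t then A t t * a {..<m} else 0)"
      unfolding cr_def by (intro sum.cong) auto
    then show ?thesis by simp
  qed
  then have "dv {..<N} A a {..<m} = (\<Sum>t<N. if t < m then A t t * a {..<m} else 0)"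
    unfolding dv_def sum_fun_apply by (intro sum.cong) auto
  also have "\<dots> = (\<Sum>t<m. A t t * a {..<m})"
    by (rule sum.mono_neutral_cong_right) (use m in auto)
  finally show ?thesis by (simp add: sum_distrib_right)
qed

text \<open>Contracting k times with the form: for Q = annihilation, Fp lowers both degrees; for Q = creation, it raises them;
  Fs contracts a single wedge with the symplectic form.\<close>

fun Fp :: "nat \<Rightarrow> (nat \<Rightarrow> (nat set \<Rightarrow> complex) \<Rightarrow> nat set \<Rightarrow> complex) \<Rightarrow> nat \<Rightarrow> nat \<Rightarrow> nat \<Rightarrow> (nat set \<Rightarrow> complex) \<Rightarrow> (nat set \<Rightarrow> complex) \<Rightarrow> complex" where
  "Fp N Q 0 m m' a b = a {..<m} * b {..<m'}"
| "Fp N Q (Suc k) m m' a b = (\<Sum>i<N. Fp N Q k m m' (Q i a) (Q (bar N i) b))"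

fun Fs :: "lie_type \<Rightarrow> nat \<Rightarrow> nat \<Rightarrow> nat \<Rightarrow> (nat set \<Rightarrow> complex) \<Rightarrow> complex" where
  "Fs T n 0 m a = a {..<m}"
| "Fs T n (Suc k) m a = (\<Sum>i<msize T n. sig T n i *
      Fs T n k m (an {..<msize T n} (ket i) (an {..<msize T n} (ket (bar (msize T n) i)) a)))"

lemma Fp_linear:
  assumes "\<And>i. lin (Q i)"
  shows "linf (\<lambda>a. Fp N Q k m m' a b)" "linf (Fp N Q k m m' a)"
proof -
  have "(\<forall>b. linf (\<lambda>a. Fp N Q k m m' a b)) \<and> (\<forall>a. linf (Fp N Q k m m' a))"
  proof (induction k)
    case 0
    then show ?case by (auto simp: linf_def algebra_simps)
  next
    case (Suc k)
    have "linf (\<lambda>a. Fp N Q (Suc k) m m' a b)" for b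
      unfolding Fp.simps using Suc by (intro linf_sums linf_comp[OF _ assms]) auto
    moreover have "linf (\<lambda>b. Fp N Q (Suc k) m m' a b)" for a
      unfolding Fp.simps
    proof (intro linf_sums)
      fix i show "linf (\<lambda>b. Fp N Q k m m' (Q i a) (Q (bar N i) b))"
        using Suc by (intro linf_comp[OF _ assms, of "Fp N Q k m m' (Q i a)"]) auto
    qed
    ultimately show ?case by auto
  qed
  then show "linf (\<lambda>a. Fp N Q k m m' a b)" "linf (Fp N Q k m m' a)" by auto
qed

lemma sum_bar_swap: "(\<Sum>i<N. \<Sum>j<N. f i j) = (\<Sum>i<N. \<Sum>k<N. f i (bar N k))"
  by (intro sum.cong refl sum_bar[symmetric])

text \<open>The hypothesis on the matrix R expresses that the operators Q i span a representation on
  which the form pairing Q i with Q (bar i) is invariant.\<close>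

lemma Fp_invariant:
  assumes A: "\<And>s t. s < t \<Longrightarrow> A s t = 0" and m: "m \<le> N" "m' \<le> N" and lin: "\<And>i. lin (Q i)"
    and sup: "\<And>i a. i < N \<Longrightarrow> supp {..<N} a \<Longrightarrow> supp {..<N} (Q i a)"
    and com: "\<And>i a. i < N \<Longrightarrow> supp {..<N} a \<Longrightarrow> Q i (dv {..<N} A a) = dv {..<N} A (Q i a) + (\<Sum>j<N. scl (R i j) (Q j a))"
    and skew: "\<And>k i. k < N \<Longrightarrow> i < N \<Longrightarrow> R k i + R (bar N i) (bar N k) = 0"
    and ab: "supp {..<N} a" "supp {..<N} b"
  shows "Fp N Q k m m' (dv {..<N} A a) b + Fp N Q k m m' a (dv {..<N} A b) = ((\<Sum>s<m. A s s) + (\<Sum>s<m'. A s s)) * Fp N Q k m m' a b"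
  using ab
proof (induction k arbitrary: a b)
  case 0
  then show ?case using dv_leading[of A m N a] dv_leading[of A m' N b] A m by (simp add: algebra_simps)
next
  case (Suc k)
  note L = Fp_linear[where Q = Q and N = N and k = k and m = m and m' = m', OF lin]
  let ?F = "Fp N Q k m m'" and ?D = "dv {..<N} A"
  have 1: "?F (Q i (?D a)) (Q (bar N i) b) = ?F (?D (Q i a)) (Q (bar N i) b) + (\<Sum>j<N. R i j * ?F (Q j a) (Q (bar N i) b))" if "i < N" for i
    unfolding com[OF that Suc.prems(1)] linf_add[OF L(1)] linf_sum[OF L(1)] linf_scl[OF L(1)] ..
  have 2: "?F (Q i a) (Q (bar N i) (?D b)) = ?F (Q i a) (?D (Q (bar N i) b)) + (\<Sum>j<N. R (bar N i) j * ?F (Q i a) (Q j b))" if "i < N" for i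
    unfolding com[OF bar_lt[OF that] Suc.prems(2)] linf_add[OF L(2)] linf_sum[OF L(2)] linf_scl[OF L(2)] ..
  \<comment> \<open>Swapping the indices in the first sum and writing j as bar k in the second makes
    both pair Q i a with Q (bar k) b, where the coefficients cancel by \<open>skew\<close>.\<close>
  have "(\<Sum>i<N. \<Sum>j<N. R i j * ?F (Q j a) (Q (bar N i) b)) + (\<Sum>i<N. \<Sum>j<N. R (bar N i) j * ?F (Q i a) (Q j b)) =
    (\<Sum>i<N. \<Sum>k<N. R k i * ?F (Q i a) (Q (bar N k) b)) + (\<Sum>i<N. \<Sum>k<N. R (bar N i) (bar N k) * ?F (Q i a) (Q (bar N k) b))"
    by (subst sum.swap, subst (2) sum_bar_swap) (rule refl)
  also have "\<dots> = (\<Sum>i<N. \<Sum>k<N. (R k i + R (bar N i) (bar N k)) * ?F (Q i a) (Q (bar N k) b))"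
    by (simp add: sum.distrib algebra_simps)
  also have "\<dots> = 0" by (intro sum.neutral ballI) (simp add: skew)
  finally have z: "(\<Sum>i<N. \<Sum>j<N. R i j * ?F (Q j a) (Q (bar N i) b)) + (\<Sum>i<N. \<Sum>j<N. R (bar N i) j * ?F (Q i a) (Q j b)) = 0" .
  have "Fp N Q (Suc k) m m' (?D a) b + Fp N Q (Suc k) m m' a (?D b) =
     (\<Sum>i<N. ?F (?D (Q i a)) (Q (bar N i) b) + ?F (Q i a) (?D (Q (bar N i) b))) +
     ((\<Sum>i<N. \<Sum>j<N. R i j * ?F (Q j a) (Q (bar N i) b)) + (\<Sum>i<N. \<Sum>j<N. R (bar N i) j * ?F (Q i a) (Q j b)))"
    using 1 2 by (simp add: sum.distrib)
  also have "\<dots> = (\<Sum>i<N. ((\<Sum>s<m. A s s) + (\<Sum>s<m'. A s s)) * ?F (Q i a) (Q (bar N i) b))"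
    unfolding z using Suc.IH[OF sup sup] Suc.prems by simp
  finally show ?case by (simp add: sum_distrib_left)
qed

lemma an_dv_ket:
  fixes N :: nat
  assumes a: "supp {..<N} a" and A: "msupp {..<N} A" and i: "i < N" and A2: "\<And>s t. N \<le> t \<Longrightarrow> A s t = 0"
  shows "an {..<N} (ket i) (dv {..<N} A a) = dv {..<N} A (an {..<N} (ket i) a) + (\<Sum>j<N. scl (A i j) (an {..<N} (ket j) a))"
proof -
  have "(\<lambda>t. \<Sum>s<N. A s t * ket i s) = (\<lambda>t. A i t)"
  proof
    fix t
    have "(\<Sum>s<N. A s t * ket i s) = (\<Sum>s<N. if i = s then A i t else 0)" by (rule sum.cong) (auto simp: ket_def)
    then show "(\<Sum>s<N. A s t * ket i s) = A i t" using i by simp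
  qed
  also have "(\<lambda>t. A i t) = (\<Sum>j<N. scl (A i j) (ket j))"
    by (rule ket_expand) (use A2 in \<open>auto simp: vsupp_def\<close>)
  finally show ?thesis using an_dv[OF _ a A, of "ket i"] by (simp add: an_sum an_scl)
qed

lemma cr_dv_ket:
  fixes N :: nat
  assumes a: "supp {..<N} a" and A: "msupp {..<N} A" and i: "i < N"
  shows "cr (ket i) (dv {..<N} A a) = dv {..<N} A (cr (ket i) a) + (\<Sum>j<N. scl (- A j i) (cr (ket j) a))"
proof -
  have "mv {..<N} A (ket i) = (\<lambda>s. A s i)"
  proof
    fix s
    have "(\<Sum>t<N. A s t * ket i t) = (\<Sum>t<N. if i = t then A s i else 0)" by (rule sum.cong) (auto simp: ket_def)
    then show "mv {..<N} A (ket i) s = A s i" using i by (simp add: mv_def)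
  qed
  also have "(\<lambda>s. A s i) = (\<Sum>j<N. scl (A j i) (ket j))"
    by (rule ket_expand) (use A in \<open>auto simp: vsupp_def msupp_def\<close>)
  finally have "cr (mv {..<N} A (ket i)) a = (\<Sum>j<N. scl (A j i) (cr (ket j) a))" by (simp add: cr_sum cr_scl)
  moreover have "vsupp {..<N} (ket i)" using i by (intro vsupp_ket) auto
  ultimately have "dv {..<N} A (cr (ket i) a) = (\<Sum>j<N. scl (A j i) (cr (ket j) a)) + cr (ket i) (dv {..<N} A a)"
    using dv_cr[OF _ a] by simp
  moreover have "(\<Sum>j<N. scl (- A j i) (cr (ket j) a)) = - (\<Sum>j<N. scl (A j i) (cr (ket j) a))"
    by (auto simp: fun_eq_iff sum_fun_apply sum_negf)
  ultimately show ?thesis by simp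
qed

lemma lie_skew:
  assumes "A \<in> lie T n" "T \<noteq> TypeC" "k < msize T n" "i < msize T n"
  shows "A k i + A (bar (msize T n) i) (bar (msize T n) k) = 0"
  using assms by (auto simp: lie_iff sig_def)

lemma Fp_an_invariant:
  fixes T n defines "N \<equiv> msize T n"
  assumes A: "A \<in> lie T n" "\<And>s t. s < t \<Longrightarrow> A s t = 0" and T: "T \<noteq> TypeC" and m: "m \<le> N" "m' \<le> N"
    and ab: "supp {..<N} a" "supp {..<N} b"
  shows "Fp N (\<lambda>i. an {..<N} (ket i)) k m m' (dv {..<N} A a) b + Fp N (\<lambda>i. an {..<N} (ket i)) k m m' a (dv {..<N} A b)
    = wtm {#m, m'#} A * Fp N (\<lambda>i. an {..<N} (ket i)) k m m' a b"
proof -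
  have nA: "msupp {..<N} A" "\<And>s t. N \<le> t \<Longrightarrow> A s t = 0" using lie_nsupp[OF A(1)] by (auto simp: N_def msupp_def nsupp_def)
  show ?thesis unfolding wtm_def
    using Fp_invariant[where Q = "\<lambda>i. an {..<N} (ket i)" and R = "\<lambda>i j. A i j", OF A(2) m lin_an supp_an
      an_dv_ket[OF _ nA(1) _ nA(2)] lie_skew[OF A(1) T, folded N_def] ab, of k] by simp
qed

text \<open>Creation operators transform by the negative transpose of A, which has the same skew
  symmetry under \<open>bar\<close>.\<close>

lemma Fp_cr_invariant:
  fixes T n defines "N \<equiv> msize T n"
  assumes A: "A \<in> lie T n" "\<And>s t. s < t \<Longrightarrow> A s t = 0" and T: "T \<noteq> TypeC" and m: "m \<le> N" "m' \<le> N"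
    and ab: "supp {..<N} a" "supp {..<N} b"
  shows "Fp N (\<lambda>i. cr (ket i)) k m m' (dv {..<N} A a) b + Fp N (\<lambda>i. cr (ket i)) k m m' a (dv {..<N} A b)
    = wtm {#m, m'#} A * Fp N (\<lambda>i. cr (ket i)) k m m' a b"
proof -
  have nA: "msupp {..<N} A" using lie_nsupp[OF A(1)] by (auto simp: N_def msupp_def nsupp_def)
  have sk: "- A i k + - A (bar N k) (bar N i) = 0" if "k < N" "i < N" for i k
    using lie_skew[OF A(1) T, of i k] that by (simp add: N_def add_eq_0_iff)
  have su: "supp {..<N} (cr (ket i) a)" if "i < N" "supp {..<N} a" for i a
    using that by (intro supp_cr vsupp_ket) auto
  show ?thesis unfolding wtm_def
    using Fp_invariant[where Q = "\<lambda>i. cr (ket i)" and R = "\<lambda>i j. - A j i", OF A(2) m lin_cr su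
      cr_dv_ket[OF _ nA(1)] sk ab, of k] by simp
qed

lemma Fs_linear: "linf (Fs T n k m)"
proof (induction k)
  case 0
  then show ?case by (auto simp: linf_def)
next
  case (Suc k)
  have "linf (\<lambda>a. Fs T n (Suc k) m a)"
    unfolding Fs.simps by (intro linf_sums linf_cmult linf_comp[OF linf_comp[OF Suc lin_an] lin_an])
  then show ?case by simp
qed

lemma Fs_invariant:
  fixes T n defines "N \<equiv> msize T n"
  assumes A: "A \<in> lie T n" "\<And>s t. s < t \<Longrightarrow> A s t = 0" and m: "m \<le> N" and a: "supp {..<N} a"
  shows "Fs T n k m (dv {..<N} A a) = wtm {#m#} A * Fs T n k m a"
  using a
proof (induction k arbitrary: a)
  case 0
  then show ?case using dv_leading[OF A(2) m] by (simp add: wtm_def)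
next
  case (Suc k)
  have nA: "msupp {..<N} A" "\<And>s t. N \<le> t \<Longrightarrow> A s t = 0" using lie_nsupp[OF A(1)] by (auto simp: N_def msupp_def nsupp_def)
  note L = Fs_linear[of T n k m]
  let ?F = "Fs T n k m" and ?D = "dv {..<N} A" and ?a = "\<lambda>i. an {..<N} (ket i)"
  let ?s = "sig T n"
  have 1: "?F (?a i (?a (bar N i) (?D a))) = ?F (?D (?a i (?a (bar N i) a))) + (\<Sum>j<N. A i j * ?F (?a j (?a (bar N i) a)))
      + (\<Sum>j<N. A (bar N i) j * ?F (?a i (?a j a)))" if "i < N" for i
  proof -
    have "?a (bar N i) (?D a) = ?D (?a (bar N i) a) + (\<Sum>j<N. scl (A (bar N i) j) (?a j a))"
      by (rule an_dv_ket[OF Suc.prems nA(1) bar_lt[OF that] nA(2)])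
    then have "?a i (?a (bar N i) (?D a)) = ?a i (?D (?a (bar N i) a)) + (\<Sum>j<N. scl (A (bar N i) j) (?a i (?a j a)))"
      by (simp only: lin_add[OF lin_an] lin_sum[OF lin_an] lin_scl[OF lin_an])
    also have "?a i (?D (?a (bar N i) a)) = ?D (?a i (?a (bar N i) a)) + (\<Sum>j<N. scl (A i j) (?a j (?a (bar N i) a)))"
      by (rule an_dv_ket[OF supp_an[OF Suc.prems] nA(1) that nA(2)])
    finally show ?thesis by (simp only: linf_add[OF L] linf_sum[OF L] linf_scl[OF L])
  qed
  have "(\<Sum>i<N. \<Sum>j<N. ?s i * (A i j * ?F (?a j (?a (bar N i) a)))) + (\<Sum>i<N. \<Sum>j<N. ?s i * (A (bar N i) j * ?F (?a i (?a j a)))) =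
    (\<Sum>i<N. \<Sum>k<N. ?s k * (A k i * ?F (?a i (?a (bar N k) a)))) + (\<Sum>i<N. \<Sum>k<N. ?s i * (A (bar N i) (bar N k) * ?F (?a i (?a (bar N k) a))))"
    by (subst sum.swap, subst (2) sum_bar_swap) (rule refl)
  also have "\<dots> = (\<Sum>i<N. \<Sum>k<N. (?s k * A k i + ?s i * A (bar N i) (bar N k)) * ?F (?a i (?a (bar N k) a)))"
    by (simp add: sum.distrib algebra_simps)
  also have "\<dots> = 0" using A(1) by (intro sum.neutral ballI) (auto simp: lie_iff N_def)
  finally have z: "(\<Sum>i<N. \<Sum>j<N. ?s i * (A i j * ?F (?a j (?a (bar N i) a)))) + (\<Sum>i<N. \<Sum>j<N. ?s i * (A (bar N i) j * ?F (?a i (?a j a)))) = 0" .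
  have "Fs T n (Suc k) m (?D a) = (\<Sum>i<N. ?s i * ?F (?D (?a i (?a (bar N i) a)))) +
     ((\<Sum>i<N. \<Sum>j<N. ?s i * (A i j * ?F (?a j (?a (bar N i) a)))) + (\<Sum>i<N. \<Sum>j<N. ?s i * (A (bar N i) j * ?F (?a i (?a j a)))))"
    using 1 by (simp add: N_def[symmetric] sum.distrib distrib_left sum_distrib_left)
  also have "\<dots> = (\<Sum>i<N. wtm {#m#} A * (?s i * ?F (?a i (?a (bar N i) a))))"
    unfolding z using Suc.IH[OF supp_an[OF supp_an[OF Suc.prems]]] by (simp add: mult_ac)
  finally show ?case by (simp add: sum_distrib_left N_def)
qed

section \<open>Non-vanishing\<close>

lemma ket_apply: "ket t s = (if s = t then 1 else 0)"
  by (simp add: ket_def)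

definition gm :: "(nat \<Rightarrow> complex) list \<Rightarrow> mat" where
  "gm vs = (\<lambda>i j. if j < length vs then (vs ! j) i else 0)"

lemma wc_gm:
  assumes "\<forall>v\<in>set vs. vsupp {..<N} v" "c \<le> length vs"
  shows "wc N (gm vs) c = wl (rev (take c vs))"
proof -
  have "colv N (gm vs) j = vs ! j" if "j < c" for j
    using that assms by (fastforce simp: colv_def gm_def vsupp_def fun_eq_iff not_less)
  then have "map (colv N (gm vs)) [0..<c] = take c vs"
    using assms(2) by (intro nth_equalityI) auto
  then show ?thesis unfolding wc_def by (metis rev_map)
qed

lemma sum_ket: "i < N \<Longrightarrow> (\<Sum>s<N. x s * ket i s) = (x i :: complex)" for N :: nat
proof -
  assume "i < N"
  have "(\<Sum>s<N. x s * ket i s) = (\<Sum>s<N. if i = s then x i else 0)" by (rule sum.cong) (auto simp: ket_apply)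
  then show ?thesis using \<open>i < N\<close> by simp
qed

lemma an_ket_cr:
  fixes N :: nat
  assumes "i < N" "supp {..<N} a" "vsupp {..<N} x"
  shows "an {..<N} (ket i) (cr x a) = scl (x i) a - cr x (an {..<N} (ket i) a)"
  using an_cr[OF _ assms(2,3), of "ket i"] sum_ket[OF assms(1), of x] by simp

lemma an_ket_wl_zero:
  fixes N :: nat
  assumes "i < N" "\<forall>x\<in>set xs. vsupp {..<N} x \<and> x i = 0"
  shows "an {..<N} (ket i) (wl xs) = 0"
  using assms sum_ket[OF assms(1)] by (intro an_wl_zero) auto

text \<open>For i distinct from bar i the symmetric form takes the value 2 on this vector and
  itself, so two columns that share it have a nonzero contraction.\<close>

definition pv :: "nat \<Rightarrow> nat \<Rightarrow> nat \<Rightarrow> complex" where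
  "pv N i = ket i + ket (bar N i)"

lemma vsupp_kets: "i < N \<Longrightarrow> vsupp {..<N} (ket i)" for N :: nat
  by (auto simp: vsupp_def ket_apply)

lemma vsupp_pv: "i < N \<Longrightarrow> vsupp {..<N} (pv N i)"
  by (auto simp: vsupp_def ket_apply pv_def bar_def)

lemma sum_two:
  fixes N :: nat
  assumes "i < N" "j < N" "i \<noteq> j"
  shows "(\<Sum>k<N. if k = i \<or> k = j then f k else 0) = f i + (f j :: complex)"
proof -
  have "(\<Sum>k<N. if k = i \<or> k = j then f k else 0) = (\<Sum>k\<in>{i,j}. f k)"
    by (rule sum.mono_neutral_cong_right) (use assms in auto)
  then show ?thesis using assms(3) by simp
qed

abbreviation anN :: "nat \<Rightarrow> nat \<Rightarrow> (nat set \<Rightarrow> complex) \<Rightarrow> nat set \<Rightarrow> complex" where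
  "anN N i \<equiv> an {..<N} (ket i)"

abbreviation crk :: "nat \<Rightarrow> (nat set \<Rightarrow> complex) \<Rightarrow> nat set \<Rightarrow> complex" where
  "crk i \<equiv> cr (ket i)"

text \<open>Neither e_i nor e_(bar i) occurs in a. Stated through annihilation, the property passes
  through other operators by anticommutation.\<close>

definition free :: "nat \<Rightarrow> nat \<Rightarrow> (nat set \<Rightarrow> complex) \<Rightarrow> bool" where
  "free N i a \<longleftrightarrow> supp {..<N} a \<and> anN N i a = 0 \<and> anN N (bar N i) a = 0"

lemma free_an: "free N i a \<Longrightarrow> free N i (anN N j a)"
  using an_anticomm[of "{..<N}" a "ket i" "ket j"] an_anticomm[of "{..<N}" a "ket (bar N i)" "ket j"]
  by (auto simp: free_def supp_an lin_0[OF lin_an])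

lemma free_cr:
  assumes "free N i a" "i < N" "j < N" "j \<noteq> i" "j \<noteq> bar N i"
  shows "free N i (crk j a)"
  using assms an_ket_cr[of i N a "ket j"] an_ket_cr[of "bar N i" N a "ket j"]
  by (auto simp: free_def supp_cr vsupp_kets lin_0[OF lin_cr] ket_apply scl_simps)

lemma free_wl:
  assumes "i < N" "\<forall>x\<in>set xs. vsupp {..<N} x \<and> x i = 0 \<and> x (bar N i) = 0"
  shows "free N i (wl xs)"
  using assms unfolding free_def by (auto intro!: an_ket_wl_zero supp_wl)

text \<open>One of the k contractions must remove the common factor, through i = \<alpha> or i = bar
  \<alpha>; this gives 2k. If the factor survives, the leading coefficient is zero, since both its
  indices are at least m.\<close>

lemma Fp_an_step:
  assumes al: "\<alpha> < N" "\<alpha> \<noteq> bar N \<alpha>" "m \<le> \<alpha>" "m \<le> bar N \<alpha>" and ab: "free N \<alpha> a" "free N \<alpha> b"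
  shows "Fp N (anN N) k m m' (cr (pv N \<alpha>) a) (cr (pv N \<alpha>) b) = 2 * of_nat k * (if k = 0 then 0 else Fp N (anN N) (k - 1) m m' a b)"
  using ab
proof (induction k arbitrary: a b)
  case 0
  have "cr (pv N \<alpha>) a {..<m} = 0"
    unfolding cr_def using al by (intro sum.neutral) (auto simp: pv_def ket_apply)
  then show ?case by simp
next
  case (Suc k)
  let ?u = "pv N \<alpha>" and ?F = "\<lambda>k. Fp N (anN N) k m m'" and ?Q = "anN N" and ?b = "bar N \<alpha>"
  note L = Fp_linear[where Q = "anN N" and N = N and m = m and m' = m', OF lin_an]
  have s: "supp {..<N} a" "supp {..<N} b" and z: "?Q \<alpha> a = 0" "?Q \<alpha> b = 0" "?Q ?b a = 0" "?Q ?b b = 0"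
    using Suc.prems by (auto simp: free_def)
  have u: "vsupp {..<N} ?u" using al by (simp add: vsupp_pv)
  have bb: "bar N ?b = \<alpha>" "?b < N" using al by simp_all
  have u1: "?u \<alpha> = 1" "?u ?b = 1" using al by (auto simp: pv_def ket_apply)
  let ?r = "\<lambda>i. 2 * of_nat k * (if k = 0 then 0 else ?F (k - 1) (?Q i a) (?Q (bar N i) b))"
  have "?F k (?Q i (cr ?u a)) (?Q (bar N i) (cr ?u b)) = (if i = \<alpha> \<or> i = ?b then ?F k a b else 0) + ?r i" if i: "i < N" for i
  proof (cases "i = \<alpha> \<or> i = ?b")
    case True
    then have "?Q i (cr ?u a) = a" "?Q (bar N i) (cr ?u b) = b"
      using an_ket_cr[OF i s(1) u] an_ket_cr[OF bar_lt[OF i] s(2) u] z u1 bb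
      by (auto simp: lin_0[OF lin_cr] scl_simps)
    moreover have "?r i = 0" using True z by (auto simp: linf_0[OF L(1)])
    ultimately show ?thesis using True by simp
  next
    case False
    then have "?u i = 0" "?u (bar N i) = 0" using al i by (auto simp: pv_def ket_apply) (metis bar_bar)+
    then have "?Q i (cr ?u a) = - cr ?u (?Q i a)" "?Q (bar N i) (cr ?u b) = - cr ?u (?Q (bar N i) b)"
      using an_ket_cr[OF i s(1) u] an_ket_cr[OF bar_lt[OF i] s(2) u] by (auto simp: scl_simps)
    then have "?F k (?Q i (cr ?u a)) (?Q (bar N i) (cr ?u b)) = ?F k (cr ?u (?Q i a)) (cr ?u (?Q (bar N i) b))"
      by (simp add: linf_minus[OF L(1)] linf_minus[OF L(2)])
    also have "\<dots> = ?r i" by (rule Suc.IH[OF free_an free_an]) (rule Suc.prems)+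
    finally show ?thesis using False by simp
  qed
  then have "?F (Suc k) (cr ?u a) (cr ?u b) = (\<Sum>i<N. (if i = \<alpha> \<or> i = ?b then ?F k a b else 0) + ?r i)"
    unfolding Fp.simps by (intro sum.cong) auto
  also have "\<dots> = 2 * ?F k a b + (\<Sum>i<N. ?r i)"
    unfolding sum.distrib using sum_two[OF al(1) bb(2) al(2), of "\<lambda>_. ?F k a b"] by simp
  also have "(\<Sum>i<N. ?r i) = 2 * of_nat k * ?F k a b"
    by (cases k) (simp_all add: sum_distrib_left)
  finally show ?case by (simp add: algebra_simps)
qed

text \<open>The dual count. The leading coefficient needs both e_\<alpha> and e_(bar \<alpha>), so
  one of the k steps must complete the common factor to the full pair on both sides. It creates
  e_\<alpha> on one side and e_(bar \<alpha>) on the other, with opposite signs, whence -2k.\<close>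

lemma Fp_cr_step:
  assumes al: "\<alpha> < N" "\<alpha> \<noteq> bar N \<alpha>" "\<alpha> < m" "bar N \<alpha> < m" and ab: "free N \<alpha> a" "free N \<alpha> b"
  shows "Fp N crk k m m' (cr (pv N \<alpha>) a) (cr (pv N \<alpha>) b) =
    - 2 * of_nat k * (if k = 0 then 0 else Fp N crk (k - 1) m m' (crk \<alpha> (crk (bar N \<alpha>) a)) (crk \<alpha> (crk (bar N \<alpha>) b)))"
  using ab
proof (induction k arbitrary: a b)
  case 0
  have z: "a S = 0" if "i \<in> S" "i = \<alpha> \<or> i = bar N \<alpha>" for S i
  proof (cases "S \<subseteq> {..<N}")
    case True
    have "anN N i a (S - {i}) = 0" using that 0 by (auto simp: free_def)
    then show ?thesis using that al by (auto simp: an_ket insert_absorb)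
  next
    case False
    then show ?thesis using suppD[of "{..<N}" a S] 0 by (auto simp: free_def)
  qed
  have "cr (pv N \<alpha>) a {..<m} = 0"
    unfolding cr_def
  proof (rule sum.neutral, rule ballI)
    fix s assume "s \<in> {..<m}"
    show "sg s {..<m} * pv N \<alpha> s * a ({..<m} - {s}) = 0"
    proof (cases "s = \<alpha> \<or> s = bar N \<alpha>")
      case True
      then show ?thesis using z[of \<alpha> "{..<m} - {s}"] z[of "bar N \<alpha>" "{..<m} - {s}"] al by auto
    qed (auto simp: pv_def ket_apply)
  qed
  then show ?case by simp
next
  case (Suc k)
  let ?u = "pv N \<alpha>" and ?F = "\<lambda>k. Fp N crk k m m'" and ?b = "bar N \<alpha>" and ?P = "\<lambda>a. crk \<alpha> (crk (bar N \<alpha>) a)"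
  note L = Fp_linear[where Q = "crk" and N = N and m = m and m' = m', OF lin_cr]
  have bb: "bar N ?b = \<alpha>" "?b < N" using al by simp_all
  have Pc: "?P (crk i c) = crk i (?P c)" for i c
    by (simp add: cr_anticomm[of "ket ?b" "ket i"] cr_anticomm[of "ket \<alpha>" "ket i"] lin_minus[OF lin_cr])
  have P0: "crk \<alpha> (?P c) = 0" "crk ?b (?P c) = 0" for c
    using cr_same[of "ket \<alpha>" "crk ?b c"] cr_same[of "ket ?b" c]
    by (simp_all add: cr_anticomm[of "ket ?b" "ket \<alpha>"] lin_0[OF lin_cr])
  have Qu: "crk \<alpha> (cr ?u c) = ?P c" "crk ?b (cr ?u c) = - ?P c" for c
    by (simp_all add: pv_def cr_add lin_add[OF lin_cr] cr_same cr_anticomm[of "ket ?b" "ket \<alpha>"])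
  let ?r = "\<lambda>i. - 2 * of_nat k * (if k = 0 then 0 else ?F (k - 1) (crk i (?P a)) (crk (bar N i) (?P b)))"
  have "?F k (crk i (cr ?u a)) (crk (bar N i) (cr ?u b)) = (if i = \<alpha> \<or> i = ?b then - ?F k (?P a) (?P b) else 0) + ?r i" if i: "i < N" for i
  proof (cases "i = \<alpha> \<or> i = ?b")
    case True
    have "?r i = 0" using True P0 by (auto simp: linf_0[OF L(1)])
    then show ?thesis using True Qu bb by (auto simp: linf_minus[OF L(1)] linf_minus[OF L(2)])
  next
    case False
    then have ne: "i \<noteq> \<alpha>" "i \<noteq> ?b" "bar N i \<noteq> \<alpha>" "bar N i \<noteq> ?b" using i al by (auto dest: arg_cong[of _ _ "bar N"])
    have "?F k (crk i (cr ?u a)) (crk (bar N i) (cr ?u b)) = ?F k (cr ?u (crk i a)) (cr ?u (crk (bar N i) b))"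
      by (simp add: cr_anticomm[of "ket _" ?u] linf_minus[OF L(1)] linf_minus[OF L(2)])
    also have "\<dots> = - 2 * of_nat k * (if k = 0 then 0 else ?F (k - 1) (?P (crk i a)) (?P (crk (bar N i) b)))"
      using Suc.prems i ne al by (intro Suc.IH free_cr) auto
    finally show ?thesis using False by (simp add: Pc)
  qed
  then have "?F (Suc k) (cr ?u a) (cr ?u b) = (\<Sum>i<N. (if i = \<alpha> \<or> i = ?b then - ?F k (?P a) (?P b) else 0) + ?r i)"
    unfolding Fp.simps by (intro sum.cong) auto
  also have "\<dots> = - 2 * ?F k (?P a) (?P b) + (\<Sum>i<N. ?r i)"
    unfolding sum.distrib using sum_two[OF al(1) bb(2) al(2), of "\<lambda>_. - ?F k (?P a) (?P b)"] by simp
  also have "(\<Sum>i<N. ?r i) = - 2 * of_nat k * ?F k (?P a) (?P b)"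
    by (cases k) (simp_all add: sum_distrib_left)
  finally show ?case by (simp add: algebra_simps)
qed

text \<open>One of the k contractions must remove the pair e_\<alpha>, e_(bar \<alpha>), in either
  order of the two; the sign of the form and the sign of the reordering combine to -1 both
  times.\<close>

lemma Fs_step:
  assumes T: "T = TypeC" and al: "\<alpha> < n" "m \<le> \<alpha>" and N: "N = msize T n" and a: "free N \<alpha> a"
  shows "Fs T n k m (crk \<alpha> (crk (bar N \<alpha>) a)) = - 2 * of_nat k * (if k = 0 then 0 else Fs T n (k - 1) m a)"
  using a
proof (induction k arbitrary: a)
  case 0
  then show ?case using al by (simp add: cr_ket)
next
  case (Suc k)
  let ?b = "bar N \<alpha>" and ?P = "\<lambda>a. crk \<alpha> (crk (bar N \<alpha>) a)" and ?Q = "anN N" and ?F = "\<lambda>k. Fs T n k m" and ?s = "sig T n"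
  have aN: "\<alpha> < N" "\<alpha> \<noteq> ?b" "\<not> ?b < n" using al N T by (auto simp: msize_def bar_def)
  have sgs: "?s \<alpha> = 1" "?s ?b = -1" using T al aN by (auto simp: sig_def)
  have bb: "bar N ?b = \<alpha>" "?b < N" using aN by simp_all
  have s: "supp {..<N} a" and z: "?Q \<alpha> a = 0" "?Q ?b a = 0" using Suc.prems by (auto simp: free_def)
  note v = vsupp_kets[OF aN(1)] vsupp_kets[OF bb(2)]
  have QP: "?Q i (?P c) = scl (ket \<alpha> i) (crk ?b c) - scl (ket ?b i) (crk \<alpha> c) + ?P (?Q i c)" if "i < N" "supp {..<N} c" for i c
    using that v by (simp add: an_ket_cr supp_cr lin_diff[OF lin_cr] lin_scl[OF lin_cr])
  have k: "ket \<alpha> \<alpha> = 1" "ket ?b ?b = 1" "ket \<alpha> ?b = 0" "ket ?b \<alpha> = 0" using aN(2) by (auto simp: ket_apply)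
  have Qa: "?Q \<alpha> (crk \<alpha> a) = a" "?Q ?b (crk ?b a) = a"
    using an_ket_cr[OF aN(1) s v(1)] an_ket_cr[OF bb(2) s v(2)] z k by (simp_all add: lin_0[OF lin_cr] scl_simps)
  let ?r = "\<lambda>i. - 2 * of_nat k * (if k = 0 then 0 else ?s i * ?F (k - 1) (?Q i (?Q (bar N i) a)))"
  have "?s i * ?F k (?Q i (?Q (bar N i) (?P a))) = (if i = \<alpha> \<or> i = ?b then - ?F k a else 0) + ?r i" if i: "i < N" for i
  proof -
    consider "i = \<alpha>" | "i = ?b" | "i \<noteq> \<alpha>" "i \<noteq> ?b" by blast
    then show ?thesis
    proof cases
      case 1
      have "?Q ?b (?P a) = - crk \<alpha> a" using QP[OF bb(2) s] k z by (simp add: lin_0[OF lin_cr] scl_simps)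
      then have "?Q \<alpha> (?Q ?b (?P a)) = - a" using Qa by (simp add: lin_minus[OF lin_an])
      then show ?thesis using 1 sgs z by (simp add: linf_minus[OF Fs_linear] lin_0[OF lin_an] linf_0[OF Fs_linear])
    next
      case 2
      have "?Q \<alpha> (?P a) = crk ?b a" using QP[OF aN(1) s] k z by (simp add: lin_0[OF lin_cr] scl_simps)
      then have "?Q ?b (?Q \<alpha> (?P a)) = a" using Qa by simp
      then show ?thesis using 2 sgs z bb by (simp add: linf_minus[OF Fs_linear] lin_0[OF lin_an] linf_0[OF Fs_linear])
    next
      case 3
      then have ne: "bar N i \<noteq> \<alpha>" "bar N i \<noteq> ?b" using i aN by (auto dest: arg_cong[of _ _ "bar N"])
      have "?Q (bar N i) (?P a) = ?P (?Q (bar N i) a)"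
        using QP[OF bar_lt[OF i] s] ne by (simp add: ket_apply scl_simps)
      then have "?Q i (?Q (bar N i) (?P a)) = ?P (?Q i (?Q (bar N i) a))"
        using QP[OF i supp_an[OF s]] 3 by (simp add: ket_apply scl_simps)
      then show ?thesis using 3 Suc.IH[OF free_an[OF free_an[OF Suc.prems]], of i "bar N i"] by simp
    qed
  qed
  then have "?F (Suc k) (?P a) = (\<Sum>i<N. (if i = \<alpha> \<or> i = ?b then - ?F k a else 0) + ?r i)"
    unfolding Fs.simps N[symmetric] by (intro sum.cong) auto
  also have "\<dots> = - 2 * ?F k a + (\<Sum>i<N. ?r i)"
    unfolding sum.distrib using sum_two[OF aN(1) bb(2) aN(2), of "\<lambda>_. - ?F k a"] by simp
  also have "(\<Sum>i<N. ?r i) = - 2 * of_nat k * ?F k a"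
    by (cases k) (simp_all add: sum_distrib_left N)
  finally show ?case by (simp add: algebra_simps)
qed

lemma good_single:
  assumes "c \<le> msize T n" shows "good T n {#c#} {#c#} (\<lambda>g. wc (msize T n) g c {..<c})"
proof (rule good_of_linear[where F = "\<lambda>a. a {..<c}"])
  fix A a assume "A \<in> lie T n" "\<And>i j. i < j \<Longrightarrow> A i j = 0"
  then show "dv {..<msize T n} A a {..<c} = wtm {#c#} A * a {..<c}"
    using dv_leading[of A c "msize T n" a] assms by (simp add: wtm_def)
next
  have "wc (msize T n) (gm (map ket [0..<c])) c = wl (map ket (rev [0..<c]))"
    using assms by (subst wc_gm) (auto simp: vsupp_kets rev_map)
  then show "wc (msize T n) (gm (map ket [0..<c])) c {..<c} \<noteq> 0"
    using wl_kets[of "rev [0..<c]" "{..<c}"] by auto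
qed (rule linf_eval)

lemma good_Fp_an:
  assumes "T \<noteq> TypeC" "N = msize T n" "m \<le> N" "m' \<le> N" "Fp N (anN N) k m m' (wc N g c) (wc N g d) \<noteq> 0"
  shows "\<exists>f. good T n {#c,d#} {#m,m'#} f"
proof -
  have "good T n {#c,d#} {#m,m'#} (\<lambda>g. Fp (msize T n) (anN (msize T n)) k m m' (wc (msize T n) g c) (wc (msize T n) g d))"
  proof (rule good_of_bilinear[where F = "Fp (msize T n) (anN (msize T n)) k m m'"])
    show "Fp (msize T n) (anN (msize T n)) k m m' (wc (msize T n) g c) (wc (msize T n) g d) \<noteq> 0" using assms by simp
  qed (use assms in \<open>simp_all add: Fp_linear lin_an Fp_an_invariant\<close>)
  then show ?thesis by blast
qed

lemma good_Fp_cr: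
  assumes "T \<noteq> TypeC" "N = msize T n" "m \<le> N" "m' \<le> N" "Fp N crk k m m' (wc N g c) (wc N g d) \<noteq> 0"
  shows "\<exists>f. good T n {#c,d#} {#m,m'#} f"
proof -
  have "good T n {#c,d#} {#m,m'#} (\<lambda>g. Fp (msize T n) crk k m m' (wc (msize T n) g c) (wc (msize T n) g d))"
  proof (rule good_of_bilinear[where F = "Fp (msize T n) (crk) k m m'"])
    show "Fp (msize T n) (crk) k m m' (wc (msize T n) g c) (wc (msize T n) g d) \<noteq> 0" using assms by simp
  qed (use assms in \<open>simp_all add: Fp_linear lin_cr Fp_cr_invariant\<close>)
  then show ?thesis by blast
qed

lemma wl_kets_nz: "distinct xs \<Longrightarrow> U = set xs \<Longrightarrow> wl (map ket xs) U \<noteq> 0"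
  using wl_kets by blast

text \<open>Witness: x - k unit vectors followed by k vectors e_i + e_(bar i), in both columns. Each
  contraction removes one of the latter; 2x < N keeps all indices i and bar i apart.\<close>

lemma good_contract_equal:
  assumes T: "T \<noteq> TypeC" and N: "N = msize T n" and x: "2 * x < N" "k \<le> x"
  shows "\<exists>f. good T n {#x,x#} {#x - k, x - k#} f"
proof -
  define d where "d = x - k"
  let ?u = "\<lambda>j. pv N (d + j)" and ?K = "map ket (rev [0..<d])"
  let ?vs = "map ket [0..<d] @ map ?u [0..<k]"
  have "Fp N (anN N) j d d (wl (rev (map ?u [0..<j]) @ ?K)) (wl (rev (map ?u [0..<j]) @ ?K)) \<noteq> 0" if "j \<le> k" for j
    using that
  proof (induction j)
    case 0
    then show ?case using wl_kets_nz[of "rev [0..<d]" "{..<d}"] by (simp add: lessThan_atLeast0)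
  next
    case (Suc j)
    let ?w = "wl (rev (map ?u [0..<j]) @ ?K)"
    have "free N (d + j) ?w"
    proof (rule free_wl)
      have "\<forall>y\<in>set (map ket (rev [0..<d])). vsupp {..<N} y \<and> y (d + j) = 0 \<and> y (bar N (d + j)) = 0"
        using x Suc.prems by (auto simp: d_def vsupp_kets ket_apply bar_def)
      moreover have "\<forall>y\<in>set (rev (map ?u [0..<j])). vsupp {..<N} y \<and> y (d + j) = 0 \<and> y (bar N (d + j)) = 0"
        using x Suc.prems by (auto simp: d_def vsupp_pv) (auto simp: pv_def ket_apply bar_def)
      ultimately show "\<forall>y\<in>set (rev (map ?u [0..<j]) @ ?K). vsupp {..<N} y \<and> y (d + j) = 0 \<and> y (bar N (d + j)) = 0"
        unfolding set_append by blast
    qed (use x Suc.prems in \<open>simp add: d_def\<close>)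
    then have "Fp N (anN N) (Suc j) d d (cr (?u j) ?w) (cr (?u j) ?w) = 2 * of_nat (Suc j) * Fp N (anN N) j d d ?w ?w"
      using Fp_an_step[of "d + j" N d ?w ?w "Suc j" d] x Suc.prems by (simp add: d_def bar_def)
    moreover have "(2 * of_nat (Suc j) :: complex) \<noteq> 0" by (metis mult_eq_0_iff of_nat_eq_0_iff nat.distinct(1) zero_neq_numeral)
    ultimately show ?case using Suc by (simp del: of_nat_Suc Fp.simps)
  qed
  from this[of k] have "Fp N (anN N) k d d (wc N (gm ?vs) x) (wc N (gm ?vs) x) \<noteq> 0"
    using x by (subst (1 2) wc_gm) (auto simp: d_def vsupp_kets vsupp_pv rev_map)
  then show ?thesis using good_Fp_an[OF T N] x by (simp add: d_def)
qed

lemma cr2_wl: "cr x (cr y (wl (us @ zs))) = wl (us @ [x, y] @ zs)"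
proof (induction us)
  case (Cons u us)
  have "cr x (cr y (cr u (wl (us @ zs)))) = cr u (cr x (cr y (wl (us @ zs))))"
    by (simp add: cr_anticomm[of y u] cr_anticomm[of x u] lin_minus[OF lin_cr])
  then show ?case using Cons by simp
qed simp

text \<open>Long columns are lengthened instead, and N - (x - k) carries the same weight as x - k.
  In the witness the vectors indexed by \<open>R\<close> stay fixed; \<open>L j\<close> still
  contains j vectors e_i + e_(bar i), the other k - j having been completed to the pairs in
  \<open>Q j\<close>. At j = 0 the indices fill {..<N - d}.\<close>

lemma good_expand_equal:
  assumes T: "T \<noteq> TypeC" and N: "N = msize T n" and x: "2 * x < N" "k \<le> x"
  shows "\<exists>f. good T n {#N - x, N - x#} {#N - (x - k), N - (x - k)#} f"
proof -
  define d where "d = x - k"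
  let ?al = "\<lambda>j. d + j" and ?u = "\<lambda>j. pv N (d + j)"
  define R where "R = [0..<d] @ [x..<N-x]"
  define Q where "Q = (\<lambda>j. concat (map (\<lambda>i. [d + i, bar N (d + i)]) [j..<k]))"
  define L where "L = (\<lambda>j. rev (map ?u [0..<j]) @ map ket (Q j @ rev R))"
  have Qset: "set (Q j) = {d + j..<x} \<union> {N - x..<N - d - j}" if "j \<le> k" for j
  proof (intro equalityI subsetI)
    fix a assume "a \<in> set (Q j)"
    then show "a \<in> {d + j..<x} \<union> {N - x..<N - d - j}" using x by (auto simp: Q_def bar_def d_def)
  next
    fix a assume a: "a \<in> {d + j..<x} \<union> {N - x..<N - d - j}"
    show "a \<in> set (Q j)"
    proof (cases "a < x")
      case True
      then have "a = d + (a - d)" "a - d \<in> set [j..<k]" using a x that by (auto simp: d_def)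
      then show ?thesis unfolding Q_def by (auto intro!: bexI[of _ "a - d"])
    next
      case False
      then have "a = bar N (d + (N - 1 - a - d))" "N - 1 - a - d \<in> set [j..<k]" using a x that by (auto simp: d_def bar_def)
      then show ?thesis unfolding Q_def by (auto intro!: bexI[of _ "N - 1 - a - d"])
    qed
  qed
  have "distinct (Q j)" if "j \<le> k" for j
    using that
  proof (induction rule: inc_induct)
    case base
    then show ?case by (simp add: Q_def)
  next
    case (step j)
    then have "Q j = [d + j, bar N (d + j)] @ Q (Suc j)" by (simp add: Q_def upt_conv_Cons)
    then show ?case using step Qset[of "Suc j"] x by (auto simp: bar_def d_def)
  qed
  from this[of 0] have dist: "distinct (Q 0 @ rev R)" using Qset[of 0] x by (auto simp: R_def d_def)
  have set0: "set (Q 0 @ rev R) = {..<N - d}" using Qset[of 0] x by (auto simp: R_def d_def)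
  have "Fp N crk j (N - d) (N - d) (wl (L j)) (wl (L j)) \<noteq> 0" if "j \<le> k" for j
    using that
  proof (induction j)
    case 0
    have "wl (L 0) {..<N - d} \<noteq> 0"
      unfolding L_def using wl_kets_nz[OF dist set0[symmetric]] by simp
    then show ?case by simp
  next
    case (Suc j)
    let ?w = "wl (rev (map ?u [0..<j]) @ map ket (Q (Suc j) @ rev R))"
    have 1: "wl (L (Suc j)) = cr (?u j) ?w" by (simp add: L_def)
    have 2: "crk (d + j) (crk (bar N (d + j)) ?w) = wl (L j)"
    proof -
      have "Q j = [d + j, bar N (d + j)] @ Q (Suc j)" using Suc.prems by (simp add: Q_def upt_conv_Cons)
      then show ?thesis unfolding cr2_wl L_def by simp
    qed
    have "free N (d + j) ?w"
    proof (rule free_wl)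
      show "d + j < N" using x Suc.prems by (simp add: d_def)
      have "set (Q (Suc j) @ rev R) \<subseteq> {..<N} - {d + j, bar N (d + j)}"
        using Qset[OF Suc.prems] x Suc.prems by (auto simp: R_def d_def bar_def)
      then have h: "i < N \<and> i \<noteq> d + j \<and> i \<noteq> bar N (d + j)" if "i \<in> set (Q (Suc j) @ rev R)" for i
        using that by blast
      have "vsupp {..<N} (ket i) \<and> ket i (d + j) = 0 \<and> ket i (bar N (d + j)) = 0" if "i \<in> set (Q (Suc j) @ rev R)" for i
        using h[OF that] vsupp_kets[of i N] by (simp add: ket_apply)
      then have "\<forall>y\<in>set (map ket (Q (Suc j) @ rev R)). vsupp {..<N} y \<and> y (d + j) = 0 \<and> y (bar N (d + j)) = 0"
        unfolding set_map by (intro ballI) (elim imageE, simp only:)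
      moreover have "\<forall>y\<in>set (rev (map ?u [0..<j])). vsupp {..<N} y \<and> y (d + j) = 0 \<and> y (bar N (d + j)) = 0"
        using x Suc.prems by (auto simp: d_def vsupp_pv) (auto simp: pv_def ket_apply bar_def)
      ultimately show "\<forall>y\<in>set (rev (map ?u [0..<j]) @ map ket (Q (Suc j) @ rev R)). vsupp {..<N} y \<and> y (d + j) = 0 \<and> y (bar N (d + j)) = 0"
        unfolding set_append by blast
    qed
    then have "Fp N crk (Suc j) (N - d) (N - d) (cr (?u j) ?w) (cr (?u j) ?w) = - 2 * of_nat (Suc j) * Fp N crk j (N - d) (N - d) (wl (L j)) (wl (L j))"
      using Fp_cr_step[of "d + j" N "N - d" ?w ?w "Suc j" "N - d"] x Suc.prems unfolding 2 by (simp add: d_def bar_def)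
    moreover have "(- 2 * of_nat (Suc j) :: complex) \<noteq> 0" by (metis mult_eq_0_iff neg_equal_0_iff_equal of_nat_eq_0_iff nat.distinct(1) zero_neq_numeral)
    ultimately show ?case using Suc unfolding 1 by (simp del: of_nat_Suc Fp.simps)
  qed
  from this[of k] have nz: "Fp N crk k (N - d) (N - d) (wl (L k)) (wl (L k)) \<noteq> 0" by simp
  let ?vs = "map ket R @ map ?u [0..<k]"
  have len: "length ?vs = N - x" using x by (simp add: R_def d_def)
  have "wc N (gm ?vs) (N - x) = wl (L k)"
    using len x by (subst wc_gm) (auto simp: L_def Q_def rev_map vsupp_kets vsupp_pv R_def d_def)
  then show ?thesis using nz good_Fp_cr[OF T N, of "N - d" "N - d" k "gm ?vs" "N - x" "N - x"] by (simp add: d_def)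
qed

lemma wl_move: "wl (xs @ u # ys) = scl ((-1) ^ length xs) (cr u (wl (xs @ ys)))"
proof (induction xs)
  case (Cons x xs)
  show ?case
    unfolding append_Cons wl_simps Cons lin_scl[OF lin_cr] cr_anticomm[of x u] by (auto simp: fun_eq_iff)
qed (simp add: scl_simps)

text \<open>If 2c <= N, the contraction removes a common vector e_(c-1) + e_(bar (c-1)). Otherwise
  bar (c-1) = N - c lies below c and unit vectors suffice, ordered so that e_(N-c) is the last one
  in the shorter column; c + d <= N + 1 keeps it apart from the first d - 1.\<close>

lemma good_contract_one:
  assumes T: "T \<noteq> TypeC" and N: "N = msize T n" and cd: "1 \<le> d" "d \<le> c" "c \<le> N" "c + d \<le> N + 1"
  shows "\<exists>f. good T n {#c,d#} {#c - 1, d - 1#} f"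
proof (cases "2 * c \<le> N")
  case True
  let ?u = "pv N (c - 1)" and ?K = "map ket (rev [0..<d-1])"
  let ?a = "wl (map ket (rev [0..<c-1]))" and ?b = "wl ?K"
  let ?vs = "map ket [0..<d-1] @ [?u] @ map ket [d-1..<c-1]"
  have v: "\<forall>v\<in>set ?vs. vsupp {..<N} v" using cd by (auto simp: vsupp_kets vsupp_pv)
  have b: "wc N (gm ?vs) d = cr ?u ?b"
    using cd by (subst wc_gm[OF v]) (auto simp: rev_map)
  have "[0..<c-1] = [0..<d-1] @ [d-1..<c-1]" using cd by (metis diff_le_mono le0 le_add_diff_inverse upt_add_eq_append)
  then have e: "rev (map ket [d-1..<c-1]) @ ?K = map ket (rev [0..<c-1])" by (simp add: rev_map)
  have "wc N (gm ?vs) c = wl (rev (map ket [d-1..<c-1]) @ ?u # ?K)"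
    using cd by (subst wc_gm[OF v]) (auto simp: rev_map)
  also have "\<dots> = scl ((-1) ^ (c - d)) (cr ?u ?a)"
    unfolding wl_move e using cd by simp
  finally have a: "wc N (gm ?vs) c = scl ((-1) ^ (c - d)) (cr ?u ?a)" .
  have fr: "free N (c - 1) (wl (map ket (rev [0..<k])))" if "k \<le> c - 1" for k
    using that cd True by (intro free_wl) (auto simp: vsupp_kets ket_apply bar_def)
  have "Fp N (anN N) 1 (c-1) (d-1) (cr ?u ?a) (cr ?u ?b) = 2 * (?a {..<c-1} * ?b {..<d-1})"
    using Fp_an_step[of "c-1" N "c-1" ?a ?b 1 "d-1"] fr cd True by (simp add: bar_def)
  also have "\<dots> \<noteq> 0"
    using wl_kets_nz[of "rev [0..<c-1]" "{..<c-1}"] wl_kets_nz[of "rev [0..<d-1]" "{..<d-1}"] by (simp add: lessThan_atLeast0)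
  finally have "Fp N (anN N) 1 (c-1) (d-1) (wc N (gm ?vs) c) (wc N (gm ?vs) d) \<noteq> 0"
    unfolding a b linf_scl[OF Fp_linear(1)[OF lin_an]] by simp
  from good_Fp_an[OF T N _ _ this] show ?thesis using cd by simp
next
  case False
  define L where "L = [0..<d-1] @ [N-c] @ filter (\<lambda>i. i \<noteq> N-c) [d-1..<c]"
  have mem: "N - c \<in> set [d-1..<c]" using False cd by auto
  have "length (filter (\<lambda>i. i \<noteq> N-c) [d-1..<c]) = card (set (filter (\<lambda>i. i \<noteq> N-c) [d-1..<c]))"
    by (rule distinct_card[symmetric]) simp
  also have "set (filter (\<lambda>i. i \<noteq> N-c) [d-1..<c]) = {d-1..<c} - {N-c}" by auto
  also have "card ({d-1..<c} - {N-c}) = c - d" using mem cd by (simp add: card_Diff_singleton)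
  finally have len: "length L = c" using cd by (simp add: L_def)
  have dist: "distinct L" using False cd by (auto simp: L_def)
  have setL: "set L = {..<c}" using mem cd by (auto simp: L_def)
  let ?vs = "map ket L"
  have v: "\<forall>v\<in>set ?vs. vsupp {..<N} v" using cd setL by (auto simp: vsupp_kets)
  let ?a = "wc N (gm ?vs) c" and ?b = "wc N (gm ?vs) d"
  have "?a = wl (map ket (rev L))" using len by (subst wc_gm[OF v]) (auto simp: rev_map)
  then have a: "?a U \<noteq> 0 \<longleftrightarrow> U = {..<c}" for U using wl_kets[of "rev L" U] dist setL by simp
  have "take d L = [0..<d-1] @ [N-c]" using cd by (simp add: L_def)
  then have "?b = wl (map ket (rev ([0..<d-1] @ [N-c])))" using len cd
    by (subst wc_gm[OF v]) (auto simp: take_map rev_map)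
  moreover have "distinct (rev ([0..<d-1] @ [N-c]))" using cd by auto
  ultimately have b: "?b U \<noteq> 0 \<longleftrightarrow> U = insert (N - c) {..<d-1}" for U
    using wl_kets[of "rev ([0..<d-1] @ [N-c])" U] by (simp add: lessThan_atLeast0 insert_commute Un_commute)
  \<comment> \<open>Only the removal of c - 1 turns {..<c} into {..<c-1}, so the contraction reduces
    to a single term and nothing can cancel.\<close>
  have A: "anN N i ?a {..<c-1} = 0" if "i \<noteq> c - 1" "i < N" for i
  proof -
    have "insert i {..<c-1} \<noteq> {..<c}" if "c - 1 \<le> i"
    proof
      assume "insert i {..<c-1} = {..<c}"
      then have "c - 1 \<in> insert i {..<c-1}" using cd by auto
      then show False using \<open>i \<noteq> c - 1\<close> by auto
    qed
    then have "?a (insert i {..<c-1}) = 0" if "c - 1 \<le> i" using a[of "insert i {..<c-1}"] that by blast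
    then show ?thesis unfolding an_ket[OF finite_lessThan] by (simp del: of_nat_diff)
  qed
  have "Fp N (anN N) 1 (c-1) (d-1) ?a ?b = (\<Sum>i<N. anN N i ?a {..<c-1} * anN N (bar N i) ?b {..<d-1})"
    by simp
  also have "\<dots> = (\<Sum>i\<in>{c-1}. anN N i ?a {..<c-1} * anN N (bar N i) ?b {..<d-1})"
    by (rule sum.mono_neutral_right) (use cd A in auto)
  also have "\<dots> \<noteq> 0"
  proof -
    have "insert (c-1) {..<c-1} = {..<c}" using cd by auto
    then have "anN N (c-1) ?a {..<c-1} \<noteq> 0" using cd a[of "{..<c}"] unfolding an_ket[OF finite_lessThan] by simp
    moreover have "bar N (c-1) = N - c" using cd by (simp add: bar_def)
    then have "anN N (bar N (c-1)) ?b {..<d-1} \<noteq> 0" using cd b[of "insert (N-c) {..<d-1}"] unfolding an_ket[OF finite_lessThan] by simp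
    ultimately show ?thesis by simp
  qed
  finally have "Fp N (anN N) 1 (c-1) (d-1) ?a ?b \<noteq> 0" .
  from good_Fp_an[OF T N _ _ this] show ?thesis using cd by simp
qed

text \<open>Witness: m unit vectors and k pairs e_i, e_(bar i) with m <= i < m + k <= n; each
  contraction removes one pair.\<close>

lemma good_symplectic:
  assumes "m + k \<le> n"
  shows "\<exists>f. good TypeC n {#m + 2 * k#} {#m#} f"
proof -
  define N where "N = msize TypeC n"
  have N2: "N = 2 * n" by (simp add: N_def msize_def)
  define L where "L = (\<lambda>j. concat (map (\<lambda>i. [m + i, bar N (m + i)]) (rev [0..<j])) @ rev [0..<m])"
  have "Fs TypeC n j m (wl (map ket (L j))) \<noteq> 0 \<and> length (L j) = m + 2 * j \<and>
      set (L j) \<subseteq> {..<m + j} \<union> {N - m - j..<N - m}" if "j \<le> k" for j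
    using that
  proof (induction j)
    case 0
    then show ?case using wl_kets_nz[of "rev [0..<m]" "{..<m}"] by (auto simp: L_def lessThan_atLeast0)
  next
    case (Suc j)
    have L: "L (Suc j) = (m + j) # bar N (m + j) # L j" by (simp add: L_def)
    have IH: "Fs TypeC n j m (wl (map ket (L j))) \<noteq> 0" "length (L j) = m + 2 * j" "set (L j) \<subseteq> {..<m + j} \<union> {N - m - j..<N - m}"
      using Suc by auto
    have "vsupp {..<N} (ket i) \<and> ket i (m + j) = 0 \<and> ket i (bar N (m + j)) = 0" if "i \<in> set (L j)" for i
    proof -
      have "i \<in> {..<m + j} \<union> {N - m - j..<N - m}" using that IH(3) by blast
      then show ?thesis using Suc.prems assms N2 by (auto simp: vsupp_kets ket_apply bar_def)
    qed
    then have "\<forall>x\<in>set (map ket (L j)). vsupp {..<N} x \<and> x (m + j) = 0 \<and> x (bar N (m + j)) = 0"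
      unfolding set_map by (intro ballI) (elim imageE, simp only:)
    then have fr: "free N (m + j) (wl (map ket (L j)))" using Suc.prems assms N2 by (intro free_wl) auto
    have "Fs TypeC n (Suc j) m (wl (map ket (L (Suc j)))) = - 2 * of_nat (Suc j) * Fs TypeC n j m (wl (map ket (L j)))"
      unfolding L list.map wl_simps using Fs_step[OF refl _ _ N_def fr, of m "Suc j"] Suc.prems assms by (simp del: Fs.simps)
    moreover have "(- 2 * of_nat (Suc j) :: complex) \<noteq> 0" by (metis mult_eq_0_iff neg_equal_0_iff_equal of_nat_eq_0_iff nat.distinct(1) zero_neq_numeral)
    ultimately have "Fs TypeC n (Suc j) m (wl (map ket (L (Suc j)))) \<noteq> 0" using IH(1) by (simp del: of_nat_Suc Fs.simps)
    moreover have "set (L (Suc j)) \<subseteq> {..<m + Suc j} \<union> {N - m - Suc j..<N - m}"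
    proof -
      have "{..<m + j} \<union> {N - m - j..<N - m} \<subseteq> {..<m + Suc j} \<union> {N - m - Suc j..<N - m}" by auto
      moreover have "bar N (m + j) \<in> {N - m - Suc j..<N - m}" using Suc.prems assms N2 by (auto simp: bar_def)
      ultimately show ?thesis unfolding L using IH(3) by auto
    qed
    ultimately show ?case using IH(2) L by simp
  qed
  from this[of k] have nz: "Fs TypeC n k m (wl (map ket (L k))) \<noteq> 0" and len: "length (L k) = m + 2 * k"
    and st: "set (L k) \<subseteq> {..<m + k} \<union> {N - m - k..<N - m}" by auto
  let ?g = "gm (map ket (rev (L k)))"
  have "\<forall>v\<in>set (map ket (rev (L k))). vsupp {..<N} v"
    using st assms N2 by (fastforce simp: vsupp_kets)
  then have "wc N ?g (m + 2 * k) = wl (map ket (L k))" using len by (subst wc_gm) (auto simp: rev_map)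
  then have nz: "Fs TypeC n k m (wc (msize TypeC n) ?g (m + 2 * k)) \<noteq> 0" using nz N_def by simp
  have "good TypeC n {#m + 2 * k#} {#m#} (\<lambda>g. Fs TypeC n k m (wc (msize TypeC n) g (m + 2 * k)))"
  proof (rule good_of_linear[OF Fs_linear _ nz])
    fix A a assume "A \<in> lie TypeC n" "\<And>i j. i < j \<Longrightarrow> A i j = 0" "supp {..<msize TypeC n} a"
    then show "Fs TypeC n k m (dv {..<msize TypeC n} A a) = wtm {#m#} A * Fs TypeC n k m a"
      using assms by (intro Fs_invariant) (auto simp: msize_def)
  qed
  then show ?thesis by blast
qed

section \<open>The symplectic case: choosing the columns\<close>

text \<open>The state after p ones and q zeros: the columns read so far can be contracted to the
  sizes in I.\<close>

definition RchS :: "nat \<Rightarrow> nat \<Rightarrow> nat \<Rightarrow> nat multiset \<Rightarrow> bool" where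
  "RchS n p q I \<longleftrightarrow> (\<exists>B C f. em (2 * n) 0 p q B C \<and> good TypeC n C I f)"

lemma RchS_0: "RchS n 0 0 {#}"
  unfolding RchS_def using em0 good_empty by blast

lemma RchS_extend:
  assumes "good TypeC n C I f" "m \<le> v" "v + m \<le> 2 * n" "even (v + m)"
  shows "\<exists>f. good TypeC n (add_mset v C) (add_mset m I) f"
proof -
  obtain k where k: "v = m + 2 * k" using assms(2,4) by (metis dvd_def even_diff_nat le_add_diff_inverse le_add_diff_inverse2 even_add)
  then have "m + k \<le> n" using assms(3) by simp
  then obtain f' where "good TypeC n {#v#} {#m#} f'" using good_symplectic k by blast
  from good_mult[OF this assms(1)] show ?thesis by auto
qed

lemma RchS_zero:
  assumes "RchS n p q I" "p + q \<le> 2 * n" "m \<le> p" "p + m \<le> 2 * n" "even (p + m)"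
  shows "RchS n p (Suc q) (add_mset m I)"
proof -
  obtain B C f where h: "em (2 * n) 0 p q B C" "good TypeC n C I f" using assms(1) unfolding RchS_def by blast
  have "em (2 * n) 0 p (q + 1) B (add_mset p C)" using h(1) assms(2) by (intro em2) auto
  then show ?thesis using RchS_extend[OF h(2) assms(3-5)] unfolding RchS_def by auto
qed

text \<open>A column of length 2n - q can be brought to the same sizes m as one of length q, so the
  conditions are those of \<open>RchS_zero\<close> with q for p.\<close>

lemma RchS_one:
  assumes "RchS n p q I" "p + q \<le> 2 * n" "m \<le> q" "q + m \<le> 2 * n" "even (q + m)"
  shows "RchS n (Suc p) q (add_mset m I)"
proof -
  obtain B C f where h: "em (2 * n) 0 p q B C" "good TypeC n C I f" using assms(1) unfolding RchS_def by blast
  have q: "m \<le> 2 * n - q" "2 * n - q + m \<le> 2 * n" "even (2 * n - q + m)" using assms(2-5) by auto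
  have "em (2 * n) 0 (p + 1) q (B \<union> {(p,j) | j. p + 0 \<le> j \<and> j < 2 * n - q}) (add_mset (2 * n - q) C)"
    using h(1) assms(2) by (intro em1) auto
  then show ?thesis using RchS_extend[OF h(2) q] unfolding RchS_def by auto
qed

text \<open>A column reaches only sizes of its own parity, so the parity of y against j fixes the
  order of the letters. Zero before one offers the sizes j + 1 and j + 1; one before zero offers j
  and j + 2, of which the larger goes to y.\<close>

lemma RchS_pair:
  assumes R: "RchS n (Suc j) j I" and j: "j < n" and xy: "x \<le> y" "even (x + y)"
    and c: "odd (y + j) \<and> y \<le> Suc j \<or> even (y + j) \<and> y \<le> j + 2 \<and> x \<le> j \<and> y \<le> n"
  shows "RchS n (Suc (Suc j)) (Suc j) (add_mset x (add_mset y I))"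
proof (cases "odd (y + j)")
  case True
  then have y: "y \<le> Suc j" using c by auto
  have "even (Suc j + x)" "even (Suc j + y)" using True xy(2) by presburger+
  then have "RchS n (Suc j) (Suc j) (add_mset x I)" using j xy y by (intro RchS_zero[OF R]) auto
  from RchS_one[OF this, of y] have "RchS n (Suc (Suc j)) (Suc j) (add_mset y (add_mset x I))"
    using j y \<open>even (Suc j + y)\<close> by auto
  then show ?thesis by (simp add: add_mset_commute)
next
  case False
  then have y: "y \<le> j + 2" "x \<le> j" "y \<le> n" using c by auto
  have ev: "even (j + x)" "even (Suc (Suc j) + y)" using False xy(2) by presburger+
  have "RchS n (Suc (Suc j)) j (add_mset x I)" using j y ev by (intro RchS_one[OF R]) auto
  \<comment> \<open>The critical case j + 1 = n and y = n is excluded by parity.\<close>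
  moreover have "Suc (Suc j) + y \<le> 2 * n"
  proof (cases "Suc j = n")
    case True
    then have "y \<noteq> n" using False by auto
    then show ?thesis using y True by linarith
  next
    case False
    then show ?thesis using y j by linarith
  qed
  ultimately have "RchS n (Suc (Suc j)) (Suc j) (add_mset y (add_mset x I))"
    using RchS_zero[of n "Suc (Suc j)" j "add_mset x I" y] j y ev by auto
  then show ?thesis by (simp add: add_mset_commute)
qed

text \<open>Items of equal parity are paired as they arrive; at most one even and one odd item wait.\<close>

lemma RchS_all:
  fixes d :: "nat \<Rightarrow> nat"
  assumes mono: "\<And>s t. s \<le> t \<Longrightarrow> t < 2 * n \<Longrightarrow> d s \<le> d t"
    and bd: "\<And>s. s < 2 * n \<Longrightarrow> 2 * d s \<le> s + 2" and dn: "\<And>s. s < 2 * n \<Longrightarrow> d s \<le> n"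
    and par: "even (\<Sum>s<2*n. d s)"
  shows "RchS n (Suc n) n (add_mset 0 (mset (map d [0..<2*n])))"
proof -
  \<comment> \<open>A waiting item came from an earlier position, so its bound s + 1 is one better
    than the bound s + 2 for \<open>d s\<close>.\<close>
  define Inv where "Inv s j I X \<longleftrightarrow> RchS n (Suc j) j I \<and> I + X = add_mset 0 (mset (map d [0..<s])) \<and>
     s = 2 * j + size X \<and> even (sum_mset I) \<and> (\<forall>x\<in>#X. 2 * x \<le> s + 1 \<and> (\<exists>t<s. x = d t)) \<and>
     (X = {#} \<or> (\<exists>x. X = {#x#}) \<or> (\<exists>x y. X = {#x, y#} \<and> odd (x + y)))" for s j I X
  have "\<exists>j I X. Inv s j I X" if "s \<le> 2 * n" for s
    using that
  proof (induction s)
    case 0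
    \<comment> \<open>The diagram has 2n + 1 columns, lam at most 2n. The first letter reads the
      full column of length 2n and contracts it to 0, which is the extra item.\<close>
    have "RchS n (Suc 0) 0 (add_mset 0 {#})" by (rule RchS_one[OF RchS_0]) auto
    then have "Inv 0 0 {#0#} {#}" by (simp add: Inv_def)
    then show ?case by blast
  next
    case (Suc s)
    then obtain j I X where inv: "Inv s j I X" by fastforce
    then have h: "RchS n (Suc j) j I" "I + X = add_mset 0 (mset (map d [0..<s]))" "s = 2 * j + size X"
      "even (sum_mset I)" "\<forall>x\<in>#X. 2 * x \<le> s + 1 \<and> (\<exists>t<s. x = d t)"
      and X: "X = {#} \<or> (\<exists>x. X = {#x#}) \<or> (\<exists>x y. X = {#x, y#} \<and> odd (x + y))"
      unfolding Inv_def by blast+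
    have sn: "s < 2 * n" using Suc.prems by simp
    have xle: "x \<le> d s" if "x \<in># X" for x using h(5) that mono[of _ s] sn by fastforce
    show ?case
    proof (cases "\<exists>x\<in>#X. even (x + d s)")
      case True
      then obtain x where x: "x \<in># X" "even (x + d s)" by blast
      then obtain Y where Y: "X = add_mset x Y" by (metis multi_member_split)
      have "size X \<le> 2" using X by auto
      then have sz: "size Y \<le> 1" using Y by simp
      have jn: "j < n" using sn h(3) Y by simp
      have bx: "2 * x \<le> s + 1" using h(5) x(1) by blast
      have "odd (d s + j) \<and> d s \<le> Suc j \<or> even (d s + j) \<and> d s \<le> j + 2 \<and> x \<le> j \<and> d s \<le> n"
      proof (cases "odd (d s + j)")
        case True
        have "d s \<le> j + 2" using bd[OF sn] h(3) Y sz by simp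
        moreover have "d s \<noteq> j + 2" using True by auto
        ultimately show ?thesis using True by simp
      next
        case False
        then have "even (x + j)" using x(2) by presburger
        moreover have "2 * x \<le> 2 * j + 3" using bx h(3) Y sz by simp
        ultimately have "x \<le> j" by presburger
        then show ?thesis using False bd[OF sn] dn[OF sn] h(3) Y sz by auto
      qed
      then have R: "RchS n (Suc (Suc j)) (Suc j) (add_mset x (add_mset (d s) I))"
        using RchS_pair[OF h(1) jn xle[OF x(1)] x(2)] by blast
      have "Inv (Suc s) (Suc j) (add_mset x (add_mset (d s) I)) Y" unfolding Inv_def
      proof (intro conjI)
        show "RchS n (Suc (Suc j)) (Suc j) (add_mset x (add_mset (d s) I))" by (rule R)
        show "add_mset x (add_mset (d s) I) + Y = add_mset 0 (mset (map d [0..<Suc s]))" using h(2) Y by auto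
        show "Suc s = 2 * Suc j + size Y" using h(3) Y by simp
        show "even (sum_mset (add_mset x (add_mset (d s) I)))" using h(4) x(2) by auto
        show "\<forall>x\<in>#Y. 2 * x \<le> Suc s + 1 \<and> (\<exists>t<Suc s. x = d t)"
          using h(5) Y by (metis le_SucI less_SucI union_iff add_mset_add_single Suc_eq_plus1)
        show "Y = {#} \<or> (\<exists>x. Y = {#x#}) \<or> (\<exists>x y. Y = {#x, y#} \<and> odd (x + y))"
          using sz by (metis One_nat_def le_Suc_eq le_zero_eq size_eq_0_iff_empty size_1_singleton_mset)
      qed
      then show ?thesis by blast
    next
      case False
      have "X = {#} \<or> (\<exists>x. X = {#x#})"
      proof (rule ccontr)
        assume "\<not> ?thesis"
        then obtain x y where "X = {#x, y#}" "odd (x + y)" using X by blast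
        then show False using False by auto
      qed
      have "Inv (Suc s) j I (add_mset (d s) X)" unfolding Inv_def
      proof (intro conjI)
        show "RchS n (Suc j) j I" by (rule h(1))
        show "I + add_mset (d s) X = add_mset 0 (mset (map d [0..<Suc s]))" using h(2) by simp
        show "Suc s = 2 * j + size (add_mset (d s) X)" using h(3) by simp
        show "even (sum_mset I)" by (rule h(4))
        show "\<forall>x\<in>#add_mset (d s) X. 2 * x \<le> Suc s + 1 \<and> (\<exists>t<Suc s. x = d t)"
          using h(5) bd[OF sn] by (auto intro: less_SucI)
        show "add_mset (d s) X = {#} \<or> (\<exists>x. add_mset (d s) X = {#x#}) \<or> (\<exists>x y. add_mset (d s) X = {#x, y#} \<and> odd (x + y))"
          using \<open>X = {#} \<or> (\<exists>x. X = {#x#})\<close>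
        proof (elim disjE exE)
          assume "X = {#}"
          then show ?thesis by simp
        next
          fix x assume x: "X = {#x#}"
          have "odd (d s + x)" using False unfolding x by (simp add: add.commute)
          then show ?thesis unfolding x by blast
        qed
      qed
      then show ?thesis by blast
    qed
  qed
  from this[of "2 * n"] obtain j I X where inv: "Inv (2 * n) j I X" by blast
  then have h: "RchS n (Suc j) j I" "I + X = add_mset 0 (mset (map d [0..<2*n]))" "2 * n = 2 * j + size X" "even (sum_mset I)"
    and X: "X = {#} \<or> (\<exists>x. X = {#x#}) \<or> (\<exists>x y. X = {#x, y#} \<and> odd (x + y))"
    unfolding Inv_def by blast+
  have "sum_mset (I + X) = (\<Sum>s<2*n. d s)" unfolding h(2) by (simp add: sum_unfold_sum_mset atLeast0LessThan)
  then have "even (sum_mset X)" using par h(4) by (metis even_add sum_mset.union)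
  \<comment> \<open>The number of waiting items is even, and two waiting items would have an odd
    sum, against \<open>par\<close>.\<close>
  then have "X = {#}" using X h(3) by (auto, presburger)
  then show ?thesis using h by simp
qed

section \<open>The orthogonal case: choosing the columns\<close>

definition eff :: "nat \<Rightarrow> nat \<Rightarrow> nat" where
  "eff N c = min c (N - c)"

text \<open>P collects column lengths that have been read but not yet used; minors of size m and N - m have the same
  weight, hence the use of eff.\<close>

definition Rch :: "lie_type \<Rightarrow> nat \<Rightarrow> nat multiset \<Rightarrow> nat \<Rightarrow> nat \<Rightarrow> nat multiset \<Rightarrow> bool" where
  "Rch T n P p q I \<longleftrightarrow> (\<exists>B C ms f. em (msize T n) 1 p q B (P + C) \<and> good T n C ms f \<and> I = image_mset (eff (msize T n)) ms)"

locale orth =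
  fixes T :: lie_type and n W :: nat
  assumes TC: "T \<noteq> TypeC" and W: "msize T n = Suc W"
begin

abbreviation "N \<equiv> msize T n"

lemma Rch_0: "Rch T n {#} 0 0 {#}"
  unfolding Rch_def using em0[of "msize T n" 1] good_empty[of T n]
  by (intro exI[of _ "{}"] exI[of _ "{#}"] exI[of _ "\<lambda>g. 1"]) auto

lemma em_zero: "em N 1 p q B C \<Longrightarrow> p + q < W \<Longrightarrow> em N 1 p (Suc q) B (add_mset p C)"
  using em2[of N 1 p q B C] W by simp

lemma em_one: "em N 1 p q B C \<Longrightarrow> p + q < W \<Longrightarrow> \<exists>B'. em N 1 (Suc p) q B' (add_mset (N - q) C)"
  using em1[of N 1 p q B C] W by auto

lemma single_zero:
  assumes "Rch T n P p q I" "p + q < W" "2 * p \<le> W" shows "Rch T n P p (Suc q) (add_mset p I)"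
proof -
  obtain B C ms f where h: "em N 1 p q B (P + C)" "good T n C ms f" "I = image_mset (eff N) ms" using assms(1) unfolding Rch_def by blast
  have "good T n (add_mset p C) (add_mset p ms) (\<lambda>g. wc N g p {..<p} * f g)"
    using good_mult[OF good_single h(2), of p] assms W by simp
  moreover have "em N 1 p (Suc q) B (P + add_mset p C)" using em_zero[OF h(1) assms(2)] by simp
  moreover have "add_mset p I = image_mset (eff N) (add_mset p ms)" using h(3) assms(3) W by (simp add: eff_def)
  ultimately show ?thesis unfolding Rch_def by blast
qed

lemma single_one:
  assumes "Rch T n P p q I" "p + q < W" "2 * q \<le> W" shows "Rch T n P (Suc p) q (add_mset q I)"
proof -
  obtain B C ms f where h: "em N 1 p q B (P + C)" "good T n C ms f" "I = image_mset (eff N) ms" using assms(1) unfolding Rch_def by blast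
  have "good T n (add_mset (N - q) C) (add_mset (N - q) ms) (\<lambda>g. wc N g (N - q) {..<N - q} * f g)"
    using good_mult[OF good_single h(2), of "N - q"] by simp
  moreover obtain B' where "em N 1 (Suc p) q B' (P + add_mset (N - q) C)" using em_one[OF h(1) assms(2)] by auto
  moreover have "add_mset q I = image_mset (eff N) (add_mset (N - q) ms)" using h(3) assms(3) W by (simp add: eff_def)
  ultimately show ?thesis unfolding Rch_def by blast
qed

lemma pair_zero:
  assumes "Rch T n P p q I" "p + q + 2 \<le> W" "2 * p \<le> W" "d \<le> p" shows "Rch T n P p (q + 2) (add_mset d (add_mset d I))"
proof -
  obtain B C ms f where h: "em N 1 p q B (P + C)" "good T n C ms f" "I = image_mset (eff N) ms" using assms(1) unfolding Rch_def by blast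
  have "\<exists>f. good T n {#p,p#} {#p - (p - d), p - (p - d)#} f"
    using good_contract_equal[OF TC refl, of p n "p - d"] assms W by auto
  then obtain f' where f': "good T n {#p,p#} {#d,d#} f'" using assms(4) by auto
  have "good T n ({#p,p#} + C) ({#d,d#} + ms) (\<lambda>g. f' g * f g)" by (rule good_mult[OF f' h(2)])
  moreover have "em N 1 p (q + 2) B (P + ({#p,p#} + C))"
    using em_zero[OF em_zero[OF h(1)]] assms(2) by simp
  moreover have "add_mset d (add_mset d I) = image_mset (eff N) ({#d,d#} + ms)" using h(3) assms(3,4) W by (simp add: eff_def)
  ultimately show ?thesis unfolding Rch_def by blast
qed

text \<open>Lengthening N - q to N - d is, for the weight, the same as shortening q to d.\<close>

lemma pair_one:
  assumes "Rch T n P p q I" "p + q + 2 \<le> W" "2 * q \<le> W" "d \<le> q" shows "Rch T n P (p + 2) q (add_mset d (add_mset d I))"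
proof -
  obtain B C ms f where h: "em N 1 p q B (P + C)" "good T n C ms f" "I = image_mset (eff N) ms" using assms(1) unfolding Rch_def by blast
  have "\<exists>f. good T n {#N - q,N - q#} {#N - (q - (q - d)), N - (q - (q - d))#} f"
    using good_expand_equal[OF TC refl, of q n "q - d"] assms W by auto
  then obtain f' where f': "good T n {#N - q,N - q#} {#N - d,N - d#} f'" using assms(4) by auto
  have "good T n ({#N - q,N - q#} + C) ({#N - d,N - d#} + ms) (\<lambda>g. f' g * f g)" by (rule good_mult[OF f' h(2)])
  moreover have "\<exists>B'. em N 1 (p + 2) q B' (P + ({#N - q,N - q#} + C))"
  proof -
    obtain B' where "em N 1 (Suc p) q B' (add_mset (N - q) (P + C))" using em_one[OF h(1)] assms(2) by auto
    from em_one[OF this] show ?thesis using assms(2) by auto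
  qed
  moreover have "add_mset d (add_mset d I) = image_mset (eff N) ({#N - d,N - d#} + ms)" using h(3) assms(3,4) W by (simp add: eff_def)
  ultimately show ?thesis unfolding Rch_def by blast
qed

text \<open>The column waits for a partner: \<open>end_zero\<close> or \<open>end_one\<close>
  contracts it once with a later column, so that it finally yields x - 1.\<close>

lemma start_pending:
  assumes "Rch T n {#} x x I" "2 * x < W" shows "Rch T n {#x#} x (Suc x) I"
proof -
  obtain B C ms f where h: "em N 1 x x B C" "good T n C ms f" "I = image_mset (eff N) ms" using assms(1) unfolding Rch_def by auto
  then have "em N 1 x (Suc x) B ({#x#} + C)" using em_zero[OF h(1)] assms(2) by simp
  then show ?thesis unfolding Rch_def using h by blast
qed

lemma end_pending:
  assumes h: "good T n C ms f" "I = image_mset (eff N) ms" and x: "1 \<le> x" "x \<le> c" "c \<le> N" "c + x \<le> N + 1" "2 * x \<le> W"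
  shows "\<exists>ms' f'. good T n (add_mset c (add_mset x C)) ms' f' \<and> add_mset (x - 1) (add_mset (eff N (c - 1)) I) = image_mset (eff N) ms'"
proof -
  obtain f' where f': "good T n {#c,x#} {#c-1,x-1#} f'" using good_contract_one[OF TC refl x(1-4)] by blast
  have "good T n (add_mset c (add_mset x C)) ({#c-1,x-1#} + ms) (\<lambda>g. f' g * f g)" using good_mult[OF f' h(1)] by simp
  moreover have "eff N (x - 1) = x - 1" using x W by (simp add: eff_def)
  then have "add_mset (x - 1) (add_mset (eff N (c - 1)) I) = image_mset (eff N) ({#c-1,x-1#} + ms)" using h(2) by simp
  ultimately show ?thesis by blast
qed

lemma end_zero:
  assumes "Rch T n {#x#} p q I" "p + q < W" "1 \<le> x" "x \<le> p" "2 * p \<le> W"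
  shows "Rch T n {#} p (Suc q) (add_mset (x - 1) (add_mset (p - 1) I))"
proof -
  obtain B C ms f where h: "em N 1 p q B ({#x#} + C)" "good T n C ms f" "I = image_mset (eff N) ms" using assms(1) unfolding Rch_def by blast
  have "eff N (p - 1) = p - 1" using assms W by (simp add: eff_def)
  moreover have "\<exists>ms' f'. good T n (add_mset p (add_mset x C)) ms' f' \<and> add_mset (x - 1) (add_mset (eff N (p - 1)) I) = image_mset (eff N) ms'"
    by (rule end_pending[OF h(2,3)]) (use assms W in auto)
  moreover have "em N 1 p (Suc q) B ({#} + add_mset p (add_mset x C))" using em_zero[OF h(1) assms(2)] by simp
  ultimately show ?thesis unfolding Rch_def by metis
qed

lemma end_one:
  assumes "Rch T n {#x#} p q I" "p + q < W" "1 \<le> x" "x \<le> Suc q" "2 * x \<le> W" "2 * q \<le> W"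
  shows "Rch T n {#} (Suc p) q (add_mset (x - 1) (add_mset (eff N (N - q - 1)) I))"
proof -
  obtain B C ms f where h: "em N 1 p q B ({#x#} + C)" "good T n C ms f" "I = image_mset (eff N) ms" using assms(1) unfolding Rch_def by blast
  have "\<exists>ms' f'. good T n (add_mset (N - q) (add_mset x C)) ms' f' \<and> add_mset (x - 1) (add_mset (eff N (N - q - 1)) I) = image_mset (eff N) ms'"
    by (rule end_pending[OF h(2,3)]) (use assms W in auto)
  moreover obtain B' where "em N 1 (Suc p) q B' (add_mset (N - q) ({#x#} + C))" using em_one[OF h(1) assms(2)] by blast
  then have "em N 1 (Suc p) q B' ({#} + add_mset (N - q) (add_mset x C))" by simp
  ultimately show ?thesis unfolding Rch_def by metis
qed

end

text \<open>The column lengths to be produced consist of K pairs of equal numbers \<open>dl k\<close> and of the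
  pairwise distinct numbers in E.\<close>

locale schedule = orth +
  fixes K :: nat and dl :: "nat \<Rightarrow> nat" and E :: "nat set"
  assumes finE: "finite E" and total: "W = 2 * K + card E"
    and dl_bound: "\<And>k. k < K \<Longrightarrow> 2 * dl k \<le> 2 * k + 1 + card {e \<in> E. e < dl k}"
    and E_bound: "\<And>e. e \<in> E \<Longrightarrow> 2 * e \<le> W"
    and parity: "odd W \<Longrightarrow> even (\<Sum>E)"
begin

definition items :: "nat \<Rightarrow> nat set \<Rightarrow> nat multiset" where
  "items k F = mset_set F + (\<Sum>i<k. {#dl i, dl i#})"

lemma items_Suc: "items (Suc k) F = add_mset (dl k) (add_mset (dl k) (items k F))"
  by (simp add: items_def)

lemma items_insert: "finite F \<Longrightarrow> e \<notin> F \<Longrightarrow> items k (insert e F) = add_mset e (items k F)"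
  by (simp add: items_def)

text \<open>k pairs and the single items in F have been produced; the remaining single items start
  at m, the size around which the counts p and q lie.\<close>

definition com :: "nat \<Rightarrow> nat \<Rightarrow> nat set \<Rightarrow> bool" where
  "com m k F \<longleftrightarrow> F \<subseteq> E \<and> k \<le> K \<and> (\<forall>e\<in>E-F. m \<le> e)"

definition fin :: bool where
  "fin \<longleftrightarrow> (\<exists>p q. p + q = W \<and> Rch T n {#} p q (items K E))"

lemma remaining: "com m k F \<Longrightarrow> W = 2 * k + card F + (2 * (K - k) + card (E - F))"
  using total finE card_mono[of E F] by (auto simp: com_def card_Diff_subset finite_subset)

lemma card_below:
  assumes "finite R" "\<forall>e\<in>R. m \<le> e" "m < v" shows "card {e \<in> R. e < v} \<le> v - m" "m \<notin> R \<Longrightarrow> card {e \<in> R. e < v} < v - m"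
proof -
  have "{e \<in> R. e < v} \<subseteq> {m..<v}" using assms by auto
  then show "card {e \<in> R. e < v} \<le> v - m" using card_mono[of "{m..<v}"] by fastforce
  assume "m \<notin> R"
  then have "{e \<in> R. e < v} \<subseteq> {Suc m..<v}" using assms by (auto simp: Suc_le_eq le_less)
  then have "card {e \<in> R. e < v} \<le> v - Suc m" using card_mono[of "{Suc m..<v}"] by fastforce
  then show "card {e \<in> R. e < v} < v - m" using assms(3) by linarith
qed

lemma dl_split:
  assumes "F \<subseteq> E" "k < K"
  shows "2 * dl k \<le> 2 * k + 1 + card F + card {e \<in> E - F. e < dl k}"
proof -
  have "{e \<in> E. e < dl k} \<subseteq> F \<union> {e \<in> E - F. e < dl k}" by auto
  then have "card {e \<in> E. e < dl k} \<le> card (F \<union> {e \<in> E - F. e < dl k})"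
    using finE assms(1) finite_subset[OF assms(1)] by (intro card_mono) auto
  also have "\<dots> \<le> card F + card {e \<in> E - F. e < dl k}" by (rule card_Un_le)
  finally show ?thesis using dl_bound[OF assms(2)] by linarith
qed

text \<open>The remaining single items below \<open>dl k\<close> are distinct and at least m, so a
  larger \<open>dl k\<close> would violate \<open>dl_bound\<close>.\<close>

lemma dl_even:
  assumes "com m k F" "k < K" "2 * k + card F = 2 * m"
  shows "dl k \<le> Suc m" "m \<notin> E - F \<Longrightarrow> dl k \<le> m"
proof -
  have R: "finite (E - F)" "\<forall>e\<in>E-F. m \<le> e" "F \<subseteq> E" using assms finE by (auto simp: com_def)
  note d = dl_split[OF R(3) assms(2)]
  show "dl k \<le> Suc m"
  proof (rule ccontr)
    assume "\<not> dl k \<le> Suc m"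
    then show False using d card_below(1)[OF R(1,2), of "dl k"] assms(3) by linarith
  qed
  assume "m \<notin> E - F"
  show "dl k \<le> m"
  proof (rule ccontr)
    assume "\<not> dl k \<le> m"
    then show False using d card_below(2)[OF R(1,2), of "dl k"] assms(3) \<open>m \<notin> E - F\<close> by linarith
  qed
qed

lemma dl_odd:
  assumes "com m k F" "k < K" "2 * k + card F + 1 = 2 * m"
  shows "dl k \<le> m"
proof (rule ccontr)
  assume "\<not> dl k \<le> m"
  have R: "finite (E - F)" "\<forall>e\<in>E-F. m \<le> e" "F \<subseteq> E" using assms finE by (auto simp: com_def)
  show False using dl_split[OF R(3) assms(2)] card_below(1)[OF R(1,2), of "dl k"] assms(3) \<open>\<not> dl k \<le> m\<close> by linarith
qed

text \<open>Being distinct and at least a, the remaining items reach at least a + card (E - F) - 1,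
  but none exceeds W / 2.\<close>

lemma top_remaining:
  assumes "com m k F" "\<forall>e\<in>E-F. a \<le> e" "E - F \<noteq> {}"
  shows "2 * (a + card (E - F) - 1) \<le> W"
proof -
  have f: "finite (E - F)" using finE by auto
  have "E - F \<subseteq> {a..Max (E - F)}" using assms(2) f by auto
  then have "card (E - F) \<le> Suc (Max (E - F)) - a" using card_mono[of "{a..Max (E - F)}"] by fastforce
  moreover have "a \<le> Max (E - F)" "2 * Max (E - F) \<le> W" using assms(2,3) f Max_in[OF f assms(3)] E_bound by auto
  ultimately show ?thesis by linarith
qed

text \<open>Here 2m items are done and p + q = 2m. By the parity condition p = q = m holds exactly
  when m plus the sum of F is even; otherwise p and q are m - 1 and m + 1, and neither letter reads
  a column of length m or N - m directly.\<close>

definition even_state :: "nat \<Rightarrow> nat \<Rightarrow> nat set \<Rightarrow> bool" where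
  "even_state m k F \<longleftrightarrow> com m k F \<and> 2 * k + card F = 2 * m \<and> (\<exists>p q. Rch T n {#} p q (items k F) \<and> even (p + \<Sum>F) \<and>
     (p = m \<and> q = m \<or> Suc p = m \<and> q = Suc m \<or> p = Suc m \<and> Suc q = m))"

text \<open>The larger of the two counts is m, so either a zero reads a column of length m or a one
  reads one of length N - m.\<close>

definition odd_state :: "nat \<Rightarrow> nat \<Rightarrow> nat set \<Rightarrow> bool" where
  "odd_state m k F \<longleftrightarrow> com m k F \<and> 2 * k + card F + 1 = 2 * m \<and> even (\<Sum>F) \<and> (\<exists>p q. Rch T n {#} p q (items k F) \<and>
     (Suc p = m \<and> q = m \<or> p = m \<and> Suc q = m))"

text \<open>In this state the column x has been read but will be used together with a later one.\<close>

definition pend_state :: "nat \<Rightarrow> nat \<Rightarrow> nat set \<Rightarrow> nat \<Rightarrow> bool" where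
  "pend_state m k F x \<longleftrightarrow> com m k (insert (x - 1) F) \<and> 2 * k + card F + 2 = 2 * m \<and> x - 1 \<in> E - F \<and> 1 \<le> x \<and> x < m \<and> even (x + \<Sum>F) \<and>
     (\<exists>p q. Rch T n {#x#} p q (items k F) \<and> even (p + x) \<and> (Suc p = m \<and> q = m \<or> p = m \<and> Suc q = m))"

lemma com_Suc: "com m k F \<Longrightarrow> m \<notin> E - F \<Longrightarrow> com (Suc m) k F"
  unfolding com_def by (metis le_antisym not_less_eq_eq)

lemma com_k: "com m k F \<Longrightarrow> k < K \<Longrightarrow> com m (Suc k) F"
  by (auto simp: com_def)

lemma com_insert: "com m k F \<Longrightarrow> e \<in> E \<Longrightarrow> com m k (insert e F)"
  by (auto simp: com_def)

lemma com_ins_Suc: "com m k F \<Longrightarrow> m \<in> E \<Longrightarrow> com (Suc m) k (insert m F)"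
  by (intro com_Suc com_insert) auto

lemma finish:
  assumes "com m k F" "2 * k + card F = W" "p + q = W" "Rch T n {#} p q (items k F)"
  shows fin
proof -
  have "k = K" "card (E - F) = 0" using remaining[OF assms(1)] assms(1,2) by (auto simp: com_def)
  then have "F = E" using finE assms(1) by (auto simp: com_def)
  then show ?thesis unfolding fin_def using assms \<open>k = K\<close> by blast
qed

lemma finF: "com m k F \<Longrightarrow> finite F"
  using finE finite_subset by (auto simp: com_def)

lemma even_stateI:
  "Rch T n {#} p q (items k F) \<Longrightarrow> even (p + \<Sum>F) \<Longrightarrow> com m k F \<Longrightarrow> 2 * k + card F = 2 * m \<Longrightarrow>
     p = m \<and> q = m \<or> Suc p = m \<and> q = Suc m \<or> p = Suc m \<and> Suc q = m \<Longrightarrow> even_state m k F"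
  unfolding even_state_def by blast

lemma odd_stateI:
  "Rch T n {#} p q (items k F) \<Longrightarrow> even (\<Sum>F) \<Longrightarrow> com m k F \<Longrightarrow> 2 * k + card F + 1 = 2 * m \<Longrightarrow>
     Suc p = m \<and> q = m \<or> p = m \<and> Suc q = m \<Longrightarrow> odd_state m k F"
  unfolding odd_state_def by blast

text \<open>If only single items were left, the largest of them would exceed W / 2.\<close>

lemma pair_available:
  assumes "com m k F" "\<forall>e\<in>E-F. a \<le> e" "2 * k + card F < W" "2 * k + card F < 2 * a - 1"
  shows "k < K"
proof (rule ccontr)
  assume "\<not> k < K"
  then have w: "W = 2 * k + card F + card (E - F)" using remaining[OF assms(1)] assms(1) by (auto simp: com_def)
  then have "E - F \<noteq> {}" using assms(3) by (metis add.right_neutral card.empty less_irrefl)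
  then show False using top_remaining[OF assms(1,2)] w assms(3,4) by linarith
qed

lemma pair_step:
  assumes R: "Rch T n P p q (items k F)" and pq: "Suc p = m \<and> q = m \<or> p = m \<and> Suc q = m"
    and W: "2 * m + 1 \<le> W" and d: "dl k \<le> m"
  shows "\<exists>p' q'. Rch T n P p' q' (items (Suc k) F) \<and> (even p' = even p) \<and> (Suc p' = Suc m \<and> q' = Suc m \<or> p' = Suc m \<and> Suc q' = Suc m)"
  using pq
proof
  assume h: "Suc p = m \<and> q = m"
  have "Rch T n P (p + 2) q (items (Suc k) F)" unfolding items_Suc using h W d by (intro pair_one[OF R]) auto
  then show ?thesis using h by (intro exI[of _ "p + 2"] exI[of _ q]) auto
next
  assume h: "p = m \<and> Suc q = m"
  have "Rch T n P p (q + 2) (items (Suc k) F)" unfolding items_Suc using h W d by (intro pair_zero[OF R]) auto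
  then show ?thesis using h by (intro exI[of _ p] exI[of _ "q + 2"]) auto
qed

text \<open>If item m remains, it is read off the larger count. Otherwise a pair is served by
  reading the rarer letter twice, which exchanges the roles of p and q.\<close>

lemma odd_step:
  assumes s: "odd_state m k F" and r: "2 * m \<le> W"
  shows "odd_state (Suc m) (Suc k) F \<or> even_state m k (insert m F)"
proof -
  obtain p q where c: "com m k F" "2 * k + card F + 1 = 2 * m" "even (\<Sum>F)" and R: "Rch T n {#} p q (items k F)"
    and pq: "Suc p = m \<and> q = m \<or> p = m \<and> Suc q = m" using s unfolding odd_state_def by blast
  note f = finF[OF c(1)]
  show ?thesis
  proof (cases "m \<in> E - F")
    case True
    have it: "items k (insert m F) = add_mset m (items k F)" using True f by (intro items_insert) auto
    have "Rch T n {#} m m (items k (insert m F))"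
      using pq
    proof
      assume h: "Suc p = m \<and> q = m"
      then show ?thesis unfolding it using single_one[OF R] r by simp
    next
      assume h: "p = m \<and> Suc q = m"
      then show ?thesis unfolding it using single_zero[OF R] r by simp
    qed
    moreover have "even (m + \<Sum>(insert m F))" using True f c(3) by simp
    ultimately have "even_state m k (insert m F)" by (rule even_stateI) (use c com_insert[OF c(1), of m] True f in auto)
    then show ?thesis by blast
  next
    case False
    have "\<forall>e\<in>E-F. Suc m \<le> e" using com_Suc[OF c(1) False] by (simp add: com_def)
    then have k: "k < K" using c(2) r by (intro pair_available[OF c(1)]) auto
    have w: "2 * m + 1 \<le> W" using remaining[OF c(1)] k c(2) by linarith
    obtain p' q' where R': "Rch T n {#} p' q' (items (Suc k) F)" and pq': "Suc p' = Suc m \<and> q' = Suc m \<or> p' = Suc m \<and> Suc q' = Suc m"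
      using pair_step[OF R pq w dl_odd[OF c(1) k c(2)]] by blast
    from R' have "odd_state (Suc m) (Suc k) F" by (rule odd_stateI) (use pq' c com_k[OF com_Suc[OF c(1) False] k] in auto)
    then show ?thesis by blast
  qed
qed

text \<open>The hard case is item m while p and q differ by two. If m + 1 remains too, it is read
  first and m then becomes readable. Otherwise a pair restores p = q, and a column of length m + 1
  is set aside, to yield m later.\<close>

lemma even_step:
  assumes s: "even_state m k F" and r: "2 * m < W"
  shows "even_state (Suc m) (Suc k) F \<or> odd_state (Suc m) k (insert m F) \<or>
    even_state (Suc m) k (insert (Suc m) (insert m F)) \<or> pend_state (m + 2) (Suc k) F (Suc m)"
proof -
  obtain p q where c: "com m k F" "2 * k + card F = 2 * m" and R: "Rch T n {#} p q (items k F)" and ev: "even (p + \<Sum>F)"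
    and pq: "p = m \<and> q = m \<or> Suc p = m \<and> q = Suc m \<or> p = Suc m \<and> Suc q = m" using s unfolding even_state_def by blast
  note f = finF[OF c(1)]
  \<comment> \<open>Repeating the rarer letter uses the larger count m + 1 twice and makes the
    counts equal.\<close>
  have mism: "Rch T n {#} (Suc m) (Suc m) (items (Suc k) F)"
    if kk: "k < K" and nn: "\<not> (p = m \<and> q = m)"
  proof -
    have w: "2 * m + 2 \<le> W" using remaining[OF c(1)] kk c(2) by linarith
    consider "Suc p = m" "q = Suc m" | "p = Suc m" "Suc q = m" using pq nn by blast
    then show ?thesis
    proof cases
      case 1
      have "Rch T n {#} (p + 2) q (items (Suc k) F)" unfolding items_Suc
        using 1 w dl_even(1)[OF c(1) kk c(2)] by (intro pair_one[OF R]) auto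
      moreover have "p + 2 = Suc m" using 1 by simp
      ultimately show ?thesis using 1 by simp
    next
      case 2
      have "Rch T n {#} p (q + 2) (items (Suc k) F)" unfolding items_Suc
        using 2 w dl_even(1)[OF c(1) kk c(2)] by (intro pair_zero[OF R]) auto
      moreover have "q + 2 = Suc m" using 2 by simp
      ultimately show ?thesis using 2 by simp
    qed
  qed
  have pm: "even p = odd m" if "\<not> (p = m \<and> q = m)" using pq that by auto
  show ?thesis
  proof (cases "m \<in> E - F")
    case False
    have "\<forall>e\<in>E-F. Suc m \<le> e" using com_Suc[OF c(1) False] by (simp add: com_def)
    then have k: "k < K" using c(2) r by (intro pair_available[OF c(1)]) auto
    have w: "2 * m + 2 \<le> W" using remaining[OF c(1)] k c(2) by linarith
    have cc: "com (Suc m) (Suc k) F" using com_k[OF com_Suc[OF c(1) False] k] .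
    have "even_state (Suc m) (Suc k) F"
    proof (cases "p = m \<and> q = m")
      case True
      have "Rch T n {#} p (q + 2) (items (Suc k) F)" unfolding items_Suc
        using True w dl_even(2)[OF c(1) k c(2) False] by (intro pair_zero[OF R]) auto
      then show ?thesis by (rule even_stateI) (use True cc c(2) ev in auto)
    next
      case False
      then have "Rch T n {#} (Suc m) (Suc m) (items (Suc k) F)" using mism k by blast
      then show ?thesis by (rule even_stateI) (use cc c(2) ev pm[OF False] in auto)
    qed
    then show ?thesis by blast
  next
    case True
    have it: "items k (insert m F) = add_mset m (items k F)" using True f by (intro items_insert) auto
    have ci: "com (Suc m) k (insert m F)" using com_ins_Suc[OF c(1)] True by blast
    have cm: "card (insert m F) = Suc (card F)" "\<Sum>(insert m F) = m + \<Sum>F" using True f by auto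
    show ?thesis
    proof (cases "p = m \<and> q = m")
      case eq: True
      have "Rch T n {#} p (Suc q) (items k (insert m F))" unfolding it using single_zero[OF R] eq r by simp
      then have "odd_state (Suc m) k (insert m F)" by (rule odd_stateI) (use ci cm c(2) ev eq in auto)
      then show ?thesis by blast
    next
      case ne: False
      show ?thesis
      proof (cases "Suc m \<in> E - F")
        case T2: True
        have it2: "items k (insert (Suc m) (insert m F)) = add_mset (Suc m) (add_mset m (items k F))"
          using T2 f it by (subst items_insert) auto
        have "2 * (m + card (E - F) - 1) \<le> W" using c(1) True by (intro top_remaining[OF c(1)]) (auto simp: com_def)
        moreover have "card {m, Suc m} \<le> card (E - F)" using True T2 finE by (intro card_mono) auto
        then have "2 \<le> card (E - F)" by simp
        ultimately have w: "2 * m + 2 \<le> W" by linarith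
        have sm: "\<Sum>(insert (Suc m) (insert m F)) = Suc m + (m + \<Sum>F)" using cm T2 f by auto
        consider "Suc p = m" "q = Suc m" | "p = Suc m" "Suc q = m" using pq ne by blast
        then have "even_state (Suc m) k (insert (Suc m) (insert m F))"
        proof cases
          case 1
          have "Rch T n {#} m (Suc m) (add_mset (Suc m) (items k F))" using single_one[OF R] 1 w by simp
          from single_zero[OF this] have "Rch T n {#} m (Suc (Suc m)) (items k (insert (Suc m) (insert m F)))"
            unfolding it2 using w by (simp add: add_mset_commute)
          then show ?thesis by (rule even_stateI) (use 1 ev sm com_insert[OF ci, of "Suc m"] T2 cm c(2) f in auto)
        next
          case 2
          have "Rch T n {#} (Suc m) m (add_mset (Suc m) (items k F))" using single_zero[OF R] 2 w by simp
          from single_one[OF this] have "Rch T n {#} (Suc (Suc m)) m (items k (insert (Suc m) (insert m F)))"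
            unfolding it2 using w by (simp add: add_mset_commute)
          then show ?thesis by (rule even_stateI) (use 2 ev sm com_insert[OF ci, of "Suc m"] T2 cm c(2) f in auto)
        qed
        then show ?thesis by blast
      next
        case F2: False
        have c2: "com (m + 2) k (insert m F)" using com_Suc[OF ci] F2 by simp
        \<comment> \<open>With no pairs left, further items would be at least m + 2 and overflow W /
          2. So m would be the last item and W odd, and then \<open>parity\<close> contradicts the
          imbalance.\<close>
        have k: "k < K"
        proof (rule ccontr)
          assume "\<not> k < K"
          then have w: "W = 2 * m + 1 + card (E - insert m F)" using remaining[OF c2] c2 cm c(2) by (auto simp: com_def)
          have "E - insert m F = {}"
          proof (rule ccontr)
            assume ne: "E - insert m F \<noteq> {}"
            have "card (E - insert m F) \<ge> 1" using ne finE by (simp add: Suc_le_eq card_gt_0_iff)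
            then show False using top_remaining[OF c2 _ ne, of "m + 2"] c2 w by (auto simp: com_def)
          qed
          moreover have "insert m F \<subseteq> E" using c2 by (simp add: com_def)
          ultimately have "E = insert m F" by blast
          moreover have "card (E - insert m F) = 0" using \<open>E - insert m F = {}\<close> by (simp only: card.empty)
          then have "odd W" using w by simp
          ultimately have "even (m + \<Sum>F)" using parity cm by simp
          then show False using ev pm[OF ne] by auto
        qed
        have "1 \<le> card (E - F)" using True finE by (auto simp: Suc_le_eq card_gt_0_iff)
        moreover have "1 \<le> K - k" using k by simp
        ultimately have "3 \<le> 2 * (K - k) + card (E - F)" by linarith
        then have w: "2 * Suc m < W" using remaining[OF c(1)] c(2) by simp
        have "Rch T n {#} (Suc m) (Suc m) (items (Suc k) F)" using mism k ne by blast
        then have "Rch T n {#Suc m#} (Suc m) (Suc (Suc m)) (items (Suc k) F)" using start_pending w by blast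
        moreover have "even (Suc m + \<Sum>F)" using ev pm[OF ne] by auto
        ultimately have "pend_state (m + 2) (Suc k) F (Suc m)"
          unfolding pend_state_def using com_k[OF c2 k] True c(2)
          by (intro conjI exI[of _ "Suc m"] exI[of _ "Suc (Suc m)"]) auto
        then show ?thesis by blast
      qed
    qed
  qed
qed

text \<open>When item m arrives, x is released against a column of length N - m + 1 or m + 1; one
  contraction takes that to N - m or m, both of effective size m. The parity of m + x shows which
  count is m, and in the unfavourable case a further pair is inserted to make the column m + 1
  readable.\<close>

lemma pend_step:
  assumes s: "pend_state m k F x" and r: "2 * m \<le> W"
  shows "pend_state (Suc m) (Suc k) F x \<or> even_state (Suc m) (Suc k) (insert m (insert (x - 1) F)) \<or>
    even_state m k (insert m (insert (x - 1) F)) \<or> fin"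
proof -
  let ?F = "insert (x - 1) F"
  obtain p q where c: "com m k ?F" "2 * k + card F + 2 = 2 * m" and x: "x - 1 \<in> E - F" "1 \<le> x" "x < m"
    and ev: "even (x + \<Sum>F)" "even (p + x)" and R: "Rch T n {#x#} p q (items k F)"
    and pq: "Suc p = m \<and> q = m \<or> p = m \<and> Suc q = m" using s unfolding pend_state_def by blast
  have f: "finite ?F" "finite F" using finF[OF c(1)] by auto
  have cm: "card ?F = Suc (card F)" "\<Sum>?F = x - 1 + \<Sum>F" using x f by auto
  have c2: "2 * k + card ?F + 1 = 2 * m" using c(2) cm by simp
  show ?thesis
  proof (cases "m \<in> E - ?F")
    case False
    have "\<forall>e\<in>E-?F. Suc m \<le> e" using com_Suc[OF c(1) False] by (simp add: com_def)
    then have k: "k < K" using c2 r by (intro pair_available[OF c(1)]) auto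
    have w: "2 * m + 1 \<le> W" using remaining[OF c(1)] k c2 by linarith
    obtain p' q' where "Rch T n {#x#} p' q' (items (Suc k) F)" "even p' = even p" "Suc p' = Suc m \<and> q' = Suc m \<or> p' = Suc m \<and> Suc q' = Suc m"
      using pair_step[OF R pq w dl_odd[OF c(1) k c2]] by blast
    then have "pend_state (Suc m) (Suc k) F x" unfolding pend_state_def
      using com_k[OF com_Suc[OF c(1) False] k] c(2) x ev by (intro conjI exI[of _ p'] exI[of _ q']) auto
    then show ?thesis by blast
  next
    case True
    have it: "items j (insert m ?F) = add_mset (x - 1) (add_mset m (items j F))" for j
      using True x f by (simp add: items_insert add_mset_commute)
    have ci: "com m k (insert m ?F)" "com (Suc m) k (insert m ?F)" using com_insert[OF c(1)] com_ins_Suc[OF c(1)] True by auto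
    have cm2: "card (insert m ?F) = card F + 2" "\<Sum>(insert m ?F) = m + (x - 1 + \<Sum>F)" using True f cm by auto
    have ev2: "even (Suc m + \<Sum>(insert m ?F))" unfolding cm2 using ev(1) x(2) by auto
    show ?thesis
    proof (cases "even (m + x)")
      case evm: True
      then have h: "p = m" "Suc q = m" using pq ev(2) by auto
      have "eff N (N - q - 1) = m" using h r W by (auto simp: eff_def)
      then have "Rch T n {#} (Suc p) q (items k (insert m ?F))"
        unfolding it using end_one[OF R] h r x by simp
      then have "even_state m k (insert m ?F)" by (rule even_stateI) (use ci cm2(1) c(2) ev2 h in auto)
      then show ?thesis by blast
    next
      case oddm: False
      then have h: "Suc p = m" "q = m" using pq ev(2) by auto
      show ?thesis
      proof (cases "k < K")
        case k: True
        have "card (E - ?F) \<ge> 1" using True finE by (auto simp: Suc_le_eq card_gt_0_iff)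
        then have w: "2 * m + 2 \<le> W" using remaining[OF c(1)] k c2 by linarith
        have "Rch T n {#x#} (p + 2) q (items (Suc k) F)" unfolding items_Suc
          using h w dl_odd[OF c(1) k c2] by (intro pair_one[OF R]) auto
        moreover have "p + 2 = Suc m" using h by simp
        ultimately have R2: "Rch T n {#x#} (Suc m) m (items (Suc k) F)" using h by simp
        have "Rch T n {#} (Suc m) (Suc m) (items (Suc k) (insert m ?F))"
          unfolding it using end_zero[OF R2] w x by simp
        then have "even_state (Suc m) (Suc k) (insert m ?F)" by (rule even_stateI) (use com_k[OF ci(2) k] cm2(1) c(2) ev2 in auto)
        then show ?thesis by blast
      next
        case nk: False
        then have w: "W + 1 = 2 * m + card (E - ?F)" using remaining[OF c(1)] c c2 by (auto simp: com_def)
        have ne: "E - ?F \<noteq> {}" using True by blast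
        then have "card (E - ?F) \<ge> 1" using finE by (simp add: Suc_le_eq card_gt_0_iff)
        moreover have "2 * (m + card (E - ?F) - 1) \<le> W" using c(1) by (intro top_remaining[OF c(1) _ ne]) (auto simp: com_def)
        \<comment> \<open>With no pairs left, m is the last item and N = 2m + 1, so the column N - q
          read by a one has length m + 1 after all.\<close>
        ultimately have W2: "W = 2 * m" using w by linarith
        have "eff N (N - q - 1) = m" using h W2 W by (auto simp: eff_def)
        then have "Rch T n {#} (Suc p) q (items k (insert m ?F))"
          unfolding it using end_one[OF R] h r x by simp
        then have fin by (intro finish[OF ci(1), of "Suc p" q]) (use cm2(1) c(2) h W2 in auto)
        then show ?thesis by blast
      qed
    qed
  qed
qed

text \<open>r is the number of columns still to be read. The pending state cannot occur at r = 0: W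
  would be odd and, since x plus the sum of F is even, the sum of E would be odd as well.\<close>

lemma run:
  "(even_state m k F \<longrightarrow> W = 2 * m + r \<longrightarrow> fin) \<and> (odd_state m k F \<longrightarrow> W + 1 = 2 * m + r \<longrightarrow> fin) \<and>
   (pend_state m k F x \<longrightarrow> W + 1 = 2 * m + r \<longrightarrow> fin)"
proof (induction r arbitrary: m k F x rule: less_induct)
  case (less r)
  have IE: "fin" if "even_state m k F" "W = 2 * m + r'" "r' < r" for m k F r' using less.IH[of r' m k F 0] that by blast
  have IO: "fin" if "odd_state m k F" "W + 1 = 2 * m + r'" "r' < r" for m k F r' using less.IH[of r' m k F 0] that by blast
  have IP: "fin" if "pend_state m k F x" "W + 1 = 2 * m + r'" "r' < r" for m k F r' x using less.IH[of r' m k F x] that by blast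
  have le: "2 * k + card F \<le> W" if "com m k F" for m k F using remaining[OF that] by linarith
  show ?case
  proof (intro conjI impI)
    assume s: "even_state m k F" and w: "W = 2 * m + r"
    show fin
    proof (cases "r = 0")
      case True
      obtain p q where "com m k F" "2 * k + card F = 2 * m" "Rch T n {#} p q (items k F)"
        "p = m \<and> q = m \<or> Suc p = m \<and> q = Suc m \<or> p = Suc m \<and> Suc q = m" using s unfolding even_state_def by blast
      then show ?thesis by (intro finish[of m k F p q]) (use True w in auto)
    next
      case False
      have l1: "fin" if "even_state (Suc m) k' F'" for k' F'
        using IE[OF that, of "r - 2"] le[of "Suc m" k' F'] that w False unfolding even_state_def by fastforce
      have l2: "fin" if "odd_state (Suc m) k' F'" for k' F'
        using IO[OF that, of "r - 1"] w False by simp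
      have l3: "fin" if "pend_state (m + 2) k' F' x'" for k' F' x'
      proof -
        have "com (m + 2) k' (insert (x' - 1) F')" "2 * k' + card F' + 2 = 2 * (m + 2)" "x' - 1 \<notin> F'"
          using that unfolding pend_state_def by blast+
        moreover note le[OF this(1)] finF[OF this(1)]
        ultimately have "2 * m + 3 \<le> W" by simp
        then show ?thesis by (intro IP[OF that, of "r - 3"]) (use w in auto)
      qed
      show ?thesis using even_step[OF s] w False l1 l2 l3 by auto
    qed
  next
    assume s: "odd_state m k F" and w: "W + 1 = 2 * m + r"
    show fin
    proof (cases "r = 0")
      case True
      obtain p q where "com m k F" "2 * k + card F + 1 = 2 * m" "Rch T n {#} p q (items k F)"
        "Suc p = m \<and> q = m \<or> p = m \<and> Suc q = m" using s unfolding odd_state_def by blast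
      then show ?thesis by (intro finish[of m k F p q]) (use True w in auto)
    next
      case False
      have l1: "fin" if "even_state m k' F'" for k' F' by (rule IE[OF that, of "r - 1"]) (use w False in auto)
      have l2: "fin" if "odd_state (Suc m) k' F'" for k' F'
        using IO[OF that, of "r - 2"] le[of "Suc m" k' F'] that w False unfolding odd_state_def by fastforce
      show ?thesis using odd_step[OF s] w False l1 l2 by auto
    qed
  next
    assume s: "pend_state m k F x" and w: "W + 1 = 2 * m + r"
    let ?F = "insert (x - 1) F"
    have c: "com m k ?F" "2 * k + card F + 2 = 2 * m" "x - 1 \<in> E - F" "1 \<le> x" "even (x + \<Sum>F)" using s unfolding pend_state_def by auto
    have f: "finite F" using finF[OF c(1)] by simp
    have cm: "card ?F = Suc (card F)" "\<Sum>?F = x - 1 + \<Sum>F" using c(3) f by auto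
    show fin
    proof (cases "r = 0")
      case True
      have "card (E - ?F) = 0" using remaining[OF c(1)] w True c(2) cm by linarith
      then have "E = ?F" using finE c(1) by (auto simp: com_def)
      moreover have "odd W" using w True by presburger
      ultimately have "even (x - 1 + \<Sum>F)" using parity cm(2) by simp
      then show ?thesis using c(4,5) by auto
    next
      case False
      have l1: "fin" if "even_state m k' F'" for k' F' by (rule IE[OF that, of "r - 1"]) (use w False in auto)
      have l2: "fin" if "even_state (Suc m) k' F'" for k' F'
      proof -
        have "2 * Suc m \<le> W" using le that unfolding even_state_def by fastforce
        then show ?thesis by (intro IE[OF that, of "r - 3"]) (use w in auto)
      qed
      have l3: "fin" if "pend_state (Suc m) k' F' x'" for k' F' x'
      proof -
        have "com (Suc m) k' (insert (x' - 1) F')" "2 * k' + card F' + 2 = 2 * Suc m" "x' - 1 \<notin> F'"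
          using that unfolding pend_state_def by blast+
        moreover note le[OF this(1)] finF[OF this(1)]
        ultimately have "2 * m + 1 \<le> W" by simp
        then show ?thesis by (intro IP[OF that, of "r - 2"]) (use w in auto)
      qed
      show ?thesis using pend_step[OF s] w False l1 l2 l3 by auto
    qed
  qed
qed

theorem fin: fin
proof -
  have "Rch T n {#} 0 0 (items 0 {})" using Rch_0 by (simp add: items_def)
  then have "even_state 0 0 {}" by (rule even_stateI) (auto simp: com_def)
  then show ?thesis using run[of 0 0 "{}" W 0] by simp
qed

end

section \<open>From the weight to its columns\<close>

text \<open>E collects the values met an odd number of times so far. When x comes again, s is the
  position of its previous copy; in a sorted list the entries before that are K complete pairs and
  the other elements of E, all smaller than x.\<close>

lemma pair_up:
  fixes xs :: "nat list"
  assumes "sorted xs"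
  shows "\<exists>K dl E. finite E \<and> length xs = 2 * K + card E \<and> mset xs = mset_set E + (\<Sum>i<K. {#dl i, dl i#}) \<and>
    (\<forall>k<K. \<exists>s<length xs. xs ! s = dl k \<and> s \<le> 2 * k + card {e \<in> E. e < dl k})"
  using assms
proof (induction xs rule: rev_induct)
  case Nil
  then show ?case by (intro exI[of _ 0] exI[of _ "\<lambda>_. 0"] exI[of _ "{}"]) auto
next
  case (snoc x xs)
  then obtain K dl E where IH: "finite E" "length xs = 2 * K + card E" "mset xs = mset_set E + (\<Sum>i<K. {#dl i, dl i#})"
    "\<And>k. k < K \<Longrightarrow> \<exists>s<length xs. xs ! s = dl k \<and> s \<le> 2 * k + card {e \<in> E. e < dl k}"
    by (auto simp: sorted_append)
  have le: "y \<le> x" if "y \<in> set xs" for y using snoc.prems that by (auto simp: sorted_append)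
  have dlx: "dl k \<le> x" if "k < K" for k using IH(4)[OF that] le nth_mem by metis
  have Ex: "e \<le> x" if "e \<in> E" for e
  proof -
    have "e \<in># mset xs" unfolding IH(3) using that IH(1) by simp
    then show ?thesis using le by simp
  qed
  have keep: "\<exists>s<length (xs @ [x]). (xs @ [x]) ! s = dl k \<and> s \<le> 2 * k + card {e \<in> E'. e < dl k}"
    if k: "k < K" and E': "{e \<in> E'. e < dl k} = {e \<in> E. e < dl k}" for k E'
    using IH(4)[OF k] unfolding E' by (auto simp: nth_append intro: less_SucI)
  show ?case
  proof (cases "x \<in> E")
    case True
    let ?E = "E - {x}" and ?dl = "dl(K := x)"
    have len: "length xs = 2 * K + card ?E + 1" using IH(1,2) True by (metis card.remove Suc_eq_plus1 add_Suc_right)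
    have m: "mset_set E = add_mset x (mset_set ?E)" using True IH(1) by (metis mset_set.remove)
    have "(\<Sum>i<Suc K. {#?dl i, ?dl i#}) = (\<Sum>i<K. {#dl i, dl i#}) + {#x, x#}" by simp
    then have 1: "mset (xs @ [x]) = mset_set ?E + (\<Sum>i<Suc K. {#?dl i, ?dl i#})" using IH(3) m by simp
    have 2: "\<exists>s<length (xs @ [x]). (xs @ [x]) ! s = ?dl k \<and> s \<le> 2 * k + card {e \<in> ?E. e < ?dl k}" if "k < Suc K" for k
    proof (cases "k = K")
      case k: True
      have "{e \<in> ?E. e < x} = ?E" using Ex by (auto simp: le_less)
      moreover have "(xs @ [x]) ! (length xs - 1) = x"
      proof -
        have "x \<in> set xs"
        proof -
          have "x \<in># mset xs" unfolding IH(3) using True IH(1) by simp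
          then show ?thesis by simp
        qed
        then have ne: "xs \<noteq> []" by auto
        then have "last xs \<le> x" using le by simp
        moreover have "x \<le> last xs" using \<open>x \<in> set xs\<close> snoc.prems by (auto simp: sorted_append in_set_conv_nth last_conv_nth ne intro!: sorted_nth_mono)
        ultimately show ?thesis using ne by (simp add: nth_append last_conv_nth)
      qed
      ultimately show ?thesis using len k by (intro exI[of _ "length xs - 1"]) auto
    next
      case False
      then have k: "k < K" using that by simp
      have "{e \<in> ?E. e < dl k} = {e \<in> E. e < dl k}" using dlx[OF k] by auto
      then show ?thesis using keep[OF k] False by simp
    qed
    show ?thesis
      by (intro exI[of _ "Suc K"] exI[of _ ?dl] exI[of _ ?E] conjI allI impI 1 2) (use IH(1) len in auto)
  next
    case False
    have "{e \<in> insert x E. e < dl k} = {e \<in> E. e < dl k}" if "k < K" for k using dlx[OF that] by auto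
    then show ?thesis using keep IH False
      by (intro exI[of _ K] exI[of _ dl] exI[of _ "insert x E"]) auto
  qed
qed

lemma conclude:
  assumes em: "em N (ofs T) p q B C" and N: "N = msize T n" and len: "p + q + 2 * ofs T = N + 1"
    and good: "good T n C ms f" and w: "\<And>H. H \<in> cartan T n \<Longrightarrow> wtm ms H = weight_val n lam H"
  shows "\<exists>W. irreducible_submodule T n W \<and> has_highest_weight T n W lam"
proof -
  obtain cs g0 where cs: "mset cs = C" "rep N cs f" "f g0 \<noteq> 0"
    and j: "\<And>A g. A \<in> lie T n \<Longrightarrow> (\<And>i j. i < j \<Longrightarrow> A i j = 0) \<Longrightarrow> jet (\<lambda>t. f (line N A g t)) (f g) (wtm ms A * f g)"
    using good unfolding good_def N[symmetric] by blast
  have "wtm ms A = 0" if "\<And>i j. i \<le> j \<Longrightarrow> A i j = 0" for A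
  proof -
    have "(\<Sum>i<m. A i i) = 0" for m using that by (intro sum.neutral) auto
    then show ?thesis unfolding wtm_def by (intro sum_mset.neutral) auto
  qed
  then show ?thesis
    using irreducible_from_function[OF _ N len cs(2,3) j _ w] em cs(1) by blast
qed

lemma cartan_skew:
  assumes "H \<in> cartan T n"
  shows "i < msize T n \<Longrightarrow> H (bar (msize T n) i) (bar (msize T n) i) = - H i i" "msize T n \<le> i \<Longrightarrow> H i i = 0"
proof -
  have H: "H \<in> lie T n" using assms by (simp add: cartan_def)
  show "msize T n \<le> i \<Longrightarrow> H i i = 0" using lie_nsupp[OF H] by (simp add: nsupp_def)
  assume i: "i < msize T n"
  have "sig T n i * H i i + sig T n i * H (bar (msize T n) i) (bar (msize T n) i) = 0"
    using H i by (auto simp: lie_iff)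
  then have "sig T n i * (H i i + H (bar (msize T n) i) (bar (msize T n) i)) = 0" by (simp add: distrib_left)
  then show "H (bar (msize T n) i) (bar (msize T n) i) = - H i i" by (simp add: add_eq_0_iff)
qed

text \<open>The diagonal of H is odd under \<open>bar\<close>, so a block of entries symmetric about
  the middle cancels; this identifies the weights of minors of sizes m and N - m.\<close>

lemma trace_eff:
  fixes T n defines "N \<equiv> msize T n"
  assumes H: "H \<in> cartan T n"
  shows "(\<Sum>i<m. H i i) = (\<Sum>i<eff N m. H i i)"
proof -
  have skew: "H (bar N i) (bar N i) = - H i i" if "i < N" for i using cartan_skew(1)[OF H] that N_def by simp
  have sym: "(\<Sum>i\<in>{a..<N - a}. H i i) = 0" for a
  proof -
    have "(\<Sum>i\<in>{a..<N - a}. H i i) = (\<Sum>i\<in>{a..<N - a}. - H i i)"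
    proof (rule sum.reindex_bij_witness[of _ "bar N" "bar N"])
      fix i assume i: "i \<in> {a..<N - a}"
      then show "bar N (bar N i) = i" "bar N i \<in> {a..<N - a}" by (auto simp: bar_def)
      then show "bar N (bar N i) = i" "bar N i \<in> {a..<N - a}" by auto
      have "H (bar N i) (bar N i) = - H i i" using i by (intro skew) auto
      then show "- H (bar N i) (bar N i) = H i i" by simp
    qed
    then show ?thesis by (simp add: sum_negf)
  qed
  show ?thesis
  proof (cases "N < m")
    case True
    have "(\<Sum>i<m. H i i) = (\<Sum>i\<in>{0..<N - 0}. H i i)"
      using True cartan_skew(2)[OF H] by (intro sum.mono_neutral_right) (auto simp: N_def)
    then show ?thesis using sym[of 0] True by (simp add: eff_def)
  next
    case False
    show ?thesis
    proof (cases "m \<le> N - m")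
      case True
      then show ?thesis by (simp add: eff_def)
    next
      case m: False
      have "(\<Sum>i<m. H i i) = (\<Sum>i\<in>{0..<N-m}. H i i) + (\<Sum>i\<in>{N-m..<m}. H i i)"
        using m False by (subst sum.atLeastLessThan_concat) (auto simp: lessThan_atLeast0)
      moreover have "{N-m..<m} = {N-m..<N-(N-m)}" using False by auto
      ultimately show ?thesis using sym[of "N-m"] m by (simp add: eff_def lessThan_atLeast0)
    qed
  qed
qed

section \<open>The conjugate partition of lam\<close>

definition col :: "nat \<Rightarrow> (nat \<Rightarrow> nat) \<Rightarrow> nat \<Rightarrow> nat" where
  "col n l j = card {i. i < n \<and> j < l i}"

lemma col_le: "col n l j \<le> n"
  unfolding col_def using card_mono[of "{..<n}" "{i. i < n \<and> j < l i}"] by auto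

lemma col_antimono: "j \<le> j' \<Longrightarrow> col n l j' \<le> col n l j"
  unfolding col_def by (intro card_mono) auto

lemma less_col_iff:
  assumes "\<And>i j. i \<le> j \<Longrightarrow> j < n \<Longrightarrow> l j \<le> l i" and i: "i < n"
  shows "i < col n l j \<longleftrightarrow> j < l i"
proof
  assume "j < l i"
  then have "{..i} \<subseteq> {i. i < n \<and> j < l i}" using assms(1)[OF _ i] i by fastforce
  then have "card {..i} \<le> col n l j" unfolding col_def by (intro card_mono) auto
  then show "i < col n l j" by simp
next
  assume h: "i < col n l j"
  show "j < l i"
  proof (rule ccontr)
    assume "\<not> j < l i"
    have "{i. i < n \<and> j < l i} \<subseteq> {..<i}"
    proof
      fix i' assume "i' \<in> {i. i < n \<and> j < l i}"
      then have "i' < n" "j < l i'" by auto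
      then show "i' \<in> {..<i}" using assms(1)[of i i'] \<open>\<not> j < l i\<close> by (cases "i \<le> i'") auto
    qed
    then have "col n l j \<le> card {..<i}" unfolding col_def by (intro card_mono) auto
    then show False using h by simp
  qed
qed

text \<open>Counting the boxes by columns and by rows. The columns run from the last to the first,
  so that lengths increase with s as the schedules expect.\<close>

lemma sum_col:
  assumes "\<And>i j. i \<le> j \<Longrightarrow> j < n \<Longrightarrow> l j \<le> l i" and W: "\<And>i. i < n \<Longrightarrow> l i \<le> W"
  shows "(\<Sum>s<W. \<Sum>i<col n l (W - 1 - s). h i) = (\<Sum>i<n. of_nat (l i) * (h i :: 'a::comm_semiring_1))"
proof -
  have "(\<Sum>s<W. \<Sum>i<col n l (W - 1 - s). h i) = (\<Sum>j<W. \<Sum>i<col n l j. h i)"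
    using sum.nat_diff_reindex[of "\<lambda>j. \<Sum>i<col n l j. h i" W] by simp
  also have "\<dots> = (\<Sum>j<W. \<Sum>i<n. if j < l i then h i else 0)"
  proof (rule sum.cong[OF refl])
    fix j
    have iff: "i < col n l j \<longleftrightarrow> j < l i" if "i < n" for i by (rule less_col_iff) (use assms(1) that in auto)
    have "(\<Sum>i<n. if j < l i then h i else 0) = (\<Sum>i\<in>{..<col n l j}. h i)"
    proof (rule sum.mono_neutral_cong_right)
      show "{..<col n l j} \<subseteq> {..<n}" using col_le[of n l j] by auto
      show "\<forall>i\<in>{..<n} - {..<col n l j}. (if j < l i then h i else 0) = 0"
      proof
        fix i assume "i \<in> {..<n} - {..<col n l j}"
        then show "(if j < l i then h i else 0) = 0" using iff[of i] by simp
      qed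
      fix i assume "i \<in> {..<col n l j}"
      then show "(if j < l i then h i else 0) = h i" using iff[of i] col_le[of n l j] by simp
    qed simp
    then show "(\<Sum>i<col n l j. h i) = (\<Sum>i<n. if j < l i then h i else 0)" by simp
  qed
  also have "\<dots> = (\<Sum>i<n. \<Sum>j<W. if j < l i then h i else 0)" by (rule sum.swap)
  also have "\<dots> = (\<Sum>i<n. of_nat (l i) * h i)"
  proof (rule sum.cong[OF refl])
    fix i assume "i \<in> {..<n}"
    then have "(\<Sum>j<W. if j < l i then h i else 0) = (\<Sum>j\<in>{..<l i}. h i)"
      using W[of i] by (intro sum.mono_neutral_cong_right) auto
    then show "(\<Sum>j<W. if j < l i then h i else 0) = of_nat (l i) * h i" by simp
  qed
  finally show ?thesis .
qed

text \<open>The row bound, applied to the lowest row that meets column j.\<close>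

lemma col_bound:
  assumes "\<And>i j. i \<le> j \<Longrightarrow> j < n \<Longrightarrow> l j \<le> l i" and b: "\<And>i. i < n \<Longrightarrow> l i + 2 * i \<le> M"
  shows "2 * col n l j + j \<le> M + 1 \<or> col n l j = 0"
proof (cases "col n l j = 0")
  case False
  then have "col n l j - 1 < n" "col n l j - 1 < col n l j" using col_le[of n l j] by linarith+
  then have "j < l (col n l j - 1)" by (subst less_col_iff[symmetric, where n = n]) (use assms(1) in auto)
  then show ?thesis using b[OF \<open>col n l j - 1 < n\<close>] False by linarith
qed simp

lemma orthogonal_case:
  assumes T: "T \<noteq> TypeC" and W: "msize T n = Suc W"
    and l: "\<And>i j. i \<le> j \<Longrightarrow> j < n \<Longrightarrow> l j \<le> l i" "\<And>i. i < n \<Longrightarrow> l i + 2 * i + 1 \<le> W"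
    and lam: "\<And>i. i < n \<Longrightarrow> lam i = real (l i)" and par: "odd W \<Longrightarrow> even (\<Sum>i<n. l i)"
  shows "\<exists>W. irreducible_submodule T n W \<and> has_highest_weight T n W lam"
proof -
  let ?N = "msize T n"
  define d where "d s = col n l (W - 1 - s)" for s
  let ?xs = "map d [0..<W]"
  have lW: "l i \<le> W" if "i < n" for i using l(2)[OF that] by simp
  \<comment> \<open>Here the coordinatewise bound by 2 rho enters: after s letters the larger of the
    two counts is at least s / 2, which is what puts \<open>d s\<close> within reach.\<close>
  have bd: "2 * d s \<le> s + 1" if "s < W" for s
    using col_bound[of n l "W - 1" "W - 1 - s", OF l(1)] l(2) that unfolding d_def by fastforce
  have sorted: "sorted ?xs"
    unfolding sorted_iff_nth_mono d_def by (auto intro!: col_antimono)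
  obtain K dl E where S: "finite E" "length ?xs = 2 * K + card E" "mset ?xs = mset_set E + (\<Sum>i<K. {#dl i, dl i#})"
    and dl: "\<forall>k<K. \<exists>s<length ?xs. ?xs ! s = dl k \<and> s \<le> 2 * k + card {e \<in> E. e < dl k}"
    using pair_up[OF sorted] by (elim exE conjE) (rule that)
  have sm: "sum_mset (mset ?xs) = (\<Sum>i<n. l i)"
  proof -
    have "sum_mset (mset ?xs) = (\<Sum>s<W. \<Sum>i<col n l (W - 1 - s). 1)"
    proof -
      have "sum_mset (mset ?xs) = (\<Sum>s<W. d s)" unfolding sum_mset_sum_list by (simp add: interv_sum_list_conv_sum_set_nat atLeast0LessThan)
      then show ?thesis by (simp add: d_def)
    qed
    then show ?thesis using sum_col[where h = "\<lambda>_. 1 :: nat", OF l(1) lW] by simp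
  qed
  interpret schedule T n W K dl E
  proof
    show "2 * dl k \<le> 2 * k + 1 + card {e \<in> E. e < dl k}" if "k < K" for k
    proof -
      obtain s where "s < W" "d s = dl k" "s \<le> 2 * k + card {e \<in> E. e < dl k}" using dl[rule_format, OF \<open>k < K\<close>] by auto
      then show ?thesis using bd[of s] by simp
    qed
    show "2 * e \<le> W" if "e \<in> E" for e
    proof -
      have "e \<in># mset ?xs" unfolding S(3) using that S(1) by simp
      then obtain s where "s < W" "e = d s" by auto
      then show ?thesis using bd[of s] by simp
    qed
    show "even (\<Sum>E)" if "odd W"
    proof -
      have "sum_mset (mset ?xs) = \<Sum>E + (\<Sum>i<K. 2 * dl i)"
      proof -
        have "sum_mset (\<Sum>i<k. {#dl i, dl i#}) = (\<Sum>i<k. 2 * dl i)" for k by (induction k) auto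
        then show ?thesis unfolding S(3) by (simp add: sum_unfold_sum_mset)
      qed
      then have "\<Sum>E + 2 * (\<Sum>i<K. dl i) = (\<Sum>i<n. l i)" unfolding sm by (simp add: sum_distrib_left)
      then show ?thesis using par[OF that] by (metis even_add even_mult_iff even_numeral)
    qed
  qed (use T W S in auto)
  obtain p q B C ms f where h: "p + q = W" "em ?N 1 p q B C" "good T n C ms f" "items K E = image_mset (eff ?N) ms"
    using fin unfolding fin_def Rch_def by auto
  have ofs: "ofs T = 1" using T by (simp add: ofs_def)
  have "wtm ms H = weight_val n lam H" if H: "H \<in> cartan T n" for H
  proof -
    have "wtm ms H = (\<Sum>v\<in>#image_mset (eff ?N) ms. \<Sum>i<v. H i i)"
      unfolding wtm_def image_mset.compositionality comp_def trace_eff[OF H, symmetric] ..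
    also have "image_mset (eff ?N) ms = mset ?xs" using h(4) S(3) by (simp add: items_def)
    also have "(\<Sum>v\<in>#mset ?xs. \<Sum>i<v. H i i) = (\<Sum>s<W. \<Sum>i<d s. H i i)"
      by (simp add: sum_unfold_sum_mset atLeast0LessThan image_mset.compositionality comp_def)
    also have "\<dots> = (\<Sum>i<n. of_nat (l i) * H i i)" unfolding d_def by (rule sum_col[OF l(1) lW])
    also have "\<dots> = weight_val n lam H" unfolding weight_val_def by (intro sum.cong) (auto simp: lam)
    finally show ?thesis .
  qed
  then show ?thesis using conclude[of ?N T p q B C n ms f lam] h W ofs by simp
qed

lemma symplectic_case:
  assumes l: "\<And>i j. i \<le> j \<Longrightarrow> j < n \<Longrightarrow> l j \<le> l i" "\<And>i. i < n \<Longrightarrow> l i + 2 * i \<le> 2 * n"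
    and lam: "\<And>i. i < n \<Longrightarrow> lam i = real (l i)" and par: "even (\<Sum>i<n. l i)"
  shows "\<exists>W. irreducible_submodule TypeC n W \<and> has_highest_weight TypeC n W lam"
proof -
  define d where "d s = col n l (2 * n - 1 - s)" for s
  have lW: "l i \<le> 2 * n" if "i < n" for i using l(2)[OF that] by simp
  have "RchS n (Suc n) n (add_mset 0 (mset (map d [0..<2*n])))"
  proof (rule RchS_all)
    show "d s \<le> d t" if "s \<le> t" for s t unfolding d_def using that by (intro col_antimono) auto
    show "2 * d s \<le> s + 2" if "s < 2 * n" for s
      using col_bound[of n l "2 * n" "2 * n - 1 - s", OF l(1)] l(2) that unfolding d_def by fastforce
    show "d s \<le> n" for s unfolding d_def by (rule col_le)
    have "(\<Sum>s<2*n. d s) = (\<Sum>s<2*n. \<Sum>i<col n l (2 * n - 1 - s). 1)" by (simp add: d_def)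
    then show "even (\<Sum>s<2*n. d s)" using sum_col[where h = "\<lambda>_. 1 :: nat" and W = "2 * n", OF l(1) lW] par by simp
  qed
  then obtain B C f where h: "em (2 * n) 0 (Suc n) n B C" "good TypeC n C (add_mset 0 (mset (map d [0..<2*n]))) f"
    unfolding RchS_def by blast
  have "wtm (add_mset 0 (mset (map d [0..<2*n]))) H = weight_val n lam H" if H: "H \<in> cartan TypeC n" for H
  proof -
    have "wtm (add_mset 0 (mset (map d [0..<2*n]))) H = (\<Sum>s<2*n. \<Sum>i<d s. H i i)"
      by (simp add: wtm_def sum_unfold_sum_mset atLeast0LessThan image_mset.compositionality comp_def)
    also have "\<dots> = (\<Sum>i<n. of_nat (l i) * H i i)" unfolding d_def by (rule sum_col[OF l(1) lW])
    also have "\<dots> = weight_val n lam H" unfolding weight_val_def by (intro sum.cong) (auto simp: lam)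
    finally show ?thesis .
  qed
  moreover have "ofs TypeC = 0" "2 * n = msize TypeC n" by (simp_all add: ofs_def msize_def)
  moreover have "Suc n + n + 2 * 0 = 2 * n + 1" by presburger
  ultimately show ?thesis using h(1) by (metis conclude[OF _ _ _ h(2)])
qed

section \<open>Integrality and parity from the dominance order\<close>

lemma sum_eps: "i < n \<Longrightarrow> (\<Sum>k<n. eps i k) = 1"
proof -
  assume "i < n"
  have "(\<Sum>k<n. eps i k) = (\<Sum>k<n. if k = i then 1 else 0)" by (simp add: eps_def)
  then show ?thesis using \<open>i < n\<close> by simp
qed

text \<open>Subtracting roots thus preserves the parity of the coordinate sum, which is even for 2
  rho.\<close>

lemma root_sum:
  assumes "\<alpha> \<in> pos_roots T n" "T \<noteq> TypeB"
  shows "(\<Sum>k<n. \<alpha> k) = 0 \<or> (\<Sum>k<n. \<alpha> k) = 2"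
  using assms by (cases T) (auto simp: pos_roots_def sum_subtractf sum.distrib sum_eps sum_distrib_left[symmetric])

lemma root_Ints: "\<alpha> \<in> pos_roots T n \<Longrightarrow> \<alpha> k \<in> \<int>"
  by (cases T) (auto simp: pos_roots_def eps_def)

lemma two_rho_even: "T \<noteq> TypeB \<Longrightarrow> \<exists>z::int. two_rho T n i = 2 * of_int z"
proof (cases T)
  case TypeC
  then show ?thesis by (intro exI[of _ "int n - int i"]) (simp add: two_rho_def)
next
  case TypeD
  then show ?thesis by (intro exI[of _ "int n - 1 - int i"]) (simp add: two_rho_def)
qed simp

lemma two_rho_Ints: "two_rho T n i \<in> \<int>"
  by (cases T) (auto simp: two_rho_def)

lemma dom_le_Ints:
  assumes "dom_le T n lam (two_rho T n)" "k < n" shows "lam k \<in> \<int>"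
proof -
  obtain c :: "(nat \<Rightarrow> real) \<Rightarrow> nat" where c: "two_rho T n k - lam k = (\<Sum>\<alpha>\<in>pos_roots T n. real (c \<alpha>) * \<alpha> k)"
    using assms unfolding dom_le_def by blast
  have "(\<Sum>\<alpha>\<in>pos_roots T n. real (c \<alpha>) * \<alpha> k) \<in> \<int>"
    by (rule Ints_sum) (auto intro!: Ints_mult dest: root_Ints)
  then have "two_rho T n k - (two_rho T n k - lam k) \<in> \<int>"
    unfolding c by (intro Ints_diff two_rho_Ints)
  then show ?thesis by simp
qed

lemma dom_le_parity:
  assumes "dom_le T n lam (two_rho T n)" "T \<noteq> TypeB" shows "\<exists>z::int. (\<Sum>k<n. lam k) = 2 * of_int z"
proof -
  obtain c :: "(nat \<Rightarrow> real) \<Rightarrow> nat" where c: "\<And>k. k < n \<Longrightarrow> two_rho T n k - lam k = (\<Sum>\<alpha>\<in>pos_roots T n. real (c \<alpha>) * \<alpha> k)"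
    using assms unfolding dom_le_def by blast
  obtain r :: "nat \<Rightarrow> int" where r: "\<And>i. two_rho T n i = 2 * of_int (r i)" using two_rho_even[OF assms(2)] by metis
  have "(\<Sum>k<n. two_rho T n k - lam k) = (\<Sum>\<alpha>\<in>pos_roots T n. \<Sum>k<n. real (c \<alpha>) * \<alpha> k)"
    by (subst sum.swap) (simp add: c)
  also have "\<dots> = (\<Sum>\<alpha>\<in>pos_roots T n. 2 * of_int (if (\<Sum>k<n. \<alpha> k) = 0 then 0 else int (c \<alpha>)))"
  proof (rule sum.cong[OF refl])
    fix \<alpha> assume "\<alpha> \<in> pos_roots T n"
    then show "(\<Sum>k<n. real (c \<alpha>) * \<alpha> k) = 2 * of_int (if (\<Sum>k<n. \<alpha> k) = 0 then 0 else int (c \<alpha>))"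
      using root_sum[OF _ assms(2)] by (auto simp: sum_distrib_left[symmetric])
  qed
  also have "\<dots> = 2 * of_int (\<Sum>\<alpha>\<in>pos_roots T n. if (\<Sum>k<n. \<alpha> k) = 0 then 0 else int (c \<alpha>))"
    by (simp only: of_int_sum sum_distrib_left)
  finally have "(\<Sum>k<n. lam k) = 2 * of_int ((\<Sum>k<n. r k) - (\<Sum>\<alpha>\<in>pos_roots T n. if (\<Sum>k<n. \<alpha> k) = 0 then 0 else int (c \<alpha>)))"
    by (simp add: sum_subtractf r sum_distrib_left[symmetric])
  then show ?thesis by blast
qed

theorem theorem3p3:
  fixes T :: lie_type and n :: nat and lam :: "nat \<Rightarrow> real"
  assumes "valid_rank T n"
    and "dominant T n lam"
    and "dom_le T n lam (two_rho T n)"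
    and "coord_le n lam (two_rho T n)"
  shows "\<exists>W. irreducible_submodule T n W \<and> has_highest_weight T n W lam"
proof -
  have n: "n \<ge> 2" using assms(1) by (cases T) (auto simp: valid_rank_def)
  \<comment> \<open>In type D the last coordinate of 2 rho is 0, so the bound on absolute values
    forces that of lam to be 0, and lam is a partition in all three types.\<close>
  have last: "lam (n - 1) \<ge> 0 \<and> (T = TypeD \<longrightarrow> lam (n - 1) = 0)"
  proof (cases T)
    case TypeD
    then have "\<bar>lam (n - 1)\<bar> \<le> 0" using assms(4) n by (auto simp: coord_le_def two_rho_def of_nat_diff dest!: spec[of _ "n - 1"])
    then show ?thesis by simp
  qed (use assms(2) in \<open>auto simp: dominant_def\<close>)
  have step: "lam (Suc i) \<le> lam i" if "Suc i < n" for i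
  proof (cases "T = TypeD \<and> i = n - 2")
    case True
    then have "Suc i = n - 1" using n by simp
    then show ?thesis using True assms(2) by (auto simp: dominant_def)
  next
    case False
    then show ?thesis using assms(2) that by (cases T) (auto simp: dominant_def)
  qed
  have anti: "lam j \<le> lam i" if "i \<le> j" "j < n" for i j
    using that
  proof (induction j rule: dec_induct)
    case (step j)
    then show ?case using \<open>\<And>i. Suc i < n \<Longrightarrow> lam (Suc i) \<le> lam i\<close>[of j] by linarith
  qed simp
  have nonneg: "lam i \<ge> 0" if "i < n" for i using anti[of i "n - 1"] last that by linarith
  define l where "l i = nat \<lfloor>lam i\<rfloor>" for i
  have lam: "lam i = real (l i)" if "i < n" for i
  proof -
    obtain z where "lam i = of_int z" using dom_le_Ints[OF assms(3) \<open>i < n\<close>] by (rule Ints_cases)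
    then show ?thesis using nonneg[OF that] by (simp add: l_def)
  qed
  have lanti: "l j \<le> l i" if "i \<le> j" "j < n" for i j
    using anti[OF that] by (auto simp: l_def intro!: nat_mono floor_mono)
  have bound: "lam i \<le> two_rho T n i" if "i < n" for i using assms(4) that by (auto simp: coord_le_def)
  have par: "even (\<Sum>i<n. l i)" if "T \<noteq> TypeB"
  proof -
    obtain z :: int where z: "(\<Sum>k<n. lam k) = 2 * of_int z" using dom_le_parity[OF assms(3) \<open>T \<noteq> TypeB\<close>] by blast
    have "(\<Sum>k<n. lam k) = of_int (int (\<Sum>i<n. l i))" by (simp add: lam)
    then have "of_int (int (\<Sum>i<n. l i)) = (of_int (2 * z) :: real)" using z by simp
    then have "int (\<Sum>i<n. l i) = 2 * z" by (simp only: of_int_eq_iff)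
    then show ?thesis by presburger
  qed
  show ?thesis
  proof (cases T)
    case TypeB
    have "l i + 2 * i + 1 \<le> 2 * n" if "i < n" for i using bound[OF that] lam[OF that] TypeB by (simp add: two_rho_def)
    then show ?thesis using TypeB by (intro orthogonal_case[of T n "2 * n" l lam] lanti lam) (auto simp: msize_def)
  next
    case TypeC
    have "l i + 2 * i \<le> 2 * n" if "i < n" for i using bound[OF that] lam[OF that] TypeC by (simp add: two_rho_def)
    then show ?thesis using TypeC par unfolding TypeC by (intro symplectic_case[of n l lam] lanti lam) auto
  next
    case TypeD
    have "l i + 2 * i + 1 \<le> 2 * n - 1" if "i < n" for i using bound[OF that] lam[OF that] TypeD that by (simp add: two_rho_def)
    then show ?thesis using TypeD par n by (intro orthogonal_case[of T n "2 * n - 1" l lam] lanti lam) (auto simp: msize_def)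
  qed
qed

end
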